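(* Let $s\in\mathbb{R}$ and let $\Phi\subset W_2^s(\mathbb{R}^d)$ be finite. Suppose $\widehat\Phi\subset L_\infty(\Omega)$ for some neighborhood $\Omega$ of the origin. Given any set $\mathcal{I}\subseteq2\pi\mathbb{Z}^d\setminus\{0\}$, denote by $k(\Phi,\mathcal{I},s)$ the order of the zero that the scalar function $$\omega\mapsto\rho_{\min}(A(\omega)),\qquad A(\omega)=\sum_{\alpha\in\mathcal{I}}\widehat\Phi(\omega+\alpha)\widehat\Phi(\omega+\alpha)^*|\omega+\alpha|^{2s},$$ has at the origin. Then the approximation order provided by the FSI space $S_\Phi(W_2^s)$ is no larger than $k(\Phi,\mathcal{I},s)/2$.
   Context: $\rho_{\min}(A)$ denotes the smallest eigenvalue of a nonnegative definite Hermitian matrix $A$. The order of the zero of a nonnegative function $F$ at the origin is understood as the largest $m$ with $F=O(|\cdot|^m)$ (a.e.) near the origin. $\widehat f(\omega)=\int f(x)e^{-i\omega\cdot x}dx$; $|\cdot|$ is the Euclidean norm. $W_2^s=W_2^s(\mathbb{R}^d)$ is the space of tempered distributions $f$ with $\widehat f$ locally in $L_2(\mathbb{R}^d)$ and $\|f\|_{W_2^s}^2=\int(1+|\omega|)^{2s}|\widehat f(\omega)|^2d\omega<\infty$. $S_\Phi(W_2^s)$ is the smallest closed subspace of $W_2^s$ containing $\Phi$ and invariant under integer translations; $\Phi$ is identified with the column vector of its elements and $\widehat\Phi$ is the vector of Fourier transforms. For $k>s$, "$S_\Phi(W_2^s)$ provides approximation order $k$" means: with $S^h=\{g(\cdot/h):g\in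 S_\Phi(W_2^s)\}$, there is a constant $C$ such that $\inf_{g\in S^h}\|f-g\|_{W_2^s}\le Ch^{k-s}\|f\|_{W_2^k}$ for every $f\in W_2^k(\mathbb{R}^d)$ and every $h>0$. *)

theory Defs
  imports "HOL-Analysis.Analysis"
begin

section \<open>Tempered distributions\<close>

definition partial_derivative :: "'a::euclidean_space \<Rightarrow> ('a \<Rightarrow> complex) \<Rightarrow> 'a \<Rightarrow> complex"
  where "partial_derivative b f x = frechet_derivative f (at x) b"

definition partial_derivatives :: "'a::euclidean_space list \<Rightarrow> ('a \<Rightarrow> complex) \<Rightarrow> 'a \<Rightarrow> complex"
  where "partial_derivatives bs f = foldr partial_derivative bs f"

definition schwartz_space :: "('a::euclidean_space \<Rightarrow> complex) set"
  where "schwartz_space =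
    {f. \<forall>bs \<in> lists Basis.
          (\<forall>x. partial_derivatives bs f differentiable (at x)) \<and>
          (\<forall>N. bounded (range (\<lambda>x. (1 + norm x) ^ N *\<^sub>R partial_derivatives bs f x)))}"

definition schwartz_seminorm :: "nat \<Rightarrow> ('a::euclidean_space \<Rightarrow> complex) \<Rightarrow> real"
  where "schwartz_seminorm N f =
    (SUP (bs, x) \<in> {bs \<in> lists Basis. length bs \<le> N} \<times> UNIV.
       (1 + norm x) ^ N * norm (partial_derivatives bs f x))"

(* Smooth functions with compact support; these are automatically Schwartz functions. *)
definition test_functions :: "('a::euclidean_space \<Rightarrow> complex) set"
  where "test_functions = {f \<in> schwartz_space. compact (closure {x. f x \<noteq> 0})}"

type_synonym 'a functional = "('a \<Rightarrow> complex) \<Rightarrow> complex"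

(* The value 0 outside the Schwartz space is only a normalization: it makes equality of
   functionals coincide with equality of distributions. *)
definition tempered_distributions :: "'a::euclidean_space functional set"
  where "tempered_distributions =
    {T. (\<forall>\<phi>. \<phi> \<notin> schwartz_space \<longrightarrow> T \<phi> = 0) \<and>
        (\<forall>\<phi>\<in>schwartz_space. \<forall>\<psi>\<in>schwartz_space. T (\<lambda>x. \<phi> x + \<psi> x) = T \<phi> + T \<psi>) \<and>
        (\<forall>\<phi>\<in>schwartz_space. \<forall>c. T (\<lambda>x. c * \<phi> x) = c * T \<phi>) \<and>
        (\<exists>N C. \<forall>\<phi>\<in>schwartz_space. norm (T \<phi>) \<le> C * schwartz_seminorm N \<phi>)}"

definition fourier_integral :: "('a::euclidean_space \<Rightarrow> complex) \<Rightarrow> 'a \<Rightarrow> complex"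
  where "fourier_integral f \<omega> = (LINT x|lborel. f x * exp (- (\<i> * complex_of_real (\<omega> \<bullet> x))))"

definition fourier_transform :: "'a::euclidean_space functional \<Rightarrow> 'a functional"
  where "fourier_transform T = (\<lambda>\<phi>. if \<phi> \<in> schwartz_space then T (fourier_integral \<phi>) else 0)"

definition locally_L2 :: "('a::euclidean_space \<Rightarrow> complex) \<Rightarrow> bool"
  where "locally_L2 F \<longleftrightarrow> F \<in> borel_measurable borel \<and>
    (\<forall>K. compact K \<longrightarrow> set_integrable lborel K (\<lambda>x. (norm (F x))\<^sup>2))"

definition represented_by :: "'a::euclidean_space functional \<Rightarrow> ('a \<Rightarrow> complex) \<Rightarrow> bool"
  where "represented_by T F \<longleftrightarrow> (\<forall>\<phi>\<in>test_functions. T \<phi> = (LINT x|lborel. F x * \<phi> x))"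

(* f(. - j), by duality *)
definition translate :: "'a::euclidean_space \<Rightarrow> 'a functional \<Rightarrow> 'a functional"
  where "translate j T = (\<lambda>\<phi>. T (\<lambda>x. \<phi> (x + j)))"

(* f(. / h), by duality *)
definition dilate :: "real \<Rightarrow> 'a::euclidean_space functional \<Rightarrow> 'a functional"
  where "dilate h T = (\<lambda>\<phi>. complex_of_real (h ^ DIM('a)) * T (\<lambda>x. \<phi> (h *\<^sub>R x)))"


section \<open>Sobolev spaces\<close>

(* A function representing the Fourier transform; it is unique up to a null set, and is
   only meaningful if the Fourier transform of the distribution is locally square integrable. *)
definition fourier_fun :: "'a::euclidean_space functional \<Rightarrow> 'a \<Rightarrow> complex"
  where "fourier_fun T = (SOME F. locally_L2 F \<and> represented_by (fourier_transform T) F)"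

definition sobolev_space :: "real \<Rightarrow> 'a::euclidean_space functional set"
  where "sobolev_space s =
    {T \<in> tempered_distributions.
       (\<exists>F. locally_L2 F \<and> represented_by (fourier_transform T) F) \<and>
       integrable lborel (\<lambda>\<omega>. (1 + norm \<omega>) powr (2 * s) * (norm (fourier_fun T \<omega>))\<^sup>2)}"

definition sobolev_norm :: "real \<Rightarrow> 'a::euclidean_space functional \<Rightarrow> real"
  where "sobolev_norm s T =
    sqrt (LINT \<omega>|lborel. (1 + norm \<omega>) powr (2 * s) * (norm (fourier_fun T \<omega>))\<^sup>2)"

definition closed_subspace :: "real \<Rightarrow> 'a::euclidean_space functional set \<Rightarrow> bool"
  where "closed_subspace s V \<longleftrightarrow>
    V \<subseteq> sobolev_space s \<and>
    (\<lambda>\<phi>. 0) \<in> V \<and>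
    (\<forall>f\<in>V. \<forall>g\<in>V. (\<lambda>\<phi>. f \<phi> + g \<phi>) \<in> V) \<and>
    (\<forall>f\<in>V. \<forall>c. (\<lambda>\<phi>. c * f \<phi>) \<in> V) \<and>
    (\<forall>f\<in>sobolev_space s.
       (\<forall>e>0. \<exists>g\<in>V. sobolev_norm s (\<lambda>\<phi>. f \<phi> - g \<phi>) < e) \<longrightarrow> f \<in> V)"


section \<open>Shift-invariant spaces and approximation order\<close>

definition integer_lattice :: "(real ^ 'd) set"
  where "integer_lattice = {j. \<forall>i. j $ i \<in> \<int>}"

definition shift_invariant :: "(real ^ 'd) functional set \<Rightarrow> bool"
  where "shift_invariant V \<longleftrightarrow> (\<forall>j\<in>integer_lattice. \<forall>f\<in>V. translate j f \<in> V)"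

definition si_space :: "real \<Rightarrow> (real ^ 'd) functional set \<Rightarrow> (real ^ 'd) functional set"
  where "si_space s \<Phi> = \<Inter>{V. closed_subspace s V \<and> shift_invariant V \<and> \<Phi> \<subseteq> V}"

definition provides_approximation_order ::
    "real \<Rightarrow> 'a::euclidean_space functional set \<Rightarrow> real \<Rightarrow> bool"
  where "provides_approximation_order s S k \<longleftrightarrow> k > s \<and>
    (\<exists>C. \<forall>f\<in>sobolev_space k. \<forall>h>0.
       (INF g\<in>dilate h ` S. sobolev_norm s (\<lambda>\<phi>. f \<phi> - g \<phi>))
         \<le> C * h powr (k - s) * sobolev_norm k f)"


section \<open>The matrices \<open>A(\<omega>)\<close> and the order of a zero\<close>

definition fourier_vec :: "('n \<Rightarrow> 'a::euclidean_space functional) \<Rightarrow> 'a \<Rightarrow> complex ^ 'n"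
  where "fourier_vec \<Phi> \<omega> = (\<chi> i. fourier_fun (\<Phi> i) \<omega>)"

(* v v^* *)
definition rank_one :: "complex ^ 'n \<Rightarrow> complex ^ 'n ^ 'n"
  where "rank_one v = (\<chi> i j. v $ i * cnj (v $ j))"

definition A_matrix ::
    "('n \<Rightarrow> 'a::euclidean_space functional) \<Rightarrow> 'a set \<Rightarrow> real \<Rightarrow> 'a \<Rightarrow> complex ^ 'n ^ 'n"
  where "A_matrix \<Phi> I s \<omega> =
    (\<Sum>\<^sub>\<infinity>\<alpha>\<in>I. norm (\<omega> + \<alpha>) powr (2 * s) *\<^sub>R rank_one (fourier_vec \<Phi> (\<omega> + \<alpha>)))"

definition eigenvalue :: "complex ^ 'n ^ 'n \<Rightarrow> complex \<Rightarrow> bool"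
  where "eigenvalue A c \<longleftrightarrow> (\<exists>v. v \<noteq> 0 \<and> A *v v = c *s v)"

(* Used for Hermitian matrices only, all of whose eigenvalues are real. *)
definition rho_min :: "complex ^ 'n ^ 'n \<Rightarrow> real"
  where "rho_min A = (LEAST r::real. eigenvalue A (complex_of_real r))"

(* The exponents m are arbitrary reals (approximation orders k are real, and may be negative if
   s is); the largest exponent is taken as a supremum in the extended reals, being infinite e.g.
   for functions vanishing near the origin. *)
definition zero_order :: "('a::euclidean_space \<Rightarrow> real) \<Rightarrow> ereal"
  where "zero_order F =
    Sup {ereal m | m. \<exists>C. \<exists>\<delta>>0. AE \<omega> in lborel. norm \<omega> < \<delta> \<longrightarrow> \<bar>F \<omega>\<bar> \<le> C * norm \<omega> powr m}"

end

theory Submission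
  imports Defs
begin

text \<open>
The obstruction to approximation is aliasing. For an element \<open>g\<close> of the shift-invariant space, the
fiber \<open>(g^(\<eta> + \<alpha>))\<close>, with \<open>\<alpha>\<close> in \<open>2\<pi>Z^d\<close>, lies for almost every \<open>\<eta>\<close> in the span of the fibers
of the generators: \<open>g^(\<eta> + \<alpha>) = \<tau> \<cdot> \<Phi>^(\<eta> + \<alpha>)\<close> with coefficients \<open>\<tau>\<close> that do not depend on \<open>\<alpha>\<close>. Since
\<open>\<Phi>^\<close> is bounded by some \<open>M\<close> near the origin, a prescribed value \<open>g^(\<eta>)\<close> needs
\<open>|\<tau>| \<ge> |g^(\<eta>)| / M\<close>, and then \<open>g\<close> unavoidably carries on the translates \<open>\<eta> + I\<close> an energy of at least
\<open>\<rho>(\<eta>) |\<tau>|\<^sup>2\<close>, where \<open>\<rho>\<close> is the smallest eigenvalue of \<open>A\<close>.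

Approximate, in the space dilated by \<open>h\<close>, a function whose Fourier transform is the indicator of
\<open>E / h\<close>, with \<open>E\<close> inside the ball of radius \<open>h\<close>. In the variable \<open>\<eta> = h\<omega>\<close> a value \<open>y\<close> of the
approximant costs \<open>|1 - y|\<^sup>2\<close> at \<open>\<eta>\<close> and, up to constants, \<open>h^(-2s) \<rho>(\<eta>) |y|\<^sup>2\<close> on the translates;
the sum is at least half of \<open>min(1, h^(-2s) \<rho>(\<eta>))\<close> whatever \<open>y\<close> is
(\<open>error_energy_lower_bound\<close>). Approximation order \<open>k\<close>
bounds the mean of this cost over \<open>E\<close> by a multiple of \<open>h^(2k - 2s)\<close> that does not depend on \<open>E\<close>
(\<open>error_energy_bound\<close>). Let \<open>E\<close> be the set where \<open>\<rho>\<close> exceeds a large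
multiple of \<open>h^(2k)\<close>. As \<open>k > s\<close>, the minimum is not attained by \<open>1\<close> for small \<open>h\<close>, and the two bounds
force \<open>E\<close> to be a null set (\<open>rho_min_bound_at_scale\<close>). Letting
\<open>h\<close> run through a geometric sequence gives \<open>\<rho>(\<eta>) = O(|\<eta>|^(2k))\<close> almost everywhere
(\<open>rho_min_zero_order\<close>).

The fibers of the elements of the space are, up to approximation, spanned by those of the generators,
for the following reason: the functions with spanned fibers form a subspace that is invariant under
integer shifts, because a shift multiplies a whole fiber by one number, and the closure of this subspace
is a closed shift-invariant space containing the generators (\<open>si_space_approximable\<close>).

The remaining work translates between distributions and functions on the frequency side. A Fourier
transform determines its representing function almost everywhere because boxes are limits of test
functions (\<open>locally_L2_unique\<close>), and every bounded Borel
function with bounded support is the Fourier transform of an element of all Sobolev spaces, by Fourier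
inversion for test functions (\<open>sobolev_space_with_fourier_fun\<close>).
\<close>

section \<open>Smooth functions\<close>

definition smooth_functions :: "('a::euclidean_space \<Rightarrow> complex) set"
  where "smooth_functions =
    {f. \<forall>bs\<in>lists Basis. \<forall>x. partial_derivatives bs f differentiable (at x)}"

lemma partial_derivatives_Nil [simp]: "partial_derivatives [] f = f"
  by (simp add: partial_derivatives_def)

lemma partial_derivatives_Cons [simp]:
  "partial_derivatives (b # bs) f = partial_derivative b (partial_derivatives bs f)"
  by (simp add: partial_derivatives_def)

lemma partial_derivatives_append:
  "partial_derivatives (bs @ cs) f = partial_derivatives bs (partial_derivatives cs f)"
  by (simp add: partial_derivatives_def)

lemma partial_derivative_eq:
  "(f has_derivative D) (at x) \<Longrightarrow> partial_derivative b f x = D b"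
  by (metis frechet_derivative_at partial_derivative_def)

lemma partial_derivative_has_derivative:
  "f differentiable (at x) \<Longrightarrow>
    \<exists>D. (f has_derivative D) (at x) \<and> (\<forall>b. partial_derivative b f x = D b)"
  by (metis frechet_derivative_works partial_derivative_def)

lemma smooth_differentiable: "f \<in> smooth_functions \<Longrightarrow> f differentiable (at x)"
  by (auto simp: smooth_functions_def dest!: bspec[where x = "[]"])

lemma smooth_partial_derivatives:
  "f \<in> smooth_functions \<Longrightarrow> bs \<in> lists Basis \<Longrightarrow> partial_derivatives bs f \<in> smooth_functions"
  by (auto simp: smooth_functions_def simp flip: partial_derivatives_append)

lemma smooth_partial_derivative:
  "f \<in> smooth_functions \<Longrightarrow> b \<in> Basis \<Longrightarrow> partial_derivative b f \<in> smooth_functions"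
  using smooth_partial_derivatives[of f "[b]"] by simp

lemma smooth_continuous_on: "f \<in> smooth_functions \<Longrightarrow> continuous_on S f"
  by (meson continuous_at_imp_continuous_on differentiable_imp_continuous_within smooth_differentiable)

lemma smooth_borel [measurable_dest]: "f \<in> smooth_functions \<Longrightarrow> f \<in> borel_measurable borel"
  by (intro borel_measurable_continuous_onI smooth_continuous_on)

text \<open>
Iterated partial derivatives never leave a class that is closed under partial differentiation, so
smoothness can be established from first derivatives alone.
\<close>

lemma smooth_coinduct:
  assumes "\<And>f x. f \<in> X \<Longrightarrow> f differentiable (at x)"
    and "\<And>f b. f \<in> X \<Longrightarrow> b \<in> Basis \<Longrightarrow> partial_derivative b f \<in> X"
  shows "X \<subseteq> smooth_functions"
proof -
  have "partial_derivatives bs f \<in> X" if "f \<in> X" "bs \<in> lists Basis" for f bs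
    using that(2,1) by (induction bs) (auto intro: assms)
  then show ?thesis
    by (auto simp: smooth_functions_def intro: assms(1))
qed

lemma partial_derivative_add:
  assumes "f differentiable (at x)" "g differentiable (at x)"
  shows "partial_derivative b (\<lambda>x. f x + g x) x = partial_derivative b f x + partial_derivative b g x"
proof -
  obtain D E where "(f has_derivative D) (at x)" "\<forall>b. partial_derivative b f x = D b"
    "(g has_derivative E) (at x)" "\<forall>b. partial_derivative b g x = E b"
    using assms partial_derivative_has_derivative by metis
  then show ?thesis
    using partial_derivative_eq[OF has_derivative_add] by metis
qed

lemma partial_derivative_mult:
  assumes "f differentiable (at x)" "g differentiable (at x)"
  shows "partial_derivative b (\<lambda>x. f x * g x) x =
    f x * partial_derivative b g x + partial_derivative b f x * g x"
proof -
  obtain D E where "(f has_derivative D) (at x)" "\<forall>b. partial_derivative b f x = D b"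
    "(g has_derivative E) (at x)" "\<forall>b. partial_derivative b g x = E b"
    using assms partial_derivative_has_derivative by metis
  then show ?thesis
    using partial_derivative_eq[OF has_derivative_mult] by metis
qed

text \<open>
A derivative is usually a combination of products rather than a member of the class one starts with.
The coinduction therefore runs in the algebra generated by the class and by all smooth functions.
\<close>

inductive_set smooth_closure :: "('a::euclidean_space \<Rightarrow> complex) set \<Rightarrow> ('a \<Rightarrow> complex) set"
  for X where
  base: "f \<in> X \<Longrightarrow> f \<in> smooth_closure X"
| smooth: "f \<in> smooth_functions \<Longrightarrow> f \<in> smooth_closure X"
| add: "f \<in> smooth_closure X \<Longrightarrow> g \<in> smooth_closure X \<Longrightarrow> (\<lambda>x. f x + g x) \<in> smooth_closure X"
| mult: "f \<in> smooth_closure X \<Longrightarrow> g \<in> smooth_closure X \<Longrightarrow> (\<lambda>x. f x * g x) \<in> smooth_closure X"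

lemma smooth_coinduct_upto:
  assumes "\<And>f x. f \<in> X \<Longrightarrow> f differentiable (at x)"
    and "\<And>f b. f \<in> X \<Longrightarrow> b \<in> Basis \<Longrightarrow> partial_derivative b f \<in> smooth_closure X"
  shows "smooth_closure X \<subseteq> smooth_functions"
proof (rule smooth_coinduct)
  show d: "f differentiable (at x)" if "f \<in> smooth_closure X" for f x
    using that by induction (auto intro: assms smooth_differentiable)
  show "partial_derivative b f \<in> smooth_closure X" if "f \<in> smooth_closure X" "b \<in> Basis" for f b
    using that
  proof induction
    case (add f g)
    then have "partial_derivative b (\<lambda>x. f x + g x) =
      (\<lambda>x. partial_derivative b f x + partial_derivative b g x)"
      by (auto intro!: partial_derivative_add d)
    then show ?case using add by (auto intro: smooth_closure.add)
  next
    case (mult f g)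
    then have "partial_derivative b (\<lambda>x. f x * g x) =
      (\<lambda>x. f x * partial_derivative b g x + partial_derivative b f x * g x)"
      by (auto intro!: partial_derivative_mult d)
    then show ?case using mult by (auto intro: smooth_closure.intros)
  qed (auto intro: assms smooth_closure.smooth smooth_partial_derivative)
qed

lemma smooth_add:
  "f \<in> smooth_functions \<Longrightarrow> g \<in> smooth_functions \<Longrightarrow> (\<lambda>x. f x + g x) \<in> smooth_functions"
  using smooth_coinduct_upto[of "{}"]
    smooth_closure.add[OF smooth_closure.smooth smooth_closure.smooth, of f g "{}"] by auto

lemma smooth_mult:
  "f \<in> smooth_functions \<Longrightarrow> g \<in> smooth_functions \<Longrightarrow> (\<lambda>x. f x * g x) \<in> smooth_functions"
  using smooth_coinduct_upto[of "{}"]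
    smooth_closure.mult[OF smooth_closure.smooth smooth_closure.smooth, of f g "{}"] by auto

lemma smooth_const: "(\<lambda>x. c) \<in> smooth_functions"
proof -
  have "range (\<lambda>c x. c) \<subseteq> (smooth_functions :: ('a \<Rightarrow> complex) set)"
  proof (rule smooth_coinduct)
    fix f :: "'a \<Rightarrow> complex" and b :: 'a assume "f \<in> range (\<lambda>c x. c)"
    then have "partial_derivative b f = (\<lambda>x. 0)"
      using partial_derivative_eq[OF has_derivative_const] by fast
    then show "partial_derivative b f \<in> range (\<lambda>c x. c)" by auto
  qed auto
  then show ?thesis by auto
qed

lemma smooth_prod:
  "(\<And>i. i \<in> A \<Longrightarrow> f i \<in> smooth_functions) \<Longrightarrow> (\<lambda>x. \<Prod>i\<in>A. f i x) \<in> smooth_functions"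
  by (induction A rule: infinite_finite_induct) (auto intro: smooth_const smooth_mult)

lemma smooth_linear:
  assumes "bounded_linear f" shows "f \<in> smooth_functions"
proof -
  have D: "(f has_derivative f) (at x)" for x
    using assms by (rule bounded_linear_imp_has_derivative)
  have "smooth_closure {f} \<subseteq> smooth_functions"
  proof (rule smooth_coinduct_upto)
    show "partial_derivative b g \<in> smooth_closure {f}" if "g \<in> {f}" for g b
    proof -
      have "partial_derivative b f = (\<lambda>x. f b)"
        using partial_derivative_eq[OF D] by blast
      then show ?thesis using that by (auto intro: smooth_closure.smooth smooth_const)
    qed
  qed (use D in \<open>auto simp: differentiable_def\<close>)
  then show ?thesis by (auto intro: smooth_closure.base)
qed

lemma smooth_exp:
  assumes "f \<in> smooth_functions" shows "(\<lambda>x. exp (f x)) \<in> smooth_functions"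
proof -
  let ?X = "{\<lambda>x. exp (f x)}"
  have D: "\<exists>D. (f has_derivative D) (at x) \<and> (\<forall>b. partial_derivative b f x = D b)" for x
    by (intro partial_derivative_has_derivative smooth_differentiable assms)
  have E: "((\<lambda>x. exp (f x)) has_derivative (\<lambda>h. D h * exp (f x))) (at x)"
    if "(f has_derivative D) (at x)" for D x
    using has_derivative_compose[OF that DERIV_exp[unfolded has_field_derivative_def]]
    by (simp add: mult.commute)
  have "smooth_closure ?X \<subseteq> smooth_functions"
  proof (rule smooth_coinduct_upto)
    show "g differentiable (at x)" if "g \<in> ?X" for g x
      using that D E unfolding differentiable_def by fast
    fix g b assume g: "g \<in> ?X" and b: "b \<in> (Basis :: 'a set)"
    have "partial_derivative b g = (\<lambda>x. partial_derivative b f x * exp (f x))"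
    proof
      fix x
      obtain D' where "(f has_derivative D') (at x)" "\<forall>b. partial_derivative b f x = D' b"
        using D by blast
      then show "partial_derivative b g x = partial_derivative b f x * exp (f x)"
        using g partial_derivative_eq[OF E] by auto
    qed
    then show "partial_derivative b g \<in> smooth_closure ?X"
      using smooth_closure.mult[OF smooth_closure.smooth smooth_closure.base[of "\<lambda>x. exp (f x)"]]
        smooth_partial_derivative[OF assms b] by auto
  qed
  then show ?thesis by (auto intro: smooth_closure.base)
qed

lemma partial_derivative_affine:
  fixes c :: real and f :: "'a::euclidean_space \<Rightarrow> complex"
  assumes "f differentiable (at (c *\<^sub>R x + a))"
  shows "(\<lambda>x. f (c *\<^sub>R x + a)) differentiable (at x)"
    and "partial_derivative b (\<lambda>x. f (c *\<^sub>R x + a)) x = c *\<^sub>R partial_derivative b f (c *\<^sub>R x + a)"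
proof -
  obtain D where D: "(f has_derivative D) (at (c *\<^sub>R x + a))"
    "\<forall>b. partial_derivative b f (c *\<^sub>R x + a) = D b"
    using partial_derivative_has_derivative assms by metis
  have "((\<lambda>x. c *\<^sub>R x + a) has_derivative (\<lambda>h. c *\<^sub>R h)) (at x)"
    by (auto intro!: derivative_eq_intros)
  from has_derivative_compose[OF this D(1)]
  have E: "((\<lambda>x. f (c *\<^sub>R x + a)) has_derivative (\<lambda>h. D (c *\<^sub>R h))) (at x)" .
  then show "(\<lambda>x. f (c *\<^sub>R x + a)) differentiable (at x)"
    by (auto simp: differentiable_def)
  show "partial_derivative b (\<lambda>x. f (c *\<^sub>R x + a)) x = c *\<^sub>R partial_derivative b f (c *\<^sub>R x + a)"
    using partial_derivative_eq[OF E, of b] D linear_simps(5)[OF has_derivative_bounded_linear[OF D(1)]]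
    by simp
qed

lemma partial_derivatives_affine:
  fixes c :: real and f :: "'a::euclidean_space \<Rightarrow> complex"
  assumes "f \<in> smooth_functions" "bs \<in> lists Basis"
  shows "partial_derivatives bs (\<lambda>x. f (c *\<^sub>R x + a)) =
    (\<lambda>x. c ^ length bs *\<^sub>R partial_derivatives bs f (c *\<^sub>R x + a))"
  using assms(2)
proof induction
  case (Cons b bs)
  then have bs: "bs \<in> lists Basis" by simp
  let ?g = "\<lambda>x. partial_derivatives bs f (c *\<^sub>R x + a)"
  have d: "?g differentiable (at x)" "partial_derivative b ?g x = c *\<^sub>R partial_derivatives (b # bs) f (c *\<^sub>R x + a)" for x
    using partial_derivative_affine[OF smooth_differentiable[OF smooth_partial_derivatives[OF assms(1) bs]]]
    by auto
  have "partial_derivative b (\<lambda>x. c ^ length bs *\<^sub>R ?g x) x = c ^ length bs *\<^sub>R partial_derivative b ?g x" for x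
    using partial_derivative_mult[of "\<lambda>_. of_real (c ^ length bs)" x ?g b] d(1)
    by (simp add: scaleR_conv_of_real partial_derivative_eq[OF has_derivative_const])
  then show ?case by (simp add: Cons d mult.commute fun_eq_iff)
qed simp

lemma smooth_affine:
  fixes c :: real and f :: "'a::euclidean_space \<Rightarrow> complex"
  assumes "f \<in> smooth_functions"
  shows "(\<lambda>x. f (c *\<^sub>R x + a)) \<in> smooth_functions"
proof -
  have "(\<lambda>x. k *\<^sub>R partial_derivatives bs f (c *\<^sub>R x + a)) differentiable (at x)"
    if "bs \<in> lists Basis" for k :: real and bs x
    using partial_derivative_affine(1)[OF smooth_differentiable[OF smooth_partial_derivatives[OF assms that]]]
    by (rule differentiable_scaleR[OF differentiable_const])
  then show ?thesis
    by (auto simp: smooth_functions_def partial_derivatives_affine[OF assms])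
qed

subsection \<open>Test functions\<close>

lemma schwartz_smooth: "f \<in> schwartz_space \<Longrightarrow> f \<in> smooth_functions"
  by (auto simp: schwartz_space_def smooth_functions_def)

text \<open>
Outside the closed support the function vanishes on a neighbourhood, so differentiation does not
enlarge the closed support.
\<close>

lemma partial_derivative_zero_outside:
  assumes "x \<notin> closure {x. f x \<noteq> 0}"
  shows "partial_derivative b f x = 0"
proof -
  have "(f has_derivative (\<lambda>h. 0)) (at x)"
    by (rule has_derivative_transform_within_open[of "\<lambda>_. 0" _ _ _ "- closure {x. f x \<noteq> 0}"])
       (use assms closure_subset[of "{x. f x \<noteq> 0}"] in auto)
  then show ?thesis by (rule partial_derivative_eq)
qed

lemma closure_support_partial_derivatives:
  "closure {x. partial_derivatives bs f x \<noteq> 0} \<subseteq> closure {x. f x \<noteq> 0}"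
proof (induction bs)
  case (Cons b bs)
  have "{x. partial_derivatives (b # bs) f x \<noteq> 0} \<subseteq> closure {x. partial_derivatives bs f x \<noteq> 0}"
    using partial_derivative_zero_outside by fastforce
  then show ?case using Cons by (meson closure_minimal closed_closure order_trans)
qed simp

text \<open>
A continuous function with bounded support is bounded on a compact set and zero elsewhere, so the decay
required of Schwartz functions comes for free.
\<close>

lemma test_functions_eq:
  "test_functions = {f \<in> smooth_functions. bounded {x. f x \<noteq> 0}}"
proof -
  have "f \<in> schwartz_space" if f: "f \<in> smooth_functions" "bounded {x. f x \<noteq> 0}"
    for f :: "'a \<Rightarrow> complex"
  proof -
    have "bounded (range (\<lambda>x. (1 + norm x) ^ N *\<^sub>R partial_derivatives bs f x))"
      if "bs \<in> lists Basis" for bs N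
    proof -
      let ?g = "\<lambda>x. (1 + norm x) ^ N *\<^sub>R partial_derivatives bs f x" and ?K = "closure {x. f x \<noteq> 0}"
      have "compact (?g ` ?K)"
        using f that by (intro compact_closure[THEN iffD2] compact_continuous_image continuous_intros
            smooth_continuous_on smooth_partial_derivatives)
      moreover have "?g x \<in> insert 0 (?g ` ?K)" for x
        using closure_support_partial_derivatives[of bs f] closure_subset[of "{x. partial_derivatives bs f x \<noteq> 0}"]
        by auto
      ultimately show ?thesis
        by (meson bounded_insert bounded_subset compact_imp_bounded image_subsetI)
    qed
    with f show ?thesis by (auto simp: schwartz_space_def smooth_functions_def)
  qed
  then show ?thesis unfolding test_functions_def compact_closure by (blast intro: schwartz_smooth)
qed

lemma test_smooth: "f \<in> test_functions \<Longrightarrow> f \<in> smooth_functions"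
  and test_schwartz: "f \<in> test_functions \<Longrightarrow> f \<in> schwartz_space"
  by (simp add: test_functions_eq) (simp add: test_functions_def)

lemma test_mult_smooth:
  assumes "g \<in> smooth_functions" "f \<in> test_functions"
  shows "(\<lambda>x. g x * f x) \<in> test_functions"
  using assms unfolding test_functions_eq
  by (auto intro!: smooth_mult elim!: bounded_subset)

lemma test_partial_derivative:
  assumes "f \<in> test_functions" "b \<in> Basis"
  shows "partial_derivative b f \<in> test_functions"
proof -
  have "{x. partial_derivative b f x \<noteq> 0} \<subseteq> closure {x. f x \<noteq> 0}"
    using partial_derivative_zero_outside by blast
  then show ?thesis
    using assms bounded_subset[OF bounded_closure] by (auto simp: test_functions_eq smooth_partial_derivative)
qed

lemma test_bounded_support:
  assumes "f \<in> test_functions"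
  obtains R where "R > 0" "\<And>x. norm x > R \<Longrightarrow> f x = 0"
proof -
  have "bounded {x. f x \<noteq> 0}"
    using assms by (simp add: test_functions_eq)
  then obtain R where "R > 0" "\<forall>x\<in>{x. f x \<noteq> 0}. norm x \<le> R"
    using bounded_pos by blast
  then show ?thesis using that by force
qed

lemma test_functionI:
  assumes "f \<in> smooth_functions" "\<And>x. norm x > R \<Longrightarrow> f x = 0"
  shows "f \<in> test_functions"
proof -
  have "bounded {x. f x \<noteq> 0}"
    using assms(2) by (auto simp: bounded_iff intro!: exI[of _ R]) (meson not_le)
  then show ?thesis using assms(1) by (simp add: test_functions_eq)
qed

lemma test_affine:
  fixes c :: real and f :: "'a::euclidean_space \<Rightarrow> complex"
  assumes "f \<in> test_functions" "c \<noteq> 0"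
  shows "(\<lambda>x. f (c *\<^sub>R x + a)) \<in> test_functions"
proof -
  obtain R where R: "R > 0" "\<And>x. norm x > R \<Longrightarrow> f x = 0"
    using test_bounded_support[OF assms(1)] by blast
  show ?thesis
  proof (rule test_functionI[where R = "(R + norm a) / \<bar>c\<bar>"])
    fix x :: 'a assume "norm x > (R + norm a) / \<bar>c\<bar>"
    then have "norm (c *\<^sub>R x) > R + norm a"
      using assms(2) by (simp add: field_simps)
    then have "norm (c *\<^sub>R x + a) > R"
      using norm_diff_ineq[of "c *\<^sub>R x" a] by simp
    then show "f (c *\<^sub>R x + a) = 0" by (rule R)
  qed (use assms in \<open>simp add: smooth_affine test_smooth\<close>)
qed

lemma test_bounded:
  assumes "f \<in> test_functions"
  obtains B where "B > 0" "\<And>x. norm (f x) \<le> B"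
proof -
  have "bounded (range f)"
    using test_schwartz[OF assms] unfolding schwartz_space_def
    by (auto dest!: bspec[where x = "[]"] spec[where x = 0])
  then show ?thesis using that by (auto simp: bounded_pos)
qed

lemma test_integrable:
  assumes "f \<in> test_functions"
  shows "integrable lborel f"
proof -
  obtain R where R: "R > 0" "\<And>x. norm x > R \<Longrightarrow> f x = 0"
    using test_bounded_support[OF assms(1)] by blast
  have "integrable lborel (\<lambda>x. indicator (cball 0 R) x *\<^sub>R f x)"
    by (intro borel_integrable_compact compact_cball smooth_continuous_on test_smooth assms)
  also have "(\<lambda>x. indicator (cball 0 R) x *\<^sub>R f x) = f"
    using R(2) by (auto simp: fun_eq_iff indicator_def)
  finally show ?thesis .
qed

section \<open>Test functions approximating boxes\<close>

text \<open>
For \<open>n = 0\<close> this is the standard function that is flat at the origin. The powers of \<open>1 / t\<close> make the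
family closed, up to linear combinations, under differentiation, which settles smoothness of all its
members simultaneously.
\<close>

definition flat_exp :: "nat \<Rightarrow> real \<Rightarrow> real"
  where "flat_exp n t = (if t > 0 then exp (- inverse t) * inverse t ^ n else 0)"

lemma flat_exp_tendsto_0: "(flat_exp n \<longlongrightarrow> 0) (at 0)"
proof (rule filterlim_split_at_real)
  show "(flat_exp n \<longlongrightarrow> 0) (at_left 0)"
    by (rule tendsto_eventually) (auto simp: eventually_at_filter flat_exp_def)
  have "((\<lambda>t. inverse t ^ n / exp (inverse t)) \<longlongrightarrow> (0::real)) (at_right 0)"
    by (rule filterlim_compose[OF tendsto_power_div_exp_0 filterlim_inverse_at_top_right])
  moreover have "\<forall>\<^sub>F t in at_right 0. inverse t ^ n / exp (inverse t) = flat_exp n t"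
    by (auto simp: eventually_at_filter flat_exp_def exp_minus power_inverse divide_inverse mult.commute)
  ultimately show "(flat_exp n \<longlongrightarrow> 0) (at_right 0)"
    by (rule Lim_transform_eventually)
qed

lemma flat_exp_has_derivative:
  "(flat_exp n has_real_derivative flat_exp (n + 2) t - n * flat_exp (n + 1) t) (at t)"
proof -
  consider "t > 0" | "t < 0" | "t = 0" by linarith
  then show ?thesis
  proof cases
    case 1
    have "((\<lambda>t. exp (- inverse t) * inverse t ^ n) has_real_derivative
        exp (- inverse t) * inverse t ^ (n + 2) - n * (exp (- inverse t) * inverse t ^ (n + 1))) (at t)"
    proof (cases n)
      case 0
      then show ?thesis
        using 1 by (auto intro!: derivative_eq_intros simp: power2_eq_square)
    next
      case (Suc m)
      have "((\<lambda>t. inverse t ^ Suc m) has_real_derivative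
          of_nat (Suc m) * (- (inverse t ^ 2) * inverse t ^ m)) (at t)"
        using 1 DERIV_power[OF DERIV_inverse[of t], of "Suc m"] by (simp add: numeral_2_eq_2)
      moreover have "((\<lambda>t. exp (- inverse t)) has_real_derivative exp (- inverse t) * inverse t ^ 2) (at t)"
        using 1 by (auto intro!: derivative_eq_intros simp: power2_eq_square)
      ultimately have "((\<lambda>t. exp (- inverse t) * inverse t ^ Suc m) has_real_derivative
          exp (- inverse t) * inverse t ^ 2 * inverse t ^ Suc m
          + of_nat (Suc m) * (- (inverse t ^ 2) * inverse t ^ m) * exp (- inverse t)) (at t)"
        using DERIV_mult by blast
      then show ?thesis
        unfolding Suc by (rule DERIV_cong) (simp add: power2_eq_square algebra_simps)
    qed
    then have "((\<lambda>t. exp (- inverse t) * inverse t ^ n) has_real_derivative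
        flat_exp (n + 2) t - n * flat_exp (n + 1) t) (at t)"
      using 1 by (simp add: flat_exp_def)
    then show ?thesis
      by (rule has_field_derivative_transform_within_open[where S = "{0<..}"])
         (use 1 in \<open>auto simp: flat_exp_def\<close>)
  next
    case 2
    have "((\<lambda>_. 0) has_real_derivative flat_exp (n + 2) t - n * flat_exp (n + 1) t) (at t)"
      using 2 by (auto simp: flat_exp_def)
    then show ?thesis
      by (rule has_field_derivative_transform_within_open[where S = "{..<0}"])
         (use 2 in \<open>auto simp: flat_exp_def\<close>)
  next
    case 3
    have "(flat_exp n (0 + h) - flat_exp n 0) / h = flat_exp (n + 1) h" for h
      by (simp add: flat_exp_def divide_inverse)
    moreover have "flat_exp m 0 = 0" for m
      by (simp add: flat_exp_def)
    ultimately show ?thesis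
      unfolding 3 DERIV_def using flat_exp_tendsto_0[of "n + 1"] by simp
  qed
qed

lemma smooth_flat_exp:
  "(\<lambda>x :: 'a::euclidean_space. complex_of_real (flat_exp n (v \<bullet> x + a))) \<in> smooth_functions"
proof -
  let ?f = "\<lambda>n (v::'a) a x. complex_of_real (flat_exp n (v \<bullet> x + a))"
  let ?X = "{?f n v a | n v a. True}"
  have D: "(?f n v a has_derivative (\<lambda>h. of_real ((flat_exp (n + 2) (v \<bullet> x + a) -
      n * flat_exp (n + 1) (v \<bullet> x + a)) * (v \<bullet> h)))) (at x)" for n v a and x :: 'a
  proof -
    have "((\<lambda>x. v \<bullet> x + a) has_derivative (\<lambda>h. v \<bullet> h)) (at x)"
      by (auto intro!: derivative_eq_intros)
    from has_derivative_compose[OF this flat_exp_has_derivative[of n, unfolded has_field_derivative_def]]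
    show ?thesis by (rule has_derivative_of_real)
  qed
  have "smooth_closure ?X \<subseteq> smooth_functions"
  proof (rule smooth_coinduct_upto)
    show "g differentiable (at x)" if g: "g \<in> ?X" for g and x :: 'a
    proof -
      obtain n v a where "g = ?f n v a" using g by auto
      then show ?thesis using D[of n v a x] unfolding differentiable_def by blast
    qed
    fix g b assume "g \<in> ?X" "b \<in> (Basis :: 'a set)"
    then obtain n v a where g: "g = ?f n v a" by auto
    have c: "(\<lambda>x. c) \<in> smooth_closure ?X" for c
      by (intro smooth_closure.smooth smooth_const)
    have "partial_derivative b g =
        (\<lambda>x. of_real (v \<bullet> b) * ?f (n + 2) v a x + of_real (- n * (v \<bullet> b)) * ?f (n + 1) v a x)"
      using partial_derivative_eq[OF D] unfolding g by (auto simp: fun_eq_iff algebra_simps)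
    moreover have "?f n v a \<in> smooth_closure ?X" for n v a
      by (rule smooth_closure.base) auto
    ultimately show "partial_derivative b g \<in> smooth_closure ?X"
      by (simp only:) (intro smooth_closure.add smooth_closure.mult c)
  qed
  then show ?thesis by (blast intro: smooth_closure.base)
qed

lemma flat_exp_0_bounds: "0 \<le> flat_exp 0 t" "flat_exp 0 t \<le> 1" "t \<le> 0 \<Longrightarrow> flat_exp 0 t = 0"
    "t > 0 \<Longrightarrow> flat_exp 0 t > 0"
  by (auto simp: flat_exp_def)

lemma flat_exp_0_scaled_tendsto:
  "(\<lambda>n. flat_exp 0 (real (Suc n) * t)) \<longlonglongrightarrow> (if t > 0 then 1 else 0)"
proof (cases "t > 0")
  case True
  have "(\<lambda>n. exp (- (inverse (real (Suc n)) * (1 / t)))) \<longlonglongrightarrow> exp (- (0 * (1 / t)))"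
    by (intro tendsto_intros LIMSEQ_inverse_real_of_nat)
  then show ?thesis using True by (simp add: flat_exp_def divide_inverse)
next
  case False
  then have "real (Suc n) * t \<le> 0" for n by (simp add: mult_nonneg_nonpos)
  then show ?thesis using False by (simp add: flat_exp_0_bounds del: of_nat_Suc)
qed

text \<open>
Stretching the argument by a growing factor drives \<open>exp (-1 / t)\<close> to \<open>1\<close> for positive \<open>t\<close> and leaves the value \<open>0\<close>
elsewhere. The product over the faces of the box consists of such functions of the signed distances to
the faces.
\<close>

lemma test_functions_approximate_box:
  fixes l u :: "'a::euclidean_space"
  obtains \<psi> where "\<And>n. \<psi> n \<in> test_functions" "\<And>n x. \<psi> n x \<in> \<real>" "\<And>n x. x \<in> box l u \<Longrightarrow> Re (\<psi> n x) > 0"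
    "\<And>n x. norm (\<psi> n x) \<le> indicator (box l u) x"
    "\<And>x. (\<lambda>n. \<psi> n x) \<longlonglongrightarrow> indicator (box l u) x"
proof -
  define q where "q n x = (\<Prod>b\<in>Basis. flat_exp 0 (real (Suc n) * ((x - l) \<bullet> b)) *
    flat_exp 0 (real (Suc n) * ((u - x) \<bullet> b)))" for n and x :: 'a
  have q0: "0 \<le> q n x" for n x
    unfolding q_def by (intro prod_nonneg) (simp add: flat_exp_0_bounds)
  have q1: "q n x \<le> 1" for n x
    unfolding q_def by (intro prod_le_1) (simp add: flat_exp_0_bounds mult_le_one)
  have qz: "q n x = 0" if x: "x \<notin> box l u" for n x
  proof -
    obtain b where "b \<in> Basis" "\<not> (l \<bullet> b < x \<bullet> b \<and> x \<bullet> b < u \<bullet> b)"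
      using x unfolding box_def by blast
    then have b: "b \<in> Basis" "(x - l) \<bullet> b \<le> 0 \<or> (u - x) \<bullet> b \<le> 0"
      by (auto simp: inner_diff_left)
    then have "real (Suc n) * ((x - l) \<bullet> b) \<le> 0 \<or> real (Suc n) * ((u - x) \<bullet> b) \<le> 0"
      by (metis mult_nonneg_nonpos of_nat_0_le_iff)
    then show ?thesis
      unfolding q_def using b(1) flat_exp_0_bounds(3) by (intro prod_zero) (auto simp del: of_nat_Suc)
  qed
  have pos: "q n x > 0" if "x \<in> box l u" for n x
    unfolding q_def
    by (intro prod_pos mult_pos_pos flat_exp_0_bounds(4)) (use that in \<open>auto simp: box_def inner_diff_left simp del: of_nat_Suc\<close>)
  have lim: "(\<lambda>n. q n x) \<longlonglongrightarrow> indicator (box l u) x" for x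
  proof (cases "x \<in> box l u")
    case True
    have "(\<lambda>n. q n x) \<longlonglongrightarrow> (\<Prod>b\<in>Basis. (if (x - l) \<bullet> b > 0 then 1 else 0) * (if (u - x) \<bullet> b > 0 then 1 else 0))"
      unfolding q_def by (intro tendsto_intros flat_exp_0_scaled_tendsto)
    also have "(\<Prod>b\<in>Basis. (if (x - l) \<bullet> b > 0 then 1 else 0) * (if (u - x) \<bullet> b > 0 then 1 else (0::real))) = 1"
      using True by (intro prod.neutral) (auto simp: box_def inner_diff_left)
    finally show ?thesis using True by simp
  qed (simp add: qz)
  have smooth: "(\<lambda>x. complex_of_real (q n x)) \<in> smooth_functions" for n
  proof -
    have "(\<lambda>x. complex_of_real (q n x)) = (\<lambda>x. \<Prod>b\<in>Basis.
        of_real (flat_exp 0 ((real (Suc n) *\<^sub>R b) \<bullet> x + - real (Suc n) * (l \<bullet> b))) *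
        of_real (flat_exp 0 ((- real (Suc n) *\<^sub>R b) \<bullet> x + real (Suc n) * (u \<bullet> b))))"
      by (auto simp: q_def fun_eq_iff inner_diff_left inner_diff_right inner_commute right_diff_distrib
          simp del: of_nat_Suc intro!: prod.cong)
    also have "\<dots> \<in> smooth_functions"
      by (intro smooth_prod smooth_mult smooth_flat_exp)
    finally show ?thesis .
  qed
  obtain R where R: "\<And>x. x \<in> box l u \<Longrightarrow> norm x \<le> R"
    using bounded_box[of l u] unfolding bounded_iff by blast
  show thesis
  proof (rule that)
    show "(\<lambda>x. complex_of_real (q n x)) \<in> test_functions" for n
      using R by (intro test_functionI[OF smooth, of R]) (metis leD of_real_0 qz)
    show "norm (complex_of_real (q n x)) \<le> indicator (box l u) x" for n x
      by (cases "x \<in> box l u") (auto simp: q0 q1 qz)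
    show "(\<lambda>n. complex_of_real (q n x)) \<longlonglongrightarrow> indicator (box l u) x" for x
      using tendsto_of_real[OF lim[of x], where 'a = complex] by (cases "x \<in> box l u") auto
  qed (auto simp: pos)
qed

section \<open>Uniqueness of representing functions\<close>

lemma locally_L2_borel: "locally_L2 F \<Longrightarrow> F \<in> borel_measurable borel"
  by (simp add: locally_L2_def)

lemma locally_L2_integrable:
  assumes F: "locally_L2 F" and "compact K"
    and [measurable]: "g \<in> borel_measurable borel" and g: "\<And>x. norm (g x) \<le> B * indicator K x"
  shows "integrable lborel (\<lambda>x. F x * g x)"
proof (rule Bochner_Integration.integrable_bound)
  have [measurable]: "F \<in> borel_measurable borel" using F by (rule locally_L2_borel)
  show "(\<lambda>x. F x * g x) \<in> borel_measurable lborel" by simp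
  have "emeasure lborel K < \<infinity>"
    using assms(2) emeasure_compact_finite by auto
  then have "integrable lborel (indicat_real K)"
    using assms(2) by (simp add: compact_imp_closed)
  then show "integrable lborel (\<lambda>x. B * (indicator K x + indicator K x *\<^sub>R (norm (F x))\<^sup>2))"
    using assms(1,2) unfolding locally_L2_def set_integrable_def by (intro integrable_mult_right Bochner_Integration.integrable_add) auto
  show "AE x in lborel. norm (F x * g x) \<le> norm (B * (indicator K x + indicator K x *\<^sub>R (norm (F x))\<^sup>2))"
  proof (intro AE_I2)
    fix x
    have "0 \<le> (norm (F x) - 1)\<^sup>2" by simp
    then have n: "norm (F x) \<le> 1 + (norm (F x))\<^sup>2"
      using norm_ge_zero[of "F x"] by (simp add: power2_eq_square algebra_simps del: norm_ge_zero)
    show "norm (F x * g x) \<le> norm (B * (indicator K x + indicator K x *\<^sub>R (norm (F x))\<^sup>2))"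
    proof (cases "x \<in> K")
      case True
      then have "norm (g x) \<le> \<bar>B\<bar>" using g[of x] by simp
      with n have "norm (F x) * norm (g x) \<le> (1 + (norm (F x))\<^sup>2) * \<bar>B\<bar>"
        by (intro mult_mono) auto
      then show ?thesis using True by (simp add: norm_mult abs_mult mult.commute)
    qed (use g[of x] in simp)
  qed
qed

lemma locally_L2_test_integrable:
  assumes "locally_L2 F" "f \<in> test_functions"
  shows "integrable lborel (\<lambda>x. F x * f x)"
proof -
  obtain B where B: "B > 0" "\<And>x. norm (f x) \<le> B" using test_bounded assms(2) by blast
  obtain R where R: "R > 0" "\<And>x. norm x > R \<Longrightarrow> f x = 0" using test_bounded_support assms(2) by blast
  show ?thesis
    by (rule locally_L2_integrable[of _ "cball 0 R" _ B])
       (use assms B R(2) in \<open>auto simp: test_smooth smooth_borel indicator_def not_le\<close>)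
qed

text \<open>
Fix one box. The Borel sets on whose intersection with it \<open>D\<close> has integral zero form a Dynkin system;
it contains the boxes, which are closed under intersection and generate the Borel sets.
\<close>

lemma vanishing_box_integrals:
  fixes D :: "'a::euclidean_space \<Rightarrow> complex"
  assumes int: "\<And>l u. integrable lborel (\<lambda>x. indicator (box l u) x *\<^sub>R D x)"
    and zero: "\<And>l u. (LINT x|lborel. indicator (box l u) x *\<^sub>R D x) = 0"
  shows "AE x in lborel. D x = 0"
proof -
  have *: "AE x in lborel. x \<in> box l u \<longrightarrow> D x = 0" for l u
  proof -
    define E where "E x = indicator (box l u) x *\<^sub>R D x" for x
    have E: "integrable lborel E" unfolding E_def by (rule int)
    then have iE: "integrable lborel (\<lambda>x. indicat_real A x *\<^sub>R E x)" if "A \<in> sets borel" for A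
      using that by (intro integrable_mult_indicator) auto
    have Z: "(LINT x|lborel. indicat_real A x *\<^sub>R E x) = 0" if "A \<in> sets borel" for A
    proof -
      have A: "A \<in> sigma_sets UNIV (range (\<lambda>(a, b). box a b :: 'a set))"
        using that by (simp add: borel_eq_box)
      have stable: "Int_stable (range (\<lambda>(a, b). box a b :: 'a set))"
        by (auto simp: Int_stable_def box_Int_box)
      have "range (\<lambda>(a, b). box a b :: 'a set) \<subseteq> Pow UNIV" by simp
      note induct = sigma_sets_induct_disjoint[OF stable this, consumes 1, case_names basic empty compl union]
      from A show ?thesis
      proof (induction rule: induct)
        case (basic A)
        then obtain a b where "A = box a b" by auto
        moreover obtain a' b' where "box a b \<inter> box l u = box a' b'"
          by (rule that[OF box_Int_box])
        ultimately have "indicat_real A x *\<^sub>R E x = indicator (box a' b') x *\<^sub>R D x" for x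
          by (auto simp: E_def indicator_def)
        then show ?case by (simp add: zero)
      next
        case empty show ?case by simp
      next
        case (compl A)
        then have A: "A \<in> sets borel" by (simp add: borel_eq_box)
        have "indicat_real (UNIV - A) x *\<^sub>R E x = E x - indicat_real A x *\<^sub>R E x" for x
          by (auto simp: indicator_def)
        then show ?case
          using compl E iE[OF A] zero[of l u] by (simp flip: E_def)
      next
        case (union A)
        then have A: "A i \<in> sets borel" for i by (auto simp: borel_eq_box)
        have "set_lebesgue_integral lborel (\<Union>i. A i) E = (\<Sum>i. set_lebesgue_integral lborel (A i) E)"
          using union(1) A iE by (intro lebesgue_integral_countable_add) (auto simp: disjoint_family_on_def set_integrable_def)
        then show ?case using union(3) by (simp add: set_lebesgue_integral_def)
      qed
    qed
    have "AE x in lborel. Re (E x) = 0"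
    proof (rule density_unique_real)
      show "(LINT x:A|lborel. Re (E x)) = (LINT x:A|lborel. 0)" if "A \<in> sets lborel" for A
        using arg_cong[OF Z, of A Re] that iE[of A] integral_Re[of lborel "\<lambda>x. indicat_real A x *\<^sub>R E x"]
        by (simp add: set_lebesgue_integral_def)
    qed (use E in auto)
    moreover have "AE x in lborel. Im (E x) = 0"
    proof (rule density_unique_real)
      show "(LINT x:A|lborel. Im (E x)) = (LINT x:A|lborel. 0)" if "A \<in> sets lborel" for A
        using arg_cong[OF Z, of A Im] that iE[of A] integral_Im[of lborel "\<lambda>x. indicat_real A x *\<^sub>R E x"]
        by (simp add: set_lebesgue_integral_def)
    qed (use E in auto)
    ultimately show ?thesis
      by eventually_elim (auto simp: E_def complex_eq_iff)
  qed
  have "AE x in lborel. \<forall>n. x \<in> box (- (real n *\<^sub>R One)) (real n *\<^sub>R One) \<longrightarrow> D x = 0"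
    unfolding AE_all_countable using * by blast
  then show ?thesis
    by eventually_elim (use UN_box_eq_UNIV in auto)
qed

text \<open>
The difference of the two functions integrates to zero against the test functions that approximate a
box, hence over the box itself by dominated convergence.
\<close>

theorem locally_L2_unique:
  assumes F: "locally_L2 F" and G: "locally_L2 G"
    and eq: "\<And>f. f \<in> test_functions \<Longrightarrow> (LINT x|lborel. F x * f x) = (LINT x|lborel. G x * f x)"
  shows "AE x in lborel. F x = G x"
proof -
  have FG[measurable]: "F \<in> borel_measurable borel" "G \<in> borel_measurable borel"
    using F G by (auto dest: locally_L2_borel)
  have i: "integrable lborel (\<lambda>x. F x * indicator (box l u) x)" "integrable lborel (\<lambda>x. G x * indicator (box l u) x)" for l u
    by (rule locally_L2_integrable[OF F compact_cbox[of l u], of _ 1] locally_L2_integrable[OF G compact_cbox[of l u], of _ 1],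
        use box_subset_cbox[of l u] in \<open>auto simp: indicator_def\<close>)+
  have "AE x in lborel. F x - G x = 0"
  proof (rule vanishing_box_integrals)
    fix l u
    have I: "integrable lborel (\<lambda>x. (F x - G x) * indicator (box l u) x)"
      using Bochner_Integration.integrable_diff[OF i] by (simp add: left_diff_distrib)
    also have s: "(\<lambda>x. (F x - G x) * indicator (box l u) x) = (\<lambda>x. indicator (box l u) x *\<^sub>R (F x - G x))"
      by (auto simp: indicator_def)
    finally show "integrable lborel (\<lambda>x. indicator (box l u) x *\<^sub>R (F x - G x))" .
    obtain \<psi> where \<psi>: "\<And>n. \<psi> n \<in> test_functions" "\<And>n x. norm (\<psi> n x) \<le> indicator (box l u) x"
      "\<And>x. (\<lambda>n. \<psi> n x) \<longlonglongrightarrow> indicator (box l u) x"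
      using test_functions_approximate_box[of l u] by metis
    have [measurable]: "\<psi> n \<in> borel_measurable borel" for n
      using \<psi>(1) by (simp add: test_smooth smooth_borel)
    have "(\<lambda>n. LINT x|lborel. (F x - G x) * \<psi> n x) \<longlonglongrightarrow> (LINT x|lborel. (F x - G x) * indicator (box l u) x)"
    proof (rule integral_dominated_convergence[where w = "\<lambda>x. norm ((F x - G x) * indicator (box l u) x)"])
      show "AE x in lborel. norm ((F x - G x) * \<psi> n x) \<le> norm ((F x - G x) * indicator (box l u) x)" for n
      proof (intro AE_I2)
        fix x
        have "norm (F x - G x) * norm (\<psi> n x) \<le> norm (F x - G x) * indicator (box l u) x"
          by (intro mult_left_mono \<psi>(2)) simp
        then show "norm ((F x - G x) * \<psi> n x) \<le> norm ((F x - G x) * indicator (box l u) x)"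
          by (cases "x \<in> box l u") (auto simp: norm_mult)
      qed
    qed (use I \<psi>(3) in \<open>auto intro!: tendsto_intros\<close>)
    moreover have "(LINT x|lborel. (F x - G x) * \<psi> n x) = 0" for n
      using eq[OF \<psi>(1)[of n]] locally_L2_test_integrable[OF F \<psi>(1)] locally_L2_test_integrable[OF G \<psi>(1)]
      by (simp add: left_diff_distrib)
    ultimately show "(LINT x|lborel. indicator (box l u) x *\<^sub>R (F x - G x)) = 0"
      unfolding s[symmetric] by (simp add: LIMSEQ_const_iff)
  qed
  then show ?thesis by simp
qed

section \<open>Changes of variables\<close>

lemma lborel_integral_affine:
  fixes f :: "'a::euclidean_space \<Rightarrow> 'b::{banach, second_countable_topology}"
  assumes "c \<noteq> 0" and [measurable]: "f \<in> borel_measurable borel"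
  shows "(LINT x|lborel. f x) = \<bar>c\<bar> ^ DIM('a) *\<^sub>R (LINT x|lborel. f (c *\<^sub>R x + a))"
  by (subst lborel_affine[OF assms(1), of a], subst integral_density)
     (auto simp: integral_distr add.commute)

lemma lborel_nn_integral_affine:
  fixes f :: "'a::euclidean_space \<Rightarrow> ennreal"
  assumes "c \<noteq> 0" and [measurable]: "f \<in> borel_measurable borel"
  shows "(\<integral>\<^sup>+x. f x \<partial>lborel) = ennreal (\<bar>c\<bar> ^ DIM('a)) * (\<integral>\<^sup>+x. f (c *\<^sub>R x + a) \<partial>lborel)"
  by (subst lborel_affine[OF assms(1), of a], subst nn_integral_density)
     (auto simp: nn_integral_distr add.commute nn_integral_cmult)

lemma lborel_integrable_affine:
  fixes f :: "'a::euclidean_space \<Rightarrow> 'b::{banach, second_countable_topology}"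
  assumes "c \<noteq> 0" and "integrable lborel f"
  shows "integrable lborel (\<lambda>x. f (c *\<^sub>R x + a))"
proof -
  have [measurable]: "f \<in> borel_measurable borel"
    using assms(2) by auto
  have "integrable (density (distr lborel borel (\<lambda>x. a + c *\<^sub>R x)) (\<lambda>_. \<bar>c\<bar> ^ DIM('a))) f"
    using assms(2) by (subst (asm) lborel_affine[OF assms(1), of a])
  then have "integrable (distr lborel borel (\<lambda>x. a + c *\<^sub>R x)) (\<lambda>x. \<bar>c\<bar> ^ DIM('a) *\<^sub>R f x)"
    by (subst (asm) integrable_density) auto
  then show ?thesis
    using assms(1) integrable_scaleR_right[of "inverse (\<bar>c\<bar> ^ DIM('a))" lborel "\<lambda>x. \<bar>c\<bar> ^ DIM('a) *\<^sub>R f (a + c *\<^sub>R x)"]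
    by (subst (asm) integrable_distr_eq) (auto simp: add.commute)
qed

lemma integrable_pair_bounded_kernel:
  fixes f g :: "'a::euclidean_space \<Rightarrow> complex"
  assumes f: "integrable lborel f" and g: "integrable lborel g"
    and k[measurable]: "case_prod k \<in> borel_measurable (borel \<Otimes>\<^sub>M borel)" and k1: "\<And>x y. norm (k x y) \<le> 1"
  shows "integrable (lborel \<Otimes>\<^sub>M lborel) (\<lambda>(x, y). f x * g y * k x y)"
proof (rule Bochner_Integration.integrable_bound)
  have [measurable]: "f \<in> borel_measurable borel" "g \<in> borel_measurable borel" using f g by auto
  show "integrable (lborel \<Otimes>\<^sub>M lborel) (\<lambda>(x, y). f x * g y)"
  proof (rule lborel_pair.Fubini_integrable)
    show "integrable lborel (\<lambda>x. LINT y|lborel. norm (case (x, y) of (x, y) \<Rightarrow> f x * g y))"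
      using f by (simp add: norm_mult)
  qed (use g in auto)
  show "(\<lambda>(x, y). f x * g y * k x y) \<in> borel_measurable (lborel \<Otimes>\<^sub>M lborel)" by measurable
  show "AE z in lborel \<Otimes>\<^sub>M lborel. norm (case z of (x, y) \<Rightarrow> f x * g y * k x y) \<le> norm (case z of (x, y) \<Rightarrow> f x * g y)"
    using k1 by (intro AE_I2) (auto simp: norm_mult intro!: mult_left_le)
qed

section \<open>The Fourier transform of test functions\<close>

abbreviation character :: "'a::euclidean_space \<Rightarrow> 'a \<Rightarrow> complex"
  where "character \<omega> x \<equiv> exp (- (\<i> * complex_of_real (\<omega> \<bullet> x)))"

lemma norm_character: "norm (character \<omega> x) = 1"
  using norm_exp_i_times[of "- (\<omega> \<bullet> x)"] by simp

lemma smooth_inner: "(\<lambda>x. complex_of_real (v \<bullet> x)) \<in> smooth_functions"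
  by (intro smooth_linear bounded_linear_compose[OF bounded_linear_of_real] bounded_linear_inner_right)

lemma smooth_character: "(\<lambda>x. character \<omega> x) \<in> smooth_functions"
proof -
  have "(\<lambda>x. character \<omega> x) = (\<lambda>x. exp ((- \<i>) * complex_of_real (\<omega> \<bullet> x)))" by simp
  also have "\<dots> \<in> smooth_functions"
    by (intro smooth_exp smooth_mult smooth_const smooth_inner)
  finally show ?thesis .
qed

lemma test_mult_character: "f \<in> test_functions \<Longrightarrow> (\<lambda>x. f x * character \<omega> x) \<in> test_functions"
  using test_mult_smooth[OF smooth_character, of f \<omega>] by (simp add: mult.commute)

lemma fourier_integral_affine:
  fixes f :: "'a::euclidean_space \<Rightarrow> complex"
  assumes "f \<in> borel_measurable borel" "c \<noteq> 0"
  shows "fourier_integral f \<omega> = complex_of_real (\<bar>c\<bar> ^ DIM('a)) * character \<omega> a *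
    fourier_integral (\<lambda>x. f (c *\<^sub>R x + a)) (c *\<^sub>R \<omega>)"
proof -
  have [measurable]: "f \<in> borel_measurable borel" by fact
  have "fourier_integral f \<omega> =
      \<bar>c\<bar> ^ DIM('a) *\<^sub>R (LINT x|lborel. f (c *\<^sub>R x + a) * character \<omega> (c *\<^sub>R x + a))"
    unfolding fourier_integral_def by (rule lborel_integral_affine) (use assms in auto)
  also have "(\<lambda>x. f (c *\<^sub>R x + a) * character \<omega> (c *\<^sub>R x + a)) =
      (\<lambda>x. character \<omega> a * (f (c *\<^sub>R x + a) * character (c *\<^sub>R \<omega>) x))"
    by (auto simp: fun_eq_iff inner_add_right algebra_simps exp_diff exp_minus field_simps)
  finally show ?thesis
    by (simp add: fourier_integral_def scaleR_conv_of_real mult.assoc)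
qed

lemma norm_exp_i_remainder: "norm (exp (\<i> * complex_of_real t) - 1 - \<i> * of_real t) \<le> t\<^sup>2"
  using Taylor_exp[of "\<i> * complex_of_real t" 1] by (simp add: norm_mult power2_eq_square algebra_simps)

lemma norm_fourier_integral_le:
  assumes "integrable lborel f"
  shows "norm (fourier_integral f \<omega>) \<le> (LINT x|lborel. norm (f x))"
  unfolding fourier_integral_def
  using integral_norm_bound[of lborel "\<lambda>x. f x * character \<omega> x"] by (simp add: norm_mult norm_character del: integral_norm_bound)

text \<open>
The exponential differs from its linearization by a quadratic remainder, and
\<open>|x|\<^sup>2 f x\<close> is again a combination of test functions, so the remainder stays quadratic after
integration.
\<close>

lemma fourier_integral_has_derivative:
  assumes "f \<in> test_functions"
  shows "(fourier_integral f has_derivative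
    (\<lambda>h. LINT x|lborel. (- \<i> * of_real (h \<bullet> x)) * (f x * character \<omega> x))) (at \<omega>)"
    (is "(_ has_derivative ?D) _")
  unfolding has_derivative_within_alt
proof (intro conjI allI impI)
  have i: "integrable lborel (\<lambda>x. (- \<i> * of_real (h \<bullet> x)) * (f x * character \<omega> x))" for h
    by (intro test_integrable test_mult_smooth test_mult_character smooth_mult smooth_const smooth_inner assms)
  show "bounded_linear ?D"
  proof (intro linear_conv_bounded_linear[THEN iffD1] linearI)
    show "?D (g + h) = ?D g + ?D h" for g h
      using Bochner_Integration.integral_add[OF i i, of g h] by (simp add: inner_add_left algebra_simps)
    show "?D (c *\<^sub>R h) = c *\<^sub>R ?D h" for c h
      using integral_scaleR_right[of lborel c "\<lambda>x. (- \<i> * of_real (h \<bullet> x)) * (f x * character \<omega> x)"] by (simp add: scaleR_conv_of_real algebra_simps)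
  qed
  define C where "C = (LINT x|lborel. norm (of_real ((norm x)\<^sup>2) * f x))"
  have n: "complex_of_real ((norm x)\<^sup>2) = (\<Sum>b\<in>Basis. of_real (b \<bullet> x) * of_real (b \<bullet> x))" for x :: 'a
    unfolding power2_norm_eq_inner by (subst euclidean_inner) (simp add: inner_commute)
  have "(\<lambda>x. of_real ((norm x)\<^sup>2) * f x) = (\<lambda>x. (\<Sum>b\<in>Basis. of_real (b \<bullet> x) * (of_real (b \<bullet> x) * f x)))"
    unfolding n sum_distrib_right mult.assoc ..
  moreover have "integrable lborel \<dots>"
    by (intro Bochner_Integration.integrable_sum test_integrable test_mult_smooth smooth_inner assms)
  ultimately have C: "integrable lborel (\<lambda>x. of_real ((norm x)\<^sup>2) * f x)" by simp
  have "C \<ge> 0" unfolding C_def by simp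
  have bound: "norm (fourier_integral f \<eta> - fourier_integral f \<omega> - ?D (\<eta> - \<omega>)) \<le> C * (norm (\<eta> - \<omega>))\<^sup>2" for \<eta>
  proof -
    let ?r = "\<lambda>x. f x * character \<eta> x - f x * character \<omega> x - (- \<i> * of_real ((\<eta> - \<omega>) \<bullet> x)) * (f x * character \<omega> x)"
    have "fourier_integral f \<eta> - fourier_integral f \<omega> - ?D (\<eta> - \<omega>) = (LINT x|lborel. ?r x)"
      unfolding fourier_integral_def
      by (subst Bochner_Integration.integral_diff[symmetric] |
          intro i Bochner_Integration.integrable_diff test_integrable test_mult_character assms)+ simp
    moreover have "norm (LINT x|lborel. ?r x) \<le> (LINT x|lborel. norm (of_real ((norm x)\<^sup>2) * f x) * (norm (\<eta> - \<omega>))\<^sup>2)"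
    proof (rule Bochner_Integration.integral_norm_bound_integral)
      fix x
      let ?t = "- ((\<eta> - \<omega>) \<bullet> x)"
      have "?r x = f x * character \<omega> x * (exp (\<i> * complex_of_real ?t) - 1 - \<i> * of_real ?t)"
        by (simp add: algebra_simps inner_diff_left flip: exp_add)
      then have "norm (?r x) \<le> norm (f x) * ?t\<^sup>2"
        using norm_exp_i_remainder[of ?t] by (simp only: norm_mult norm_character) (simp add: mult_left_mono)
      also have "\<dots> \<le> norm (f x) * (norm (\<eta> - \<omega>) * norm x)\<^sup>2"
        using Cauchy_Schwarz_ineq2[of "\<eta> - \<omega>" x] by (intro mult_left_mono) (simp_all add: abs_le_square_iff[symmetric])
      also have "\<dots> = norm (of_real ((norm x)\<^sup>2) * f x) * (norm (\<eta> - \<omega>))\<^sup>2"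
        by (simp only: norm_mult norm_of_real abs_power2 power_mult_distrib mult_ac abs_norm_cancel)
      finally show "norm (?r x) \<le> norm (of_real ((norm x)\<^sup>2) * f x) * (norm (\<eta> - \<omega>))\<^sup>2" .
    qed (intro i Bochner_Integration.integrable_diff test_integrable test_mult_character assms
        integrable_mult_left integrable_norm C)+
    ultimately show ?thesis by (simp add: C_def)
  qed
  fix e :: real assume e: "e > 0"
  show "\<exists>d>0. \<forall>\<eta>\<in>UNIV. norm (\<eta> - \<omega>) < d \<longrightarrow>
      norm (fourier_integral f \<eta> - fourier_integral f \<omega> - ?D (\<eta> - \<omega>)) \<le> e * norm (\<eta> - \<omega>)"
  proof (intro exI[of _ "e / (C + 1)"] conjI ballI impI)
    fix \<eta> assume "norm (\<eta> - \<omega>) < e / (C + 1)"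
    then have "norm (\<eta> - \<omega>) * (C + 1) \<le> e" using \<open>C \<ge> 0\<close> by (simp add: field_simps)
    then have "norm (\<eta> - \<omega>) * (norm (\<eta> - \<omega>) * (C + 1)) \<le> norm (\<eta> - \<omega>) * e"
      by (intro mult_left_mono) auto
    then have "C * (norm (\<eta> - \<omega>))\<^sup>2 \<le> e * norm (\<eta> - \<omega>)"
      using mult_nonneg_nonneg[OF norm_ge_zero norm_ge_zero, of "\<eta> - \<omega>" "\<eta> - \<omega>"]
      unfolding power2_eq_square distrib_left mult_1_right by (simp only: mult_ac)
    then show "norm (fourier_integral f \<eta> - fourier_integral f \<omega> - ?D (\<eta> - \<omega>)) \<le> e * norm (\<eta> - \<omega>)"
      using bound[of \<eta>] by linarith
  qed (use e \<open>C \<ge> 0\<close> in auto)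
qed

lemma partial_derivative_fourier_integral:
  assumes "f \<in> test_functions"
  shows "partial_derivative b (fourier_integral f) = fourier_integral (\<lambda>x. (- \<i> * of_real (b \<bullet> x)) * f x)"
  using partial_derivative_eq[OF fourier_integral_has_derivative[OF assms], of b]
  by (auto simp: fun_eq_iff fourier_integral_def mult.assoc)

lemma partial_derivatives_fourier_integral:
  assumes "f \<in> test_functions"
  shows "\<exists>g\<in>test_functions. partial_derivatives bs (fourier_integral f) = fourier_integral g"
proof (induction bs)
  case (Cons b bs)
  then obtain g where g: "g \<in> test_functions" "partial_derivatives bs (fourier_integral f) = fourier_integral g"
    by blast
  have "(\<lambda>x. (- \<i> * of_real (b \<bullet> x)) * g x) \<in> test_functions"
    by (intro test_mult_smooth smooth_mult smooth_const smooth_inner g)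
  then show ?case using partial_derivative_fourier_integral[OF g(1)] g(2) by auto
qed (use assms in auto)

text \<open>
Supplies the integrable majorant for the difference quotients in the next lemma.
\<close>

lemma test_difference_bound:
  assumes f: "f \<in> test_functions" and b: "b \<in> Basis" and B: "\<And>x. norm (partial_derivative b f x) \<le> B"
  shows "norm (f (x + t *\<^sub>R b) - f x) \<le> B * \<bar>t\<bar>"
proof -
  have "norm (f (x + t *\<^sub>R b) - f (x + 0 *\<^sub>R b)) \<le> B * norm (t - 0)"
  proof (rule differentiable_bound[of UNIV "\<lambda>t. f (x + t *\<^sub>R b)" "\<lambda>t h. h *\<^sub>R partial_derivative b f (x + t *\<^sub>R b)"])
    fix t :: real
    obtain D where D: "(f has_derivative D) (at (x + t *\<^sub>R b))" "partial_derivative b f (x + t *\<^sub>R b) = D b"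
      using partial_derivative_has_derivative[OF smooth_differentiable[OF test_smooth[OF f]]] by blast
    have "((\<lambda>t. x + t *\<^sub>R b) has_derivative (\<lambda>h. h *\<^sub>R b)) (at t)"
      by (auto intro!: derivative_eq_intros)
    from has_derivative_compose[OF this D(1)]
    show "((\<lambda>t. f (x + t *\<^sub>R b)) has_derivative (\<lambda>h. h *\<^sub>R partial_derivative b f (x + t *\<^sub>R b))) (at t)"
      using linear_simps(5)[OF has_derivative_bounded_linear[OF D(1)]] D(2) by simp
    show "onorm (\<lambda>h. h *\<^sub>R partial_derivative b f (x + t *\<^sub>R b)) \<le> B"
    proof (intro onorm_bound)
      show "0 \<le> B" using B norm_ge_zero order_trans by blast
      show "norm (h *\<^sub>R partial_derivative b f (x + t *\<^sub>R b)) \<le> B * norm h" for h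
        using mult_left_mono[OF B, of "\<bar>h\<bar>" "x + t *\<^sub>R b"] by (simp add: mult.commute)
    qed
  qed auto
  then show ?thesis by simp
qed

text \<open>
The transform turns the difference quotient of \<open>f\<close> into a multiple of the transform of \<open>f\<close>, because a
translation becomes a character; dominated convergence then passes to the derivative.
\<close>

lemma fourier_integral_partial_derivative:
  assumes f: "f \<in> test_functions" and b: "b \<in> Basis"
  shows "fourier_integral (partial_derivative b f) \<omega> = \<i> * of_real (\<omega> \<bullet> b) * fourier_integral f \<omega>"
proof -
  define t where "t n = inverse (real (Suc n))" for n
  have t: "t n > 0" "t n \<le> 1" for n by (auto simp: t_def field_simps)
  have t0: "filterlim t (at 0) sequentially"
    using LIMSEQ_inverse_real_of_nat unfolding filterlim_at t_def by auto
  have [measurable]: "f \<in> borel_measurable borel" "partial_derivative b f \<in> borel_measurable borel"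
    using f b by (auto simp: smooth_borel test_smooth test_partial_derivative)
  obtain B where B: "B > 0" "\<And>x. norm (partial_derivative b f x) \<le> B"
    using test_bounded[OF test_partial_derivative[OF f b]] by blast
  obtain R where R: "R > 0" "\<And>x. norm x > R \<Longrightarrow> f x = 0" using test_bounded_support[OF f] by blast
  let ?q = "\<lambda>n x. (f (x + t n *\<^sub>R b) - f x) / of_real (t n) * character \<omega> x"
  have lim1: "(\<lambda>n. LINT x|lborel. ?q n x) \<longlonglongrightarrow> (LINT x|lborel. partial_derivative b f x * character \<omega> x)"
  proof (rule integral_dominated_convergence[where w = "\<lambda>x. B * indicator (cball 0 (R + 1)) x"])
    show "integrable lborel (\<lambda>x::'a. B * indicator (cball 0 (R + 1)) x)"
      using emeasure_compact_finite[OF compact_cball[of "0::'a" "R + 1"]]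
      by (intro integrable_mult_right integrable_real_indicator) (auto simp: less_top)
    show "AE x in lborel. norm (?q n x) \<le> B * indicator (cball 0 (R + 1)) x" for n
    proof (intro AE_I2)
      fix x
      show "norm (?q n x) \<le> B * indicator (cball 0 (R + 1)) x"
      proof (cases "norm x \<le> R + 1")
        case True
        then show ?thesis
          using test_difference_bound[OF f b B(2), of x "t n"] t[of n]
          by (simp add: norm_mult norm_character norm_divide divide_le_eq)
      next
        case False
        then have "norm (x + t n *\<^sub>R b) > R"
          using norm_diff_ineq[of x "t n *\<^sub>R b"] t[of n] b by simp
        then show ?thesis using False R by simp
      qed
    qed
    show "AE x in lborel. (\<lambda>n. ?q n x) \<longlonglongrightarrow> partial_derivative b f x * character \<omega> x"
    proof (intro AE_I2 tendsto_mult tendsto_const)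
      fix x
      obtain D where D: "(f has_derivative D) (at x)" "partial_derivative b f x = D b"
        using partial_derivative_has_derivative[OF smooth_differentiable[OF test_smooth[OF f]]] by blast
      have "((\<lambda>s. x + s *\<^sub>R b) has_derivative (\<lambda>h. h *\<^sub>R b)) (at 0)"
        by (auto intro!: derivative_eq_intros)
      from has_derivative_compose[OF this, of f D]
      have "((\<lambda>s. f (x + s *\<^sub>R b)) has_vector_derivative D b) (at 0)"
        using D linear_simps(5)[OF has_derivative_bounded_linear[OF D(1)]]
        by (simp add: has_vector_derivative_def)
      then have "((\<lambda>s. norm (f (x + s *\<^sub>R b) - f x - s *\<^sub>R D b) / \<bar>s\<bar>) \<longlongrightarrow> 0) (at 0)"
        by (simp add: has_vector_derivative_def has_derivative_iff_norm)
      moreover have "\<forall>\<^sub>F s in at 0. norm (f (x + s *\<^sub>R b) - f x - s *\<^sub>R D b) / \<bar>s\<bar> =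
          norm ((f (x + s *\<^sub>R b) - f x) /\<^sub>R s - D b)"
      proof (unfold eventually_at_filter, intro always_eventually allI impI)
        fix s :: real assume "s \<noteq> 0"
        then have "(f (x + s *\<^sub>R b) - f x) /\<^sub>R s - D b = (f (x + s *\<^sub>R b) - f x - s *\<^sub>R D b) /\<^sub>R s"
          by (simp add: scaleR_diff_right)
        then show "norm (f (x + s *\<^sub>R b) - f x - s *\<^sub>R D b) / \<bar>s\<bar> =
            norm ((f (x + s *\<^sub>R b) - f x) /\<^sub>R s - D b)"
          by (simp add: divide_inverse mult.commute)
      qed
      ultimately have "((\<lambda>s. norm ((f (x + s *\<^sub>R b) - f x) /\<^sub>R s - D b)) \<longlongrightarrow> 0) (at 0)"
        by (rule Lim_transform_eventually)
      then have "((\<lambda>s. (f (x + s *\<^sub>R b) - f x) /\<^sub>R s) \<longlongrightarrow> D b) (at 0)"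
        by (simp only: tendsto_norm_zero_iff LIM_zero_iff)
      from filterlim_compose[OF this t0]
      show "(\<lambda>n. (f (x + t n *\<^sub>R b) - f x) / of_real (t n)) \<longlonglongrightarrow> partial_derivative b f x"
        by (simp add: D scaleR_conv_of_real divide_inverse mult.commute)
    qed
  qed auto
  have eq: "(LINT x|lborel. ?q n x) = (exp (\<i> * of_real (\<omega> \<bullet> b) * of_real (t n)) - 1) / of_real (t n) * fourier_integral f \<omega>" for n
  proof -
    have ft: "(\<lambda>x. f (x + t n *\<^sub>R b)) \<in> test_functions"
      using test_affine[OF f, of 1 "t n *\<^sub>R b"] by simp
    have "fourier_integral f \<omega> = character \<omega> (t n *\<^sub>R b) * fourier_integral (\<lambda>x. f (x + t n *\<^sub>R b)) \<omega>"
      using fourier_integral_affine[of f 1 \<omega> "t n *\<^sub>R b"] by simp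
    then have "fourier_integral (\<lambda>x. f (x + t n *\<^sub>R b)) \<omega> = exp (\<i> * of_real (\<omega> \<bullet> b) * of_real (t n)) * fourier_integral f \<omega>"
      by (simp add: exp_minus field_simps)
    moreover have "?q n = (\<lambda>x. (f (x + t n *\<^sub>R b) * character \<omega> x - f x * character \<omega> x) / of_real (t n))"
      by (simp add: fun_eq_iff left_diff_distrib diff_divide_distrib)
    then have "(LINT x|lborel. ?q n x) = (fourier_integral (\<lambda>x. f (x + t n *\<^sub>R b)) \<omega> - fourier_integral f \<omega>) / of_real (t n)"
      unfolding fourier_integral_def
      by (subst Bochner_Integration.integral_diff[symmetric], (intro test_integrable test_mult_character ft f)+)
         simp
    ultimately show ?thesis by (simp add: left_diff_distrib diff_divide_distrib)
  qed
  have lim2: "(\<lambda>n. (exp (\<i> * of_real (\<omega> \<bullet> b) * of_real (t n)) - 1) / of_real (t n) * fourier_integral f \<omega>)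
      \<longlonglongrightarrow> \<i> * of_real (\<omega> \<bullet> b) * fourier_integral f \<omega>"
  proof (intro tendsto_mult tendsto_const)
    have "((\<lambda>z. exp (\<i> * of_real (\<omega> \<bullet> b) * z)) has_field_derivative \<i> * of_real (\<omega> \<bullet> b)) (at 0)"
      by (auto intro!: derivative_eq_intros)
    then have L: "((\<lambda>z. (exp (\<i> * of_real (\<omega> \<bullet> b) * z) - 1) / z) \<longlongrightarrow> \<i> * of_real (\<omega> \<bullet> b)) (at 0)"
      by (simp add: DERIV_def)
    have "filterlim (\<lambda>n. complex_of_real (t n)) (at 0) sequentially"
      using tendsto_of_real[of t 0 sequentially, where 'a = complex] t0 by (auto simp: filterlim_at)
    from filterlim_compose[OF L this]
    show "(\<lambda>n. (exp (\<i> * of_real (\<omega> \<bullet> b) * of_real (t n)) - 1) / of_real (t n)) \<longlonglongrightarrow> \<i> * of_real (\<omega> \<bullet> b)" .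
  qed
  show ?thesis
    using LIMSEQ_unique[OF lim1[unfolded eq] lim2] unfolding fourier_integral_def[of "partial_derivative b f"] .
qed

text \<open>
Every factor \<open>|\<omega>|\<close> is paid for by one derivative of \<open>f\<close>.
\<close>

lemma fourier_integral_decay:
  assumes "f \<in> test_functions"
  shows "\<exists>B. \<forall>\<omega>. (1 + norm \<omega>) ^ N * norm (fourier_integral f \<omega>) \<le> B"
  using assms
proof (induction N arbitrary: f)
  case 0
  then show ?case using norm_fourier_integral_le[OF test_integrable] by auto
next
  case (Suc N)
  obtain B0 where B0: "\<And>\<omega>. (1 + norm \<omega>) ^ N * norm (fourier_integral f \<omega>) \<le> B0"
    using Suc by blast
  have "\<forall>b\<in>Basis. \<exists>B. \<forall>\<omega>. (1 + norm \<omega>) ^ N * norm (fourier_integral (partial_derivative b f) \<omega>) \<le> B"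
    using Suc by (auto intro: test_partial_derivative)
  then obtain B where B: "\<And>b \<omega>. b \<in> Basis \<Longrightarrow> (1 + norm \<omega>) ^ N * norm (fourier_integral (partial_derivative b f) \<omega>) \<le> B b"
    by metis
  have "(1 + norm \<omega>) ^ Suc N * norm (fourier_integral f \<omega>) \<le> B0 + sum B Basis" for \<omega>
  proof -
    have "norm \<omega> * ((1 + norm \<omega>) ^ N * norm (fourier_integral f \<omega>))
      \<le> (\<Sum>b\<in>Basis. \<bar>\<omega> \<bullet> b\<bar>) * ((1 + norm \<omega>) ^ N * norm (fourier_integral f \<omega>))"
      by (intro mult_right_mono norm_le_l1) auto
    also have "\<dots> = (\<Sum>b\<in>Basis. (1 + norm \<omega>) ^ N * norm (fourier_integral (partial_derivative b f) \<omega>))"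
      unfolding sum_distrib_right
      by (intro sum.cong refl) (simp add: fourier_integral_partial_derivative[OF Suc.prems] norm_mult mult_ac)
    also have "\<dots> \<le> sum B Basis" by (intro sum_mono B)
    finally show ?thesis using B0[of \<omega>] by (simp add: algebra_simps)
  qed
  then show ?case by blast
qed

lemma fourier_integral_schwartz:
  assumes "f \<in> test_functions"
  shows "fourier_integral f \<in> schwartz_space"
  unfolding schwartz_space_def
proof (intro CollectI ballI conjI allI)
  fix bs :: "'a list" and x :: 'a and N
  obtain g where g: "g \<in> test_functions" "partial_derivatives bs (fourier_integral f) = fourier_integral g"
    using partial_derivatives_fourier_integral[OF assms] by blast
  show "partial_derivatives bs (fourier_integral f) differentiable (at x)"
    unfolding g(2) differentiable_def using fourier_integral_has_derivative[OF g(1)] by blast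
  obtain B where "\<And>\<omega>. (1 + norm \<omega>) ^ N * norm (fourier_integral g \<omega>) \<le> B"
    using fourier_integral_decay[OF g(1)] by blast
  then show "bounded (range (\<lambda>x. (1 + norm x) ^ N *\<^sub>R partial_derivatives bs (fourier_integral f) x))"
    unfolding g(2) bounded_iff by (auto intro!: exI[of _ B])
qed

section \<open>Integrability of Schwartz functions\<close>

text \<open>
On the shell where \<open>|x|\<close> has integer part \<open>n\<close> the function is at most \<open>(n + 1)^(- d - 2)\<close>, while the
volume of the shell is at most a multiple of \<open>(n + 1)^d\<close>.
\<close>

lemma integrable_inverse_power:
  "integrable lborel (\<lambda>x::'a::euclidean_space. inverse ((1 + norm x) ^ (DIM('a) + 2)))"
proof (rule integrableI_bounded)
  let ?N = "DIM('a) + 2"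
  let ?B = "\<lambda>n. cball (0::'a) (real (Suc n))"
  let ?c = "\<lambda>n. unit_ball_vol (DIM('a)) * inverse (real (Suc n)) ^ 2"
  show "(\<lambda>x::'a. inverse ((1 + norm x) ^ ?N)) \<in> borel_measurable lborel" by measurable
  have "ennreal (norm (inverse ((1 + norm x) ^ ?N))) \<le> (\<Sum>n. ennreal (inverse (real (Suc n) ^ ?N)) * indicator (?B n) x)" for x :: 'a
  proof -
    define n where "n = nat \<lfloor>norm x\<rfloor>"
    have n: "real n \<le> norm x" "norm x \<le> real (Suc n)"
      unfolding n_def by (auto simp: of_nat_nat) linarith
    have "inverse ((1 + norm x) ^ ?N) \<le> inverse (real (Suc n) ^ ?N)"
      using n by (intro le_imp_inverse_le power_mono zero_less_power) auto
    moreover have "norm (inverse ((1 + norm x) ^ ?N)) = inverse ((1 + norm x) ^ ?N)"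
      unfolding real_norm_def by (intro abs_of_nonneg) (meson add_nonneg_nonneg inverse_nonnegative_iff_nonnegative norm_ge_zero zero_le_one zero_le_power)
    ultimately have "ennreal (norm (inverse ((1 + norm x) ^ ?N))) \<le> ennreal (inverse (real (Suc n) ^ ?N)) * indicator (?B n) x"
      using n by (simp only:) (simp add: ennreal_leI del: of_nat_Suc)
    also have "\<dots> \<le> (\<Sum>n. ennreal (inverse (real (Suc n) ^ ?N)) * indicator (?B n) x)"
    proof -
      have "h n \<le> (\<Sum>n. h n)" for h :: "nat \<Rightarrow> ennreal"
        using sum_le_suminf[of h "{n}"] by simp
      then show ?thesis .
    qed
    finally show ?thesis .
  qed
  then have "(\<integral>\<^sup>+(x::'a). ennreal (norm (inverse ((1 + norm x) ^ ?N))) \<partial>lborel)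
      \<le> (\<integral>\<^sup>+x. (\<Sum>n. ennreal (inverse (real (Suc n) ^ ?N)) * indicator (?B n) x) \<partial>lborel)"
    by (intro nn_integral_mono) auto
  also have "\<dots> = (\<Sum>n. ennreal (inverse (real (Suc n) ^ ?N)) * emeasure lborel (?B n))"
  proof -
    have "(\<integral>\<^sup>+x. (\<Sum>n. w n * indicator (?B n) x) \<partial>lborel) = (\<Sum>n. w n * emeasure lborel (?B n))"
      for w :: "nat \<Rightarrow> ennreal"
      by (subst nn_integral_suminf) (auto simp: nn_integral_cmult_indicator
          intro!: borel_measurable_times_ennreal borel_measurable_indicator simp del: of_nat_Suc)
    then show ?thesis .
  qed
  also have "\<dots> = (\<Sum>n. ennreal (?c n))"
  proof (intro suminf_cong)
    fix n
    have "inverse (real (Suc n) ^ ?N) * (unit_ball_vol (DIM('a)) * real (Suc n) ^ DIM('a)) = ?c n"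
      by (simp add: power_add power_inverse power2_eq_square field_simps del: of_nat_Suc)
    then show "ennreal (inverse (real (Suc n) ^ ?N)) * emeasure lborel (?B n) = ennreal (?c n)"
      by (subst emeasure_cball) (auto simp: ennreal_mult[symmetric] unit_ball_vol_nonneg simp del: of_nat_Suc)
  qed
  also have "\<dots> = ennreal (\<Sum>n. ?c n)"
  proof (rule suminf_ennreal2)
    show "summable ?c"
      using summable_Suc_iff[of "\<lambda>n. inverse (real n) ^ 2"] inverse_power_summable[of 2, where 'a = real]
      by (intro summable_mult) (simp add: power_inverse)
  qed (simp add: unit_ball_vol_nonneg)
  finally show "(\<integral>\<^sup>+(x::'a). ennreal (norm (inverse ((1 + norm x) ^ ?N))) \<partial>lborel) < \<infinity>"
    unfolding infinity_ennreal_def by (rule le_less_trans[OF _ ennreal_less_top])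
qed

lemma schwartz_seminorm_upper:
  fixes f :: "'a::euclidean_space \<Rightarrow> complex"
  assumes f: "f \<in> schwartz_space" and bs: "bs \<in> lists Basis" "length bs \<le> N"
  shows "(1 + norm x) ^ N * norm (partial_derivatives bs f x) \<le> schwartz_seminorm N f"
proof -
  let ?L = "{bs \<in> lists (Basis :: 'a set). length bs \<le> N}"
  let ?g = "\<lambda>(bs, x). (1 + norm x) ^ N * norm (partial_derivatives bs f x)"
  have "?L = {bs. set bs \<subseteq> Basis \<and> length bs \<le> N}" by auto
  then have "finite ?L"
    using finite_lists_length_le[of "Basis :: 'a set" N] by simp
  moreover have "bdd_above (range (\<lambda>x. ?g (bs, x)))" if bs: "bs \<in> ?L" for bs
  proof -
    have "bounded (range (\<lambda>x. (1 + norm x) ^ N *\<^sub>R partial_derivatives bs f x))"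
      using f bs by (auto simp: schwartz_space_def)
    then obtain B where "\<And>x. norm ((1 + norm x) ^ N *\<^sub>R partial_derivatives bs f x) \<le> B"
      by (auto simp: bounded_iff)
    then show ?thesis by (auto simp: norm_power intro!: bdd_aboveI[of _ B])
  qed
  ultimately have "bdd_above (\<Union>bs\<in>?L. range (\<lambda>x. ?g (bs, x)))"
    by (simp add: bdd_above_UN)
  moreover have "?g ` (?L \<times> UNIV) = (\<Union>bs\<in>?L. range (\<lambda>x. ?g (bs, x)))" by auto
  ultimately have "bdd_above (?g ` (?L \<times> UNIV))" by simp
  from cSUP_upper[OF _ this, of "(bs, x)"] show ?thesis
    using bs by (simp add: schwartz_seminorm_def)
qed

lemma schwartz_seminorm_nonneg: "f \<in> schwartz_space \<Longrightarrow> 0 \<le> schwartz_seminorm N f"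
  using schwartz_seminorm_upper[of f "[]" N 0] by (auto intro: order_trans[rotated])

lemma schwartz_decay:
  fixes f :: "'a::euclidean_space \<Rightarrow> complex"
  assumes "f \<in> schwartz_space"
  shows "norm (f x) \<le> schwartz_seminorm (DIM('a) + 2) f * inverse ((1 + norm x) ^ (DIM('a) + 2))"
proof -
  have "(1 + norm x) ^ (DIM('a) + 2) > 0"
    by (meson add_pos_nonneg norm_ge_zero zero_less_one zero_less_power)
  moreover have "(1 + norm x) ^ (DIM('a) + 2) * norm (f x) \<le> schwartz_seminorm (DIM('a) + 2) f"
    using schwartz_seminorm_upper[OF assms, of "[]" "DIM('a) + 2" x]
    by (simp only: partial_derivatives_Nil lists.Nil list.size zero_le)
  ultimately show ?thesis
    by (simp only: divide_inverse[symmetric] pos_le_divide_eq mult.commute)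
qed

lemma schwartz_borel: "f \<in> schwartz_space \<Longrightarrow> f \<in> borel_measurable borel"
  by (intro smooth_borel schwartz_smooth)

lemma schwartz_integrable:
  fixes f :: "'a::euclidean_space \<Rightarrow> complex"
  assumes "f \<in> schwartz_space"
  shows "integrable lborel f"
proof (rule Bochner_Integration.integrable_bound)
  show "AE x in lborel. norm (f x) \<le> norm (schwartz_seminorm (DIM('a) + 2) f * inverse ((1 + norm x) ^ (DIM('a) + 2)))"
    unfolding real_norm_def by (intro AE_I2 order_trans[OF schwartz_decay[OF assms] abs_ge_self])
  show "integrable lborel (\<lambda>x :: 'a. schwartz_seminorm (DIM('a) + 2) f * inverse ((1 + norm x) ^ (DIM('a) + 2)))"
    by (rule integrable_mult_right) (rule integrable_inverse_power)
  show "f \<in> borel_measurable lborel"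
    using schwartz_borel[OF assms] by simp
qed

lemma schwartz_integral_bound:
  fixes f :: "'a::euclidean_space \<Rightarrow> complex"
  assumes f: "f \<in> schwartz_space"
  shows "(LINT x|lborel. norm (f x)) \<le>
    (LINT x|lborel. inverse ((1 + norm (x::'a)) ^ (DIM('a) + 2))) * schwartz_seminorm (DIM('a) + 2) f"
proof -
  have "(LINT x|lborel. norm (f x)) \<le>
      (LINT (x::'a)|lborel. schwartz_seminorm (DIM('a) + 2) f * inverse ((1 + norm x) ^ (DIM('a) + 2)))"
    by (rule Bochner_Integration.integral_mono[OF integrable_norm[OF schwartz_integrable[OF f]]
          integrable_mult_right[OF integrable_inverse_power] schwartz_decay[OF f]])
  then show ?thesis by (simp add: mult.commute)
qed

section \<open>Fourier inversion\<close>

lemma continuous_fourier_integral: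
  assumes "f \<in> test_functions" shows "continuous_on S (fourier_integral f)"
  by (intro smooth_continuous_on schwartz_smooth fourier_integral_schwartz assms)

lemma fourier_integral_borel: "f \<in> test_functions \<Longrightarrow> fourier_integral f \<in> borel_measurable borel"
  by (intro schwartz_borel fourier_integral_schwartz)

lemma fourier_integral_integrable: "f \<in> test_functions \<Longrightarrow> integrable lborel (fourier_integral f)"
  by (intro schwartz_integrable fourier_integral_schwartz)

lemma character_measurable [measurable]:
  "(\<lambda>(x :: 'a::euclidean_space, y). character x y) \<in> borel_measurable (borel \<Otimes>\<^sub>M borel)"
  "(\<lambda>(x :: 'a::euclidean_space, y). exp (\<i> * complex_of_real (x \<bullet> y))) \<in> borel_measurable (borel \<Otimes>\<^sub>M borel)"
  unfolding borel_prod case_prod_beta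
  by (intro borel_measurable_continuous_onI continuous_intros)+

text \<open>
The cut-off \<open>g (e x)\<close> makes the double integral absolutely convergent, so that the order of integration
can be exchanged; the inner integral is then a rescaled transform of \<open>g\<close> centred at \<open>\<omega>\<close>.
\<close>

lemma regularized_inversion:
  fixes f g :: "'a::euclidean_space \<Rightarrow> complex"
  assumes f: "f \<in> test_functions" and g: "g \<in> test_functions" and e: "e > 0"
  shows "(LINT x|lborel. fourier_integral f x * exp (\<i> * of_real (\<omega> \<bullet> x)) * g (e *\<^sub>R x)) =
    (LINT z|lborel. f (\<omega> + e *\<^sub>R z) * fourier_integral g z)"
proof -
  have fgm[measurable]: "f \<in> borel_measurable borel" "g \<in> borel_measurable borel"
    "fourier_integral g \<in> borel_measurable borel"
    using f g by (auto simp: smooth_borel test_smooth fourier_integral_borel)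
  have gi: "(\<lambda>x. g (e *\<^sub>R x)) \<in> test_functions"
    using test_affine[OF g, of e 0] e by simp
  have *: "integrable (lborel \<Otimes>\<^sub>M lborel) (\<lambda>(x, y). f x * g (e *\<^sub>R y) * (character x y * exp (\<i> * of_real (\<omega> \<bullet> y))))"
    by (rule integrable_pair_bounded_kernel)
       (use f gi in \<open>auto simp: test_integrable norm_mult norm_character\<close>)
  have "(LINT x|lborel. fourier_integral f x * exp (\<i> * of_real (\<omega> \<bullet> x)) * g (e *\<^sub>R x)) =
      (LINT x|lborel. LINT y|lborel. f y * g (e *\<^sub>R x) * (character y x * exp (\<i> * of_real (\<omega> \<bullet> x))))"
  proof (rule Bochner_Integration.integral_cong[OF refl])
    fix x
    have "fourier_integral f x * exp (\<i> * of_real (\<omega> \<bullet> x)) * g (e *\<^sub>R x) =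
      (LINT y|lborel. (f y * character x y) * (exp (\<i> * of_real (\<omega> \<bullet> x)) * g (e *\<^sub>R x)))"
      by (simp add: fourier_integral_def)
    then show "fourier_integral f x * exp (\<i> * of_real (\<omega> \<bullet> x)) * g (e *\<^sub>R x) =
      (LINT y|lborel. f y * g (e *\<^sub>R x) * (character y x * exp (\<i> * of_real (\<omega> \<bullet> x))))"
      by (simp add: mult_ac inner_commute)
  qed
  also have "\<dots> = (LINT y|lborel. LINT x|lborel. f y * g (e *\<^sub>R x) * (character y x * exp (\<i> * of_real (\<omega> \<bullet> x))))"
    using lborel_pair.Fubini_integral[OF *] by simp
  also have "\<dots> = (LINT y|lborel. f y * fourier_integral (\<lambda>x. g (e *\<^sub>R x)) (y - \<omega>))"
  proof (rule Bochner_Integration.integral_cong[OF refl])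
    fix y
    have "(\<lambda>x. f y * g (e *\<^sub>R x) * (character y x * exp (\<i> * of_real (\<omega> \<bullet> x)))) =
      (\<lambda>x. f y * (g (e *\<^sub>R x) * character (y - \<omega>) x))"
      by (simp add: fun_eq_iff inner_diff_left algebra_simps exp_diff exp_minus field_simps)
    then show "(LINT x|lborel. f y * g (e *\<^sub>R x) * (character y x * exp (\<i> * of_real (\<omega> \<bullet> x)))) =
      f y * fourier_integral (\<lambda>x. g (e *\<^sub>R x)) (y - \<omega>)"
      by (simp add: fourier_integral_def)
  qed
  also have "\<dots> = e ^ DIM('a) *\<^sub>R (LINT z|lborel. f (e *\<^sub>R z + \<omega>) * fourier_integral (\<lambda>x. g (e *\<^sub>R x)) (e *\<^sub>R z))"
    using e lborel_integral_affine[of e "\<lambda>y. f y * fourier_integral (\<lambda>x. g (e *\<^sub>R x)) (y - \<omega>)" \<omega>]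
      fourier_integral_borel[OF gi] by simp
  also have "\<dots> = (LINT z|lborel. f (\<omega> + e *\<^sub>R z) * fourier_integral g z)"
  proof -
    have "fourier_integral g z = of_real (e ^ DIM('a)) * fourier_integral (\<lambda>x. g (e *\<^sub>R x)) (e *\<^sub>R z)" for z
      using fourier_integral_affine[of g e z 0] e by simp
    then show ?thesis by (simp add: scaleR_conv_of_real add.commute mult_ac)
  qed
  finally show ?thesis .
qed

text \<open>
Let \<open>e\<close> tend to \<open>0\<close>: the cut-off becomes the constant \<open>g 0\<close> on the left, and the rescaled transform
concentrates at \<open>\<omega>\<close> on the right.
\<close>

lemma inversion_product:
  fixes f g :: "'a::euclidean_space \<Rightarrow> complex"
  assumes f: "f \<in> test_functions" and g: "g \<in> test_functions"
  shows "(LINT x|lborel. fourier_integral f x * exp (\<i> * of_real (\<omega> \<bullet> x))) * g 0 =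
    f \<omega> * (LINT z|lborel. fourier_integral g z)"
proof -
  define e where "e n = inverse (real (Suc n))" for n
  have e: "e n > 0" for n by (simp add: e_def)
  have e0: "e \<longlonglongrightarrow> 0" using LIMSEQ_inverse_real_of_nat by (simp add: e_def[abs_def])
  have fgm[measurable]: "f \<in> borel_measurable borel" "g \<in> borel_measurable borel"
    "fourier_integral f \<in> borel_measurable borel" "fourier_integral g \<in> borel_measurable borel"
    using f g by (auto simp: smooth_borel test_smooth fourier_integral_borel)
  obtain A where A: "A > 0" "\<And>x. norm (f x) \<le> A" using test_bounded[OF f] by blast
  obtain B where B: "B > 0" "\<And>x. norm (g x) \<le> B" using test_bounded[OF g] by blast
  have 1: "(\<lambda>n. LINT x|lborel. fourier_integral f x * exp (\<i> * of_real (\<omega> \<bullet> x)) * g (e n *\<^sub>R x)) \<longlonglongrightarrow>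
    (LINT x|lborel. fourier_integral f x * exp (\<i> * of_real (\<omega> \<bullet> x)) * g 0)"
  proof (rule integral_dominated_convergence[where w = "\<lambda>x. norm (fourier_integral f x) * B"])
    show "integrable lborel (\<lambda>x. norm (fourier_integral f x) * B)"
      by (intro integrable_mult_left integrable_norm fourier_integral_integrable f)
    show "AE x in lborel. (\<lambda>n. fourier_integral f x * exp (\<i> * of_real (\<omega> \<bullet> x)) * g (e n *\<^sub>R x))
        \<longlonglongrightarrow> fourier_integral f x * exp (\<i> * of_real (\<omega> \<bullet> x)) * g 0"
    proof (intro AE_I2 tendsto_mult tendsto_const)
      fix x :: 'a
      have "(\<lambda>n. e n *\<^sub>R x) \<longlonglongrightarrow> 0 *\<^sub>R x" by (intro tendsto_intros e0)
      then show "(\<lambda>n. g (e n *\<^sub>R x)) \<longlonglongrightarrow> g 0"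
        using continuous_on_tendsto_compose[OF smooth_continuous_on[OF test_smooth[OF g], of UNIV]] by simp
    qed
  qed (auto simp: norm_mult B intro!: mult_left_mono)
  have 2: "(\<lambda>n. LINT z|lborel. f (\<omega> + e n *\<^sub>R z) * fourier_integral g z) \<longlonglongrightarrow>
    (LINT z|lborel. f \<omega> * fourier_integral g z)"
  proof (rule integral_dominated_convergence[where w = "\<lambda>x. A * norm (fourier_integral g x)"])
    show "integrable lborel (\<lambda>x. A * norm (fourier_integral g x))"
      by (intro integrable_mult_right integrable_norm fourier_integral_integrable g)
    show "AE x in lborel. (\<lambda>n. f (\<omega> + e n *\<^sub>R x) * fourier_integral g x)
        \<longlonglongrightarrow> f \<omega> * fourier_integral g x"
    proof (intro AE_I2 tendsto_mult tendsto_const)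
      fix x :: 'a
      have "(\<lambda>n. \<omega> + e n *\<^sub>R x) \<longlonglongrightarrow> \<omega> + 0 *\<^sub>R x" by (intro tendsto_intros e0)
      then show "(\<lambda>n. f (\<omega> + e n *\<^sub>R x)) \<longlonglongrightarrow> f \<omega>"
        using continuous_on_tendsto_compose[OF smooth_continuous_on[OF test_smooth[OF f], of UNIV]] by simp
    qed
  qed (auto simp: norm_mult A intro!: mult_right_mono)
  have 3: "(LINT x|lborel. fourier_integral f x * exp (\<i> * of_real (\<omega> \<bullet> x)) * g (e n *\<^sub>R x)) =
    (LINT z|lborel. f (\<omega> + e n *\<^sub>R z) * fourier_integral g z)" for n
    by (rule regularized_inversion[OF f g e])
  show ?thesis using LIMSEQ_unique[OF 1 2[folded 3]] by simp
qed

text \<open>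
Integrating the hypothesis against the conjugate of \<open>g\<close> and exchanging the integrals yields the integral
of \<open>|g^|\<^sup>2\<close>, and \<open>g^\<close> is continuous.
\<close>

lemma fourier_integral_eq_zeroI:
  fixes g :: "'a::euclidean_space \<Rightarrow> complex"
  assumes g: "g \<in> test_functions" and cg: "(\<lambda>x. cnj (g x)) \<in> test_functions"
    and zero: "\<And>\<omega>. (LINT x|lborel. fourier_integral g x * exp (\<i> * of_real (\<omega> \<bullet> x))) = 0"
  shows "fourier_integral g x = 0"
proof -
  have [measurable]: "fourier_integral g \<in> borel_measurable borel" "g \<in> borel_measurable borel"
    using g by (auto simp: smooth_borel test_smooth fourier_integral_borel)
  let ?k = "\<lambda>x y. fourier_integral g x * cnj (g y) * exp (\<i> * of_real (x \<bullet> y))"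
  have i: "integrable (lborel \<Otimes>\<^sub>M lborel) (\<lambda>(x, y). ?k x y)"
    by (rule integrable_pair_bounded_kernel) (use g cg in \<open>auto simp: test_integrable fourier_integral_integrable\<close>)
  have c: "(LINT y|lborel. ?k x y) = of_real ((norm (fourier_integral g x))\<^sup>2)" for x
  proof -
    have "cnj (fourier_integral g x) = (LINT y|lborel. cnj (g y) * exp (\<i> * of_real (x \<bullet> y)))"
      unfolding fourier_integral_def by (subst Bochner_Integration.integral_cnj[symmetric]) (simp add: exp_cnj)
    then show ?thesis
      unfolding mult.assoc using complex_norm_square[of "fourier_integral g x"] by simp
  qed
  have "(LINT x|lborel. complex_of_real ((norm (fourier_integral g x))\<^sup>2)) = (LINT y|lborel. LINT x|lborel. ?k x y)"
    using lborel_pair.Fubini_integral[OF i] c by simp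
  also have "\<dots> = (LINT y|lborel. cnj (g y) * (LINT x|lborel. fourier_integral g x * exp (\<i> * of_real (y \<bullet> x))))"
    by (subst integral_mult_right_zero[symmetric], rule Bochner_Integration.integral_cong[OF refl]) (simp add: mult_ac inner_commute)
  also have "\<dots> = 0" by (simp add: zero)
  finally have "(LINT x|lborel. (norm (fourier_integral g x))\<^sup>2) = 0"
    by (simp add: integral_complex_of_real del: of_real_power)
  moreover have "integrable lborel (\<lambda>x. (norm (fourier_integral g x))\<^sup>2)"
  proof (rule Bochner_Integration.integrable_bound)
    show "integrable lborel (\<lambda>x. (LINT x|lborel. norm (g x)) * norm (fourier_integral g x))"
      by (intro integrable_mult_right integrable_norm fourier_integral_integrable g)
    show "AE x in lborel. norm ((norm (fourier_integral g x))\<^sup>2) \<le> norm ((LINT x|lborel. norm (g x)) * norm (fourier_integral g x))"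
      using norm_fourier_integral_le[OF test_integrable[OF g]]
      by (intro AE_I2) (auto simp: power2_eq_square abs_mult intro!: mult_right_mono)
  qed auto
  ultimately have "AE x in lborel. fourier_integral g x = 0"
    using integral_nonneg_eq_0_iff_AE[of lborel "\<lambda>x. (norm (fourier_integral g x))\<^sup>2"] by simp
  then have "{x. fourier_integral g x \<noteq> 0} \<in> null_sets lborel"
    by (subst (asm) AE_iff_null) auto
  then have "negligible {x. fourier_integral g x \<noteq> 0}"
    by (simp add: negligible_iff_null_sets null_sets_completionI)
  moreover have "open {x. fourier_integral g x \<noteq> 0}"
    by (intro open_Collect_neq continuous_fourier_integral g continuous_on_const)
  ultimately show ?thesis using open_not_negligible by blast
qed

text \<open>
The product formula for a fixed bump \<open>g\<close> with \<open>g 0 \<noteq> 0\<close> yields the identity and a formula for \<open>c\<close>,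
classically \<open>(2\<pi>)^d\<close>. If \<open>c\<close> were zero, the transform of \<open>g\<close> would vanish identically, but at the origin its value is the integral of a nonnegative
function that is not zero.
\<close>

theorem fourier_inversion:
  obtains c :: complex where "c \<noteq> 0"
    "\<And>f (\<omega>::'a::euclidean_space). f \<in> test_functions \<Longrightarrow>
      (LINT x|lborel. fourier_integral f x * exp (\<i> * of_real (\<omega> \<bullet> x))) = c * f \<omega>"
proof -
  obtain \<psi> where \<psi>: "\<And>n::nat. \<psi> n \<in> test_functions" "\<And>n x. \<psi> n x \<in> \<real>"
    "\<And>n x. x \<in> box (- One) (One::'a) \<Longrightarrow> Re (\<psi> n x) > 0"
    "\<And>n x. norm (\<psi> n x) \<le> indicator (box (- One) One) x"
    using test_functions_approximate_box[of "- One :: 'a" One] by metis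
  define g where "g = \<psi> 0"
  have g: "g \<in> test_functions" and real: "cnj (g x) = g x" for x
    using \<psi> by (auto simp: g_def Reals_cnj_iff)
  have pos: "Re (g x) > 0" if "x \<in> box (- One) One" for x
    using \<psi> that by (simp add: g_def)
  have nonneg: "Re (g x) \<ge> 0" for x
  proof (cases "x \<in> box (- One) One")
    case False
    then show ?thesis using \<psi>(4)[of 0 x] by (simp add: g_def)
  qed (use pos in \<open>simp add: less_imp_le\<close>)
  have 0: "(0::'a) \<in> box (- One) One" by (simp add: box_def)
  have g0: "g 0 \<noteq> 0" using pos[OF 0] by auto
  define c where "c = (LINT z|lborel. fourier_integral g z) / g 0"
  have inv: "(LINT x|lborel. fourier_integral f x * exp (\<i> * of_real (\<omega> \<bullet> x))) = c * f \<omega>"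
    if "f \<in> test_functions" for f and \<omega> :: 'a
    using inversion_product[OF that g, of \<omega>] g0 by (simp add: c_def field_simps)
  have "c \<noteq> 0"
  proof
    assume "c = 0"
    then have "fourier_integral g 0 = 0"
      by (intro fourier_integral_eq_zeroI g) (use inv[OF g] g real in auto)
    then have "(LINT x|lborel. g x) = 0" by (simp add: fourier_integral_def)
    then have "(LINT x|lborel. Re (g x)) = 0"
      using integral_Re[OF test_integrable[OF g]] by simp
    then have "AE x in lborel. Re (g x) = 0"
      using integral_nonneg_eq_0_iff_AE[of lborel "\<lambda>x. Re (g x)"] nonneg test_integrable[OF g] by auto
    then have "AE x in lborel. x \<notin> box (- One) (One::'a)"
      by eventually_elim (use pos in force)
    then have "box (- One) (One::'a) \<in> null_sets lborel"
      by (subst (asm) AE_iff_null) auto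
    then have "negligible (box (- One) (One::'a))"
      by (simp add: negligible_iff_null_sets null_sets_completionI)
    then show False using 0 open_not_negligible[OF open_box] by blast
  qed
  with inv show thesis using that by blast
qed

section \<open>The Schwartz space and tempered distributions\<close>

lemma partial_derivatives_add:
  assumes "f \<in> smooth_functions" "g \<in> smooth_functions" "bs \<in> lists Basis"
  shows "partial_derivatives bs (\<lambda>x. f x + g x) = (\<lambda>x. partial_derivatives bs f x + partial_derivatives bs g x)"
  using assms(3)
proof induction
  case (Cons b bs)
  then have bs: "bs \<in> lists Basis" by simp
  show ?case
    unfolding partial_derivatives_Cons Cons.IH
    by (rule ext, intro partial_derivative_add smooth_differentiable smooth_partial_derivatives assms(1,2) bs)
qed simp

lemma partial_derivatives_cmult:
  assumes "f \<in> smooth_functions" "bs \<in> lists Basis"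
  shows "partial_derivatives bs (\<lambda>x. c * f x) = (\<lambda>x. c * partial_derivatives bs f x)"
  using assms(2)
proof induction
  case (Cons b bs)
  then have d: "partial_derivatives bs f differentiable (at x)" for x
    using assms(1) by (simp add: smooth_differentiable smooth_partial_derivatives)
  show ?case
    unfolding partial_derivatives_Cons Cons.IH
  proof
    fix x
    obtain D where D: "(partial_derivatives bs f has_derivative D) (at x)"
      "\<forall>b. partial_derivative b (partial_derivatives bs f) x = D b"
      using partial_derivative_has_derivative[OF d] by blast
    show "partial_derivative b (\<lambda>x. c * partial_derivatives bs f x) x =
        c * partial_derivative b (partial_derivatives bs f) x"
      using partial_derivative_eq[OF has_derivative_mult_right[OF D(1)]] D(2) by simp
  qed
qed simp

lemma schwartz_add:
  assumes "f \<in> schwartz_space" "g \<in> schwartz_space"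
  shows "(\<lambda>x. f x + g x) \<in> schwartz_space"
proof -
  have s: "f \<in> smooth_functions" "g \<in> smooth_functions" using assms by (auto intro: schwartz_smooth)
  have "bounded (range (\<lambda>x. (1 + norm x) ^ N *\<^sub>R (partial_derivatives bs f x + partial_derivatives bs g x)))"
    if "bs \<in> lists Basis" for bs N
  proof -
    have "bounded (range (\<lambda>x. (1 + norm x) ^ N *\<^sub>R partial_derivatives bs f x))"
      "bounded (range (\<lambda>x. (1 + norm x) ^ N *\<^sub>R partial_derivatives bs g x))"
      using assms that by (auto simp: schwartz_space_def)
    from bounded_plus_comp[OF this] show ?thesis by (simp add: scaleR_add_right)
  qed
  then show ?thesis
    using smooth_add[OF s] by (auto simp: schwartz_space_def smooth_functions_def partial_derivatives_add[OF s])
qed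

lemma schwartz_cmult:
  assumes "f \<in> schwartz_space"
  shows "(\<lambda>x. c * f x) \<in> schwartz_space"
proof -
  have s: "f \<in> smooth_functions" using assms by (auto intro: schwartz_smooth)
  have "bounded (range (\<lambda>x. (1 + norm x) ^ N *\<^sub>R (c * partial_derivatives bs f x)))"
    if "bs \<in> lists Basis" for bs N
  proof -
    have "bounded (range (\<lambda>x. (1 + norm x) ^ N *\<^sub>R partial_derivatives bs f x))"
      using assms that by (auto simp: schwartz_space_def)
    then have "bounded ((*) c ` range (\<lambda>x. (1 + norm x) ^ N *\<^sub>R partial_derivatives bs f x))"
      by (rule bounded_linear_image[OF _ bounded_linear_mult_right])
    then show ?thesis by (simp add: image_image)
  qed
  then show ?thesis
    using smooth_mult[OF smooth_const s] by (auto simp: schwartz_space_def smooth_functions_def partial_derivatives_cmult[OF s])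
qed

lemma schwartz_seminorm_least:
  fixes f :: "'a::euclidean_space \<Rightarrow> complex"
  assumes "\<And>bs x. bs \<in> lists Basis \<Longrightarrow> length bs \<le> N \<Longrightarrow> (1 + norm x) ^ N * norm (partial_derivatives bs f x) \<le> B"
  shows "schwartz_seminorm N f \<le> B"
  unfolding schwartz_seminorm_def
proof (rule cSUP_least)
  have "([], 0) \<in> {bs \<in> lists (Basis :: 'a set). length bs \<le> N} \<times> (UNIV :: 'a set)" by simp
  then show "{bs \<in> lists (Basis :: 'a set). length bs \<le> N} \<times> (UNIV :: 'a set) \<noteq> {}" by blast
qed (use assms in auto)

lemma schwartz_seminorm_mono:
  fixes f :: "'a::euclidean_space \<Rightarrow> complex"
  assumes "f \<in> schwartz_space" "N \<le> M"
  shows "schwartz_seminorm N f \<le> schwartz_seminorm M f"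
proof (rule schwartz_seminorm_least)
  fix bs :: "'a list" and x assume "bs \<in> lists Basis" "length bs \<le> N"
  then have "(1 + norm x) ^ M * norm (partial_derivatives bs f x) \<le> schwartz_seminorm M f"
    using assms by (intro schwartz_seminorm_upper) auto
  moreover have "(1 + norm x) ^ N * norm (partial_derivatives bs f x) \<le> (1 + norm x) ^ M * norm (partial_derivatives bs f x)"
    using assms(2) by (intro mult_right_mono power_increasing) auto
  ultimately show "(1 + norm x) ^ N * norm (partial_derivatives bs f x) \<le> schwartz_seminorm M f" by linarith
qed

lemma shift_weight: "1 + norm x \<le> (1 + norm (x + j)) * (1 + norm j)"
proof -
  have "norm x \<le> norm (x + j) + norm j" using norm_triangle_ineq4[of "x + j" j] by simp
  moreover have "(1 + norm (x + j)) * (1 + norm j) = 1 + norm (x + j) + norm j + norm (x + j) * norm j"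
    by (simp add: algebra_simps)
  moreover have "0 \<le> norm (x + j) * norm j" by simp
  ultimately show ?thesis by linarith
qed

lemma
  fixes f :: "'a::euclidean_space \<Rightarrow> complex"
  assumes f: "f \<in> schwartz_space"
  shows schwartz_shift: "(\<lambda>x. f (x + j)) \<in> schwartz_space"
    and schwartz_seminorm_shift: "schwartz_seminorm N (\<lambda>x. f (x + j)) \<le> (1 + norm j) ^ N * schwartz_seminorm N f"
proof -
  have s: "f \<in> smooth_functions" using f by (rule schwartz_smooth)
  have eq: "partial_derivatives bs (\<lambda>x. f (x + j)) = (\<lambda>x. partial_derivatives bs f (x + j))" if "bs \<in> lists Basis" for bs
    using partial_derivatives_affine[OF s that, of 1 j] by simp
  have w: "(1 + norm x) ^ N * norm (partial_derivatives bs f (x + j)) \<le>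
      (1 + norm j) ^ N * ((1 + norm (x + j)) ^ N * norm (partial_derivatives bs f (x + j)))" for bs N and x :: 'a
  proof -
    have "(1 + norm x) ^ N \<le> ((1 + norm (x + j)) * (1 + norm j)) ^ N"
      by (intro power_mono shift_weight) auto
    then have "(1 + norm x) ^ N * norm (partial_derivatives bs f (x + j)) \<le>
        ((1 + norm (x + j)) * (1 + norm j)) ^ N * norm (partial_derivatives bs f (x + j))"
      by (rule mult_right_mono) simp
    then show ?thesis by (simp add: power_mult_distrib mult_ac)
  qed
  have "bounded (range (\<lambda>x. (1 + norm x) ^ N *\<^sub>R partial_derivatives bs f (x + j)))" if "bs \<in> lists Basis" for bs N
  proof -
    have "bounded (range (\<lambda>x. (1 + norm x) ^ N *\<^sub>R partial_derivatives bs f x))"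
      using f that by (auto simp: schwartz_space_def)
    then obtain B where B: "\<And>x. (1 + norm x) ^ N * norm (partial_derivatives bs f x) \<le> B"
      by (auto simp: bounded_iff)
    have "norm ((1 + norm x) ^ N *\<^sub>R partial_derivatives bs f (x + j)) \<le> (1 + norm j) ^ N * B" for x
    proof -
      have "(1 + norm x) ^ N * norm (partial_derivatives bs f (x + j)) \<le> (1 + norm j) ^ N * B"
        by (rule order_trans[OF w mult_left_mono[OF B]]) simp
      then show ?thesis by simp
    qed
    then show ?thesis unfolding bounded_iff by blast
  qed
  then show "(\<lambda>x. f (x + j)) \<in> schwartz_space"
    using smooth_affine[OF s, of 1 j] by (auto simp: schwartz_space_def smooth_functions_def eq)
  show "schwartz_seminorm N (\<lambda>x. f (x + j)) \<le> (1 + norm j) ^ N * schwartz_seminorm N f"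
  proof (rule schwartz_seminorm_least)
    fix bs :: "'a list" and x :: 'a assume bs: "bs \<in> lists Basis" "length bs \<le> N"
    have "(1 + norm j) ^ N * ((1 + norm (x + j)) ^ N * norm (partial_derivatives bs f (x + j))) \<le>
        (1 + norm j) ^ N * schwartz_seminorm N f"
      by (intro mult_left_mono schwartz_seminorm_upper f bs) auto
    from order_trans[OF w this]
    show "(1 + norm x) ^ N * norm (partial_derivatives bs (\<lambda>x. f (x + j)) x) \<le> (1 + norm j) ^ N * schwartz_seminorm N f"
      unfolding eq[OF bs(1)] .
  qed
qed

lemma tempered_distributionsI:
  assumes "\<And>\<phi>. \<phi> \<notin> schwartz_space \<Longrightarrow> T \<phi> = 0"
    and "\<And>\<phi> \<psi>. \<phi> \<in> schwartz_space \<Longrightarrow> \<psi> \<in> schwartz_space \<Longrightarrow> T (\<lambda>x. \<phi> x + \<psi> x) = T \<phi> + T \<psi>"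
    and "\<And>\<phi> c. \<phi> \<in> schwartz_space \<Longrightarrow> T (\<lambda>x. c * \<phi> x) = c * T \<phi>"
    and "\<And>\<phi>. \<phi> \<in> schwartz_space \<Longrightarrow> norm (T \<phi>) \<le> C * schwartz_seminorm N \<phi>"
  shows "T \<in> tempered_distributions"
  unfolding tempered_distributions_def using assms by blast

lemma tempered_linear:
  assumes "T \<in> tempered_distributions" "\<phi> \<in> schwartz_space"
  shows "\<psi> \<in> schwartz_space \<Longrightarrow> T (\<lambda>x. \<phi> x + \<psi> x) = T \<phi> + T \<psi>"
    and "T (\<lambda>x. c * \<phi> x) = c * T \<phi>"
  using assms by (simp_all add: tempered_distributions_def)

lemma tempered_bound:
  assumes "T \<in> tempered_distributions"
  obtains C N where "C \<ge> 0" "\<And>\<phi>. \<phi> \<in> schwartz_space \<Longrightarrow> norm (T \<phi>) \<le> C * schwartz_seminorm N \<phi>"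
proof -
  obtain N C where *: "\<And>\<phi>. \<phi> \<in> schwartz_space \<Longrightarrow> norm (T \<phi>) \<le> C * schwartz_seminorm N \<phi>"
    using assms unfolding tempered_distributions_def by blast
  have "norm (T \<phi>) \<le> \<bar>C\<bar> * schwartz_seminorm N \<phi>" if "\<phi> \<in> schwartz_space" for \<phi>
    using *[OF that] mult_right_mono[OF abs_ge_self schwartz_seminorm_nonneg[OF that], of C N] by linarith
  then show thesis using that[of "\<bar>C\<bar>" N] by simp
qed

lemma tempered_zero: "(\<lambda>\<phi>. 0) \<in> tempered_distributions"
  by (rule tempered_distributionsI[of _ 0 0]) auto

lemma tempered_add:
  assumes S: "S \<in> tempered_distributions" and T: "T \<in> tempered_distributions"
  shows "(\<lambda>\<phi>. S \<phi> + T \<phi>) \<in> tempered_distributions"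
proof -
  obtain M A where A: "A \<ge> 0" "\<And>\<phi>. \<phi> \<in> schwartz_space \<Longrightarrow> norm (S \<phi>) \<le> A * schwartz_seminorm M \<phi>"
    by (rule tempered_bound[OF S], rule that)
  obtain N B where B: "B \<ge> 0" "\<And>\<phi>. \<phi> \<in> schwartz_space \<Longrightarrow> norm (T \<phi>) \<le> B * schwartz_seminorm N \<phi>"
    by (rule tempered_bound[OF T], rule that)
  show ?thesis
  proof (rule tempered_distributionsI[of _ "A + B" "max M N"])
    fix \<phi> :: "'a \<Rightarrow> complex" assume \<phi>: "\<phi> \<in> schwartz_space"
    have "norm (S \<phi> + T \<phi>) \<le> A * schwartz_seminorm M \<phi> + B * schwartz_seminorm N \<phi>"
      by (intro norm_triangle_mono A B \<phi>)
    also have "\<dots> \<le> A * schwartz_seminorm (max M N) \<phi> + B * schwartz_seminorm (max M N) \<phi>"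
      by (intro add_mono mult_left_mono schwartz_seminorm_mono A B \<phi>) auto
    finally show "norm (S \<phi> + T \<phi>) \<le> (A + B) * schwartz_seminorm (max M N) \<phi>"
      by (simp add: distrib_right)
  qed (use S T in \<open>auto simp: tempered_distributions_def algebra_simps\<close>)
qed

lemma tempered_cmult:
  assumes T: "T \<in> tempered_distributions"
  shows "(\<lambda>\<phi>. c * T \<phi>) \<in> tempered_distributions"
proof -
  obtain N B where B: "B \<ge> 0" "\<And>\<phi>. \<phi> \<in> schwartz_space \<Longrightarrow> norm (T \<phi>) \<le> B * schwartz_seminorm N \<phi>"
    by (rule tempered_bound[OF T], rule that)
  show ?thesis
  proof (rule tempered_distributionsI[of _ "norm c * B" N])
    fix \<phi> :: "'a \<Rightarrow> complex" assume "\<phi> \<in> schwartz_space"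
    from mult_left_mono[OF B(2)[OF this] norm_ge_zero, of c]
    show "norm (c * T \<phi>) \<le> norm c * B * schwartz_seminorm N \<phi>"
      by (simp add: norm_mult mult.assoc)
  qed (use T in \<open>auto simp: tempered_distributions_def algebra_simps\<close>)
qed

lemma tempered_translate:
  assumes T: "T \<in> tempered_distributions"
  shows "translate j T \<in> tempered_distributions"
proof -
  obtain N B where B: "B \<ge> 0" "\<And>\<phi>. \<phi> \<in> schwartz_space \<Longrightarrow> norm (T \<phi>) \<le> B * schwartz_seminorm N \<phi>"
    by (rule tempered_bound[OF T], rule that)
  show ?thesis
  proof (rule tempered_distributionsI[of _ "B * (1 + norm j) ^ N" N])
    fix \<phi> :: "'a \<Rightarrow> complex" assume "\<phi> \<notin> schwartz_space"
    then have "(\<lambda>x. \<phi> (x + j)) \<notin> schwartz_space"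
      using schwartz_shift[of "\<lambda>x. \<phi> (x + j)" "- j"] by auto
    then show "translate j T \<phi> = 0"
      using T by (simp add: translate_def tempered_distributions_def)
  next
    fix \<phi> :: "'a \<Rightarrow> complex" assume \<phi>: "\<phi> \<in> schwartz_space"
    have "norm (translate j T \<phi>) \<le> B * schwartz_seminorm N (\<lambda>x. \<phi> (x + j))"
      unfolding translate_def by (intro B schwartz_shift \<phi>)
    also have "\<dots> \<le> B * ((1 + norm j) ^ N * schwartz_seminorm N \<phi>)"
      by (intro mult_left_mono schwartz_seminorm_shift B \<phi>)
    finally show "norm (translate j T \<phi>) \<le> B * (1 + norm j) ^ N * schwartz_seminorm N \<phi>" by simp
  next
    fix \<phi> \<psi> :: "'a \<Rightarrow> complex" assume "\<phi> \<in> schwartz_space" "\<psi> \<in> schwartz_space"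
    then show "translate j T (\<lambda>x. \<phi> x + \<psi> x) = translate j T \<phi> + translate j T \<psi>"
      unfolding translate_def by (intro tempered_linear(1) T schwartz_shift)
  next
    fix \<phi> :: "'a \<Rightarrow> complex" and c assume "\<phi> \<in> schwartz_space"
    then show "translate j T (\<lambda>x. c * \<phi> x) = c * translate j T \<phi>"
      unfolding translate_def by (intro tempered_linear(2) T schwartz_shift)
  qed
qed

section \<open>Fourier transforms given by functions\<close>

text \<open>
The choice made in \<open>fourier_fun\<close> is inconvenient: the function that represents a sum is
only almost everywhere the sum of the chosen ones. Calculations are done with an arbitrary representing
function instead.
\<close>

definition has_fourier_fun :: "'a::euclidean_space functional \<Rightarrow> ('a \<Rightarrow> complex) \<Rightarrow> bool"
  where "has_fourier_fun T F \<longleftrightarrow> locally_L2 F \<and> represented_by (fourier_transform T) F"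

lemma has_fourier_fun_iff:
  "has_fourier_fun T F \<longleftrightarrow>
    locally_L2 F \<and> (\<forall>\<phi>\<in>test_functions. T (fourier_integral \<phi>) = (LINT x|lborel. F x * \<phi> x))"
  by (auto simp: has_fourier_fun_def represented_by_def fourier_transform_def test_schwartz)

lemma has_fourier_fun_fourier_fun: "has_fourier_fun T F \<Longrightarrow> has_fourier_fun T (fourier_fun T)"
  unfolding has_fourier_fun_def fourier_fun_def by (rule someI[of "\<lambda>F. locally_L2 F \<and> represented_by (fourier_transform T) F" F])

lemma has_fourier_fun_unique:
  assumes "has_fourier_fun T F" "has_fourier_fun T G"
  shows "AE \<omega> in lborel. F \<omega> = G \<omega>"
  using assms by (intro locally_L2_unique) (auto simp: has_fourier_fun_iff)

lemma fourier_fun_AE_eq: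
  "has_fourier_fun T F \<Longrightarrow> AE \<omega> in lborel. fourier_fun T \<omega> = F \<omega>"
  using has_fourier_fun_unique has_fourier_fun_fourier_fun by blast

lemma locally_L2_bound:
  assumes F: "locally_L2 F" and [measurable]: "G \<in> borel_measurable borel" and le: "\<And>x. norm (G x) \<le> C * norm (F x)"
  shows "locally_L2 G"
  unfolding locally_L2_def
proof (intro conjI allI impI)
  fix K :: "'a set" assume K: "compact K"
  have [measurable]: "F \<in> borel_measurable borel" using F by (rule locally_L2_borel)
  have [measurable]: "K \<in> sets borel" using K by (simp add: compact_imp_closed borel_closed)
  have "set_integrable lborel K (\<lambda>x. (norm (F x))\<^sup>2)" using F K by (simp add: locally_L2_def)
  then have "integrable lborel (\<lambda>x. C\<^sup>2 * (indicat_real K x *\<^sub>R (norm (F x))\<^sup>2))"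
    unfolding set_integrable_def by (rule integrable_mult_right)
  then show "set_integrable lborel K (\<lambda>x. (norm (G x))\<^sup>2)"
    unfolding set_integrable_def
  proof (rule Bochner_Integration.integrable_bound)
    have "(norm (G x))\<^sup>2 \<le> C\<^sup>2 * (norm (F x))\<^sup>2" for x
      using power_mono[OF le, of x 2] by (simp add: power_mult_distrib)
    then show "AE x in lborel. norm (indicat_real K x *\<^sub>R (norm (G x))\<^sup>2) \<le> norm (C\<^sup>2 * (indicat_real K x *\<^sub>R (norm (F x))\<^sup>2))"
      by (intro AE_I2) (auto simp: indicator_def)
  qed measurable
qed measurable

lemma norm_add_square_le: "(norm (a + b))\<^sup>2 \<le> 2 * ((norm a)\<^sup>2 + (norm b)\<^sup>2)" for a b :: "'a::real_normed_vector"
proof -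
  have "(norm (a + b))\<^sup>2 \<le> (norm a + norm b)\<^sup>2"
    by (intro power_mono norm_triangle_ineq) auto
  also have "\<dots> \<le> 2 * ((norm a)\<^sup>2 + (norm b)\<^sup>2)"
    using zero_le_power2[of "norm a - norm b"] by (simp add: power2_eq_square algebra_simps)
  finally show ?thesis .
qed

lemma locally_L2_add:
  assumes F: "locally_L2 F" and G: "locally_L2 G"
  shows "locally_L2 (\<lambda>x. F x + G x)"
  unfolding locally_L2_def
proof (intro conjI allI impI)
  have [measurable]: "F \<in> borel_measurable borel" "G \<in> borel_measurable borel"
    using F G by (auto intro: locally_L2_borel)
  show "(\<lambda>x. F x + G x) \<in> borel_measurable borel" by measurable
  fix K :: "'a set" assume K: "compact K"
  have [measurable]: "K \<in> sets borel" using K by (simp add: compact_imp_closed borel_closed)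
  have "set_integrable lborel K (\<lambda>x. (norm (F x))\<^sup>2)" "set_integrable lborel K (\<lambda>x. (norm (G x))\<^sup>2)"
    using F G K by (auto simp: locally_L2_def)
  then have "integrable lborel (\<lambda>x. 2 * (indicat_real K x *\<^sub>R (norm (F x))\<^sup>2 + indicat_real K x *\<^sub>R (norm (G x))\<^sup>2))"
    unfolding set_integrable_def by (intro integrable_mult_right Bochner_Integration.integrable_add)
  then show "set_integrable lborel K (\<lambda>x. (norm (F x + G x))\<^sup>2)"
    unfolding set_integrable_def
  proof (rule Bochner_Integration.integrable_bound)
    show "AE x in lborel. norm (indicat_real K x *\<^sub>R (norm (F x + G x))\<^sup>2) \<le>
        norm (2 * (indicat_real K x *\<^sub>R (norm (F x))\<^sup>2 + indicat_real K x *\<^sub>R (norm (G x))\<^sup>2))"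
      using norm_add_square_le[of "F x" "G x" for x] by (intro AE_I2) (auto simp: indicator_def)
  qed measurable
qed

lemma locally_L2_affine:
  assumes F: "locally_L2 F" and c: "c \<noteq> 0"
  shows "locally_L2 (\<lambda>x. F (c *\<^sub>R x))"
  unfolding locally_L2_def
proof (intro conjI allI impI)
  have [measurable]: "F \<in> borel_measurable borel" using F by (rule locally_L2_borel)
  show "(\<lambda>x. F (c *\<^sub>R x)) \<in> borel_measurable borel" by measurable
  fix K :: "'a set" assume K: "compact K"
  have "compact ((*\<^sub>R) c ` K)" by (rule compact_scaling[OF K])
  then have "integrable lborel (\<lambda>x. indicat_real ((*\<^sub>R) c ` K) x *\<^sub>R (norm (F x))\<^sup>2)"
    using F by (simp add: locally_L2_def set_integrable_def)
  from lborel_integrable_affine[OF c this, of 0]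
  have "integrable lborel (\<lambda>x. indicat_real ((*\<^sub>R) c ` K) (c *\<^sub>R x) *\<^sub>R (norm (F (c *\<^sub>R x)))\<^sup>2)" by simp
  moreover have "indicat_real ((*\<^sub>R) c ` K) (c *\<^sub>R x) = indicat_real K x" for x
    using c by (auto simp: indicator_def)
  ultimately show "set_integrable lborel K (\<lambda>x. (norm (F (c *\<^sub>R x)))\<^sup>2)"
    by (simp add: set_integrable_def)
qed

lemma has_fourier_fun_zero: "has_fourier_fun (\<lambda>\<phi>. 0) (\<lambda>\<omega>. 0)"
  by (simp add: has_fourier_fun_iff locally_L2_def set_integrable_def)

lemma has_fourier_fun_add:
  assumes "has_fourier_fun S F" "has_fourier_fun T G"
  shows "has_fourier_fun (\<lambda>\<phi>. S \<phi> + T \<phi>) (\<lambda>\<omega>. F \<omega> + G \<omega>)"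
  unfolding has_fourier_fun_iff
proof (intro conjI ballI)
  have FG: "locally_L2 F" "locally_L2 G" using assms by (auto simp: has_fourier_fun_iff)
  then show "locally_L2 (\<lambda>\<omega>. F \<omega> + G \<omega>)" by (rule locally_L2_add)
  fix \<phi> :: "'a \<Rightarrow> complex" assume \<phi>: "\<phi> \<in> test_functions"
  have "(LINT x|lborel. (F x + G x) * \<phi> x) = (LINT x|lborel. F x * \<phi> x) + (LINT x|lborel. G x * \<phi> x)"
    using Bochner_Integration.integral_add[OF locally_L2_test_integrable[OF FG(1) \<phi>] locally_L2_test_integrable[OF FG(2) \<phi>]]
    by (simp add: distrib_right)
  then show "S (fourier_integral \<phi>) + T (fourier_integral \<phi>) = (LINT x|lborel. (F x + G x) * \<phi> x)"
    using assms \<phi> by (simp add: has_fourier_fun_iff)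
qed

lemma has_fourier_fun_cmult:
  assumes "has_fourier_fun T F"
  shows "has_fourier_fun (\<lambda>\<phi>. c * T \<phi>) (\<lambda>\<omega>. c * F \<omega>)"
proof -
  have F: "locally_L2 F" using assms by (simp add: has_fourier_fun_iff)
  then have [measurable]: "F \<in> borel_measurable borel" by (rule locally_L2_borel)
  have "locally_L2 (\<lambda>\<omega>. c * F \<omega>)"
    by (rule locally_L2_bound[OF F, of _ "norm c"]) (measurable, simp add: norm_mult)
  then show ?thesis using assms by (auto simp: has_fourier_fun_iff mult.assoc)
qed

lemma has_fourier_fun_diff:
  assumes "has_fourier_fun S F" "has_fourier_fun T G"
  shows "has_fourier_fun (\<lambda>\<phi>. S \<phi> - T \<phi>) (\<lambda>\<omega>. F \<omega> - G \<omega>)"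
  using has_fourier_fun_add[OF assms(1) has_fourier_fun_cmult[OF assms(2), of "-1"]] by simp

lemma has_fourier_fun_translate:
  assumes "has_fourier_fun T F"
  shows "has_fourier_fun (translate j T) (\<lambda>\<omega>. character j \<omega> * F \<omega>)"
  unfolding has_fourier_fun_iff
proof (intro conjI ballI)
  have F: "locally_L2 F" using assms by (simp add: has_fourier_fun_iff)
  then have [measurable]: "F \<in> borel_measurable borel" by (rule locally_L2_borel)
  show "locally_L2 (\<lambda>\<omega>. character j \<omega> * F \<omega>)"
    by (rule locally_L2_bound[OF F, of _ 1]) (measurable, simp add: norm_mult norm_character)
  fix \<phi> :: "'a \<Rightarrow> complex" assume \<phi>: "\<phi> \<in> test_functions"
  have eq: "fourier_integral \<phi> (x + j) = fourier_integral (\<lambda>\<omega>. character j \<omega> * \<phi> \<omega>) x" for x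
    by (simp add: fourier_integral_def inner_add_left algebra_simps exp_diff exp_minus field_simps)
  have "(\<lambda>\<omega>. character j \<omega> * \<phi> \<omega>) \<in> test_functions"
    by (intro test_mult_smooth smooth_character \<phi>)
  then show "translate j T (fourier_integral \<phi>) = (LINT x|lborel. character j x * F x * \<phi> x)"
    using assms unfolding has_fourier_fun_iff translate_def eq by (simp add: mult_ac)
qed

lemma has_fourier_fun_dilate:
  fixes T :: "'a::euclidean_space functional"
  assumes "has_fourier_fun T F" and h: "h > 0"
  shows "has_fourier_fun (dilate h T) (\<lambda>\<omega>. of_real (h ^ DIM('a)) * F (h *\<^sub>R \<omega>))"
  unfolding has_fourier_fun_iff
proof (intro conjI ballI)
  have F: "locally_L2 F" using assms by (simp add: has_fourier_fun_iff)
  then have [measurable]: "F \<in> borel_measurable borel" by (rule locally_L2_borel)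
  show "locally_L2 (\<lambda>\<omega>. of_real (h ^ DIM('a)) * F (h *\<^sub>R \<omega>))"
    by (rule locally_L2_bound[OF locally_L2_affine[OF F, of h], of _ "h ^ DIM('a)"])
       (use h in \<open>auto simp: norm_mult norm_power\<close>)
  fix \<phi> :: "'a \<Rightarrow> complex" assume \<phi>: "\<phi> \<in> test_functions"
  let ?\<psi> = "\<lambda>x. of_real (inverse (h ^ DIM('a))) * \<phi> (inverse h *\<^sub>R x)"
  have [measurable]: "\<phi> \<in> borel_measurable borel" using \<phi> by (simp add: smooth_borel test_smooth)
  have \<psi>: "?\<psi> \<in> test_functions"
    using test_mult_smooth[OF smooth_const test_affine[OF \<phi>, of "inverse h" 0], of "of_real (inverse (h ^ DIM('a)))"] h by simp
  have eq: "fourier_integral \<phi> (h *\<^sub>R x) = fourier_integral ?\<psi> x" for x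
    using fourier_integral_affine[of \<phi> "inverse h" "h *\<^sub>R x" 0] h
    by (simp add: power_inverse) (simp add: fourier_integral_def mult.assoc)
  have "dilate h T (fourier_integral \<phi>) = of_real (h ^ DIM('a)) * (LINT x|lborel. F x * ?\<psi> x)"
    using assms(1) \<psi> unfolding dilate_def eq has_fourier_fun_iff by simp
  also have "\<dots> = (LINT x|lborel. F x * \<phi> (inverse h *\<^sub>R x))"
    using h by (subst integral_mult_right_zero[symmetric]) (simp add: field_simps)
  also have "\<dots> = h ^ DIM('a) *\<^sub>R (LINT x|lborel. F (h *\<^sub>R x) * \<phi> x)"
    using lborel_integral_affine[of h "\<lambda>x. F x * \<phi> (inverse h *\<^sub>R x)" 0] h by simp
  also have "\<dots> = (LINT x|lborel. of_real (h ^ DIM('a)) * F (h *\<^sub>R x) * \<phi> x)"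
    by (simp add: mult.assoc scaleR_conv_of_real)
  finally show "dilate h T (fourier_integral \<phi>) = (LINT x|lborel. of_real (h ^ DIM('a)) * F (h *\<^sub>R x) * \<phi> x)" .
qed

section \<open>Sobolev spaces\<close>

text \<open>
Null sets do not affect the norm, so it can be read off from any representing function.
\<close>

lemma sobolev_norm_eq:
  assumes "has_fourier_fun T F"
  shows "sobolev_norm s T = sqrt (LINT \<omega>|lborel. (1 + norm \<omega>) powr (2 * s) * (norm (F \<omega>))\<^sup>2)"
proof -
  have [measurable]: "F \<in> borel_measurable borel" "fourier_fun T \<in> borel_measurable borel"
    using assms has_fourier_fun_fourier_fun[OF assms] by (auto simp: has_fourier_fun_def locally_L2_borel)
  have "(LINT \<omega>|lborel. (1 + norm \<omega>) powr (2 * s) * (norm (fourier_fun T \<omega>))\<^sup>2) =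
      (LINT \<omega>|lborel. (1 + norm \<omega>) powr (2 * s) * (norm (F \<omega>))\<^sup>2)"
    by (rule integral_cong_AE) (use fourier_fun_AE_eq[OF assms] in \<open>auto elim: eventually_mono\<close>)
  then show ?thesis by (simp add: sobolev_norm_def)
qed

lemma sobolev_spaceI:
  assumes "T \<in> tempered_distributions" and T: "has_fourier_fun T F"
    and i: "integrable lborel (\<lambda>\<omega>. (1 + norm \<omega>) powr (2 * s) * (norm (F \<omega>))\<^sup>2)"
  shows "T \<in> sobolev_space s"
proof -
  have [measurable]: "F \<in> borel_measurable borel" "fourier_fun T \<in> borel_measurable borel"
    using T has_fourier_fun_fourier_fun[OF T] by (auto simp: has_fourier_fun_def locally_L2_borel)
  have "integrable lborel (\<lambda>\<omega>. (1 + norm \<omega>) powr (2 * s) * (norm (fourier_fun T \<omega>))\<^sup>2) \<longleftrightarrow>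
    integrable lborel (\<lambda>\<omega>. (1 + norm \<omega>) powr (2 * s) * (norm (F \<omega>))\<^sup>2)"
    by (rule integrable_cong_AE) (use fourier_fun_AE_eq[OF T] in \<open>auto elim: eventually_mono\<close>)
  then show ?thesis using assms by (auto simp: sobolev_space_def has_fourier_fun_def)
qed

lemma sobolev_space_tempered: "T \<in> sobolev_space s \<Longrightarrow> T \<in> tempered_distributions"
  by (simp add: sobolev_space_def)

lemma sobolev_space_fourier_fun:
  "T \<in> sobolev_space s \<Longrightarrow> has_fourier_fun T (fourier_fun T)"
  using has_fourier_fun_fourier_fun[of T] by (auto simp: sobolev_space_def has_fourier_fun_def)

lemma sobolev_space_integrable:
  "T \<in> sobolev_space s \<Longrightarrow> integrable lborel (\<lambda>\<omega>. (1 + norm \<omega>) powr (2 * s) * (norm (fourier_fun T \<omega>))\<^sup>2)"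
  by (simp add: sobolev_space_def)

lemma fourier_fun_borel: "T \<in> sobolev_space s \<Longrightarrow> fourier_fun T \<in> borel_measurable borel"
  using sobolev_space_fourier_fun locally_L2_borel unfolding has_fourier_fun_def by blast

lemma sobolev_zero: "(\<lambda>\<phi>. 0) \<in> sobolev_space s"
  by (rule sobolev_spaceI[OF tempered_zero has_fourier_fun_zero]) simp

text \<open>
The pointwise bound \<open>|a + b|\<^sup>2 \<le> 2 (|a|\<^sup>2 + |b|\<^sup>2)\<close> integrates to a triangle inequality with a constant.
\<close>

lemma
  assumes S: "S \<in> sobolev_space s" and T: "T \<in> sobolev_space s"
  shows sobolev_add: "(\<lambda>\<phi>. S \<phi> + T \<phi>) \<in> sobolev_space s"
    and sobolev_norm_add_le: "sobolev_norm s (\<lambda>\<phi>. S \<phi> + T \<phi>) \<le> 2 * (sobolev_norm s S + sobolev_norm s T)"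
proof -
  define w where "w \<omega> = (1 + norm \<omega>) powr (2 * s)" for \<omega> :: 'a
  define F G where "F = fourier_fun S" and "G = fourier_fun T"
  have [measurable]: "F \<in> borel_measurable borel" "G \<in> borel_measurable borel" "w \<in> borel_measurable borel"
    using S T by (auto simp: F_def G_def fourier_fun_borel w_def[abs_def])
  have h: "has_fourier_fun (\<lambda>\<phi>. S \<phi> + T \<phi>) (\<lambda>\<omega>. F \<omega> + G \<omega>)"
    unfolding F_def G_def using S T by (intro has_fourier_fun_add sobolev_space_fourier_fun)
  have iF: "integrable lborel (\<lambda>\<omega>. w \<omega> * (norm (F \<omega>))\<^sup>2)" and iG: "integrable lborel (\<lambda>\<omega>. w \<omega> * (norm (G \<omega>))\<^sup>2)"
    using S T by (auto simp: w_def F_def G_def sobolev_space_integrable)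
  have i2: "integrable lborel (\<lambda>\<omega>. 2 * (w \<omega> * (norm (F \<omega>))\<^sup>2 + w \<omega> * (norm (G \<omega>))\<^sup>2))"
    by (intro integrable_mult_right Bochner_Integration.integrable_add iF iG)
  have le: "w \<omega> * (norm (F \<omega> + G \<omega>))\<^sup>2 \<le> 2 * (w \<omega> * (norm (F \<omega>))\<^sup>2 + w \<omega> * (norm (G \<omega>))\<^sup>2)" for \<omega>
    using mult_left_mono[OF norm_add_square_le[of "F \<omega>" "G \<omega>"], of "w \<omega>"] by (simp add: w_def algebra_simps)
  have i: "integrable lborel (\<lambda>\<omega>. w \<omega> * (norm (F \<omega> + G \<omega>))\<^sup>2)"
    by (rule Bochner_Integration.integrable_bound[OF i2], measurable)
       (use le in \<open>auto intro!: AE_I2 order_trans[OF _ abs_ge_self] simp: w_def abs_mult\<close>)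
  show "(\<lambda>\<phi>. S \<phi> + T \<phi>) \<in> sobolev_space s"
    by (rule sobolev_spaceI[OF tempered_add[OF S[THEN sobolev_space_tempered] T[THEN sobolev_space_tempered]] h])
       (use i in \<open>simp add: w_def\<close>)
  define a b where "a = (LINT \<omega>|lborel. w \<omega> * (norm (F \<omega>))\<^sup>2)" and "b = (LINT \<omega>|lborel. w \<omega> * (norm (G \<omega>))\<^sup>2)"
  have ab: "a \<ge> 0" "b \<ge> 0" by (auto simp: a_def b_def w_def intro!: Bochner_Integration.integral_nonneg)
  have "(LINT \<omega>|lborel. w \<omega> * (norm (F \<omega> + G \<omega>))\<^sup>2) \<le> 2 * (a + b)"
  proof -
    have "(LINT \<omega>|lborel. w \<omega> * (norm (F \<omega> + G \<omega>))\<^sup>2) \<le>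
        (LINT \<omega>|lborel. 2 * (w \<omega> * (norm (F \<omega>))\<^sup>2 + w \<omega> * (norm (G \<omega>))\<^sup>2))"
      by (rule Bochner_Integration.integral_mono[OF i i2 le])
    also have "\<dots> = 2 * (a + b)"
      unfolding a_def b_def by (subst integral_mult_right_zero) (simp only: Bochner_Integration.integral_add[OF iF iG])
    finally show ?thesis .
  qed
  also have "2 * (a + b) \<le> (2 * (sqrt a + sqrt b))\<^sup>2"
  proof -
    have "(2 * (sqrt a + sqrt b))\<^sup>2 = 4 * ((sqrt a)\<^sup>2 + (sqrt b)\<^sup>2) + 8 * (sqrt a * sqrt b)"
      by algebra
    then have e: "(2 * (sqrt a + sqrt b))\<^sup>2 = 4 * (a + b) + 8 * (sqrt a * sqrt b)"
      using ab by simp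
    have "0 \<le> sqrt a * sqrt b" using ab by simp
    with ab have "0 \<le> 2 * a + 2 * b + 8 * (sqrt a * sqrt b)" by (intro add_nonneg_nonneg mult_nonneg_nonneg) auto
    then show ?thesis unfolding e by (simp add: algebra_simps)
  qed
  finally have "sqrt (LINT \<omega>|lborel. w \<omega> * (norm (F \<omega> + G \<omega>))\<^sup>2) \<le> 2 * (sqrt a + sqrt b)"
    using ab by (intro real_le_lsqrt) auto
  then show "sobolev_norm s (\<lambda>\<phi>. S \<phi> + T \<phi>) \<le> 2 * (sobolev_norm s S + sobolev_norm s T)"
    unfolding sobolev_norm_eq[OF h] sobolev_norm_def a_def b_def w_def F_def G_def .
qed

lemma
  assumes T: "T \<in> sobolev_space s"
  shows sobolev_cmult: "(\<lambda>\<phi>. c * T \<phi>) \<in> sobolev_space s"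
    and sobolev_norm_cmult: "sobolev_norm s (\<lambda>\<phi>. c * T \<phi>) = norm c * sobolev_norm s T"
proof -
  note h = has_fourier_fun_cmult[OF sobolev_space_fourier_fun[OF T], of c]
  have eq: "(1 + norm \<omega>) powr (2 * s) * (norm (c * fourier_fun T \<omega>))\<^sup>2 =
    (norm c)\<^sup>2 * ((1 + norm \<omega>) powr (2 * s) * (norm (fourier_fun T \<omega>))\<^sup>2)" for \<omega>
    by (simp add: norm_mult power_mult_distrib)
  show "(\<lambda>\<phi>. c * T \<phi>) \<in> sobolev_space s"
    by (rule sobolev_spaceI[OF tempered_cmult[OF sobolev_space_tempered[OF T]] h])
       (unfold eq, intro integrable_mult_right sobolev_space_integrable T)
  show "sobolev_norm s (\<lambda>\<phi>. c * T \<phi>) = norm c * sobolev_norm s T"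
    unfolding sobolev_norm_eq[OF h] eq by (simp add: sobolev_norm_def real_sqrt_mult)
qed

lemma
  assumes T: "T \<in> sobolev_space s"
  shows sobolev_translate: "translate j T \<in> sobolev_space s"
    and sobolev_norm_translate: "sobolev_norm s (translate j T) = sobolev_norm s T"
proof -
  note h = has_fourier_fun_translate[OF sobolev_space_fourier_fun[OF T], of j]
  have eq: "(norm (character j \<omega> * fourier_fun T \<omega>))\<^sup>2 = (norm (fourier_fun T \<omega>))\<^sup>2" for \<omega>
    by (simp add: norm_mult norm_character del: norm_exp_eq_Re)
  show "translate j T \<in> sobolev_space s"
    by (rule sobolev_spaceI[OF tempered_translate[OF sobolev_space_tempered[OF T]] h])
       (unfold eq, intro sobolev_space_integrable T)
  show "sobolev_norm s (translate j T) = sobolev_norm s T"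
    unfolding sobolev_norm_eq[OF h] eq by (simp add: sobolev_norm_def)
qed

lemma sobolev_diff:
  assumes "S \<in> sobolev_space s" "T \<in> sobolev_space s"
  shows "(\<lambda>\<phi>. S \<phi> - T \<phi>) \<in> sobolev_space s"
  using sobolev_add[OF assms(1) sobolev_cmult[OF assms(2), of "-1"]] by simp

lemma sobolev_norm_diff_triangle:
  assumes "f \<in> sobolev_space s" "g \<in> sobolev_space s" "k \<in> sobolev_space s"
  shows "sobolev_norm s (\<lambda>\<phi>. f \<phi> - k \<phi>) \<le>
    2 * (sobolev_norm s (\<lambda>\<phi>. f \<phi> - g \<phi>) + sobolev_norm s (\<lambda>\<phi>. g \<phi> - k \<phi>))"
  using sobolev_norm_add_le[OF sobolev_diff[OF assms(1,2)] sobolev_diff[OF assms(2,3)]] by simp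

lemma weight_upper_bound:
  fixes k :: real
  assumes "0 \<le> r" "r \<le> R"
  shows "(1 + r) powr k \<le> (1 + R) powr \<bar>k\<bar>"
proof -
  have "(1 + r) powr k \<le> (1 + r) powr \<bar>k\<bar>" using assms by (intro powr_mono) auto
  also have "\<dots> \<le> (1 + R) powr \<bar>k\<bar>" using assms by (intro powr_mono2) auto
  finally show ?thesis .
qed

text \<open>
The inverse Fourier integral \<open>u\<close> of \<open>F\<close> is a bounded function and hence defines a tempered distribution
by integration. Its Fourier transform applied to a test function \<open>\<phi>\<close> pairs \<open>u\<close> with \<open>\<phi>^\<close>, and
exchanging the integrals leaves \<open>F\<close> paired with the inverse transform of \<open>\<phi>^\<close>, which is \<open>c \<phi>\<close>.
The support of \<open>F\<close> being bounded, the same distribution serves all weights.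
\<close>

theorem sobolev_space_with_fourier_fun:
  fixes F :: "'a::euclidean_space \<Rightarrow> complex"
  assumes F[measurable]: "F \<in> borel_measurable borel"
    and B: "\<And>\<omega>. norm (F \<omega>) \<le> B" and R: "\<And>\<omega>. norm \<omega> > R \<Longrightarrow> F \<omega> = 0"
  obtains f where "\<And>k. f \<in> sobolev_space k" "has_fourier_fun f F"
proof -
  have B0: "B \<ge> 0" using B norm_ge_zero order_trans by blast
  have ball: "integrable lborel (\<lambda>x::'a. C * indicator (cball 0 R) x)" for C :: real
    using emeasure_compact_finite[OF compact_cball[of "0::'a" R]]
    by (intro integrable_mult_right integrable_real_indicator) (auto simp: less_top)
  have bounded_integrable: "integrable lborel g"
    if [measurable]: "g \<in> borel_measurable borel" and le: "\<And>x. norm x \<le> R \<Longrightarrow> norm (g x) \<le> C"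
      and z: "\<And>x. norm x > R \<Longrightarrow> g x = 0"
    for g :: "'a \<Rightarrow> 'b::{banach, second_countable_topology}" and C
  proof (rule Bochner_Integration.integrable_bound[OF ball[of C]])
    show "AE x in lborel. norm (g x) \<le> norm (C * indicator (cball 0 R) x)"
    proof (intro AE_I2)
      fix x
      show "norm (g x) \<le> norm (C * indicator (cball 0 R) x)"
        using le[of x] z[of x] by (cases "norm x \<le> R") auto
    qed
  qed measurable
  have iF: "integrable lborel F"
    by (rule bounded_integrable[of _ B]) (use B R in auto)
  have locF: "locally_L2 F"
    unfolding locally_L2_def
  proof (intro conjI allI impI F)
    fix K :: "'a set" assume "compact K"
    then have [measurable]: "K \<in> sets borel" by (simp add: compact_imp_closed borel_closed)
    have "(norm (F x))\<^sup>2 \<le> B\<^sup>2" for x by (intro power_mono B) auto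
    then show "set_integrable lborel K (\<lambda>x. (norm (F x))\<^sup>2)"
      unfolding set_integrable_def
      by (intro bounded_integrable[of _ "B\<^sup>2"]) (use R B0 in \<open>auto simp: indicator_def\<close>)
  qed
  obtain c where c: "c \<noteq> 0" and inv: "\<And>\<phi> (\<omega>::'a). \<phi> \<in> test_functions \<Longrightarrow>
      (LINT x|lborel. fourier_integral \<phi> x * exp (\<i> * of_real (\<omega> \<bullet> x))) = c * \<phi> \<omega>"
    using fourier_inversion by blast
  define u where "u x = (LINT \<omega>|lborel. F \<omega> * exp (\<i> * of_real (\<omega> \<bullet> x)))" for x
  have [measurable]: "u \<in> borel_measurable borel"
  proof -
    have "(\<lambda>(x, \<omega>). F \<omega> * exp (\<i> * of_real (\<omega> \<bullet> x))) \<in> borel_measurable (borel \<Otimes>\<^sub>M lborel)"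
      using character_measurable(2)[where 'a='a] measurable_pair_swap_iff[of "\<lambda>(x, \<omega>). exp (\<i> * complex_of_real (\<omega> \<bullet> x))" "borel :: 'a measure" "borel :: 'a measure" borel]
      by (auto simp: case_prod_beta intro!: borel_measurable_times)
    then show ?thesis unfolding u_def by (intro sigma_finite_measure.borel_measurable_lebesgue_integral[OF sigma_finite_lborel])
  qed
  define M where "M = (LINT \<omega>|lborel. norm (F \<omega>))"
  have uM: "norm (u x) \<le> M" for x
    unfolding u_def M_def
    using integral_norm_bound[of lborel "\<lambda>\<omega>. F \<omega> * exp (\<i> * of_real (\<omega> \<bullet> x))"] by (simp add: norm_mult del: integral_norm_bound)
  have M0: "M \<ge> 0" using uM norm_ge_zero order_trans by blast
  have iu: "integrable lborel (\<lambda>x. u x * \<phi> x)" if "\<phi> \<in> schwartz_space" for \<phi>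
  proof (rule Bochner_Integration.integrable_bound)
    show "integrable lborel (\<lambda>x. M * norm (\<phi> x))"
      by (intro integrable_mult_right integrable_norm schwartz_integrable that)
    show "AE x in lborel. norm (u x * \<phi> x) \<le> norm (M * norm (\<phi> x))"
      using uM M0 by (intro AE_I2) (auto simp: norm_mult intro!: mult_right_mono)
  qed (use schwartz_borel[OF that] in measurable)
  define T where "T \<phi> = (if \<phi> \<in> schwartz_space then inverse c * (LINT x|lborel. u x * \<phi> x) else 0)" for \<phi>
  define A where "A = (LINT x|lborel. inverse ((1 + norm (x::'a)) ^ (DIM('a) + 2)))"
  have "T \<in> tempered_distributions"
  proof (rule tempered_distributionsI[of _ "norm (inverse c) * (M * A)" "DIM('a) + 2"])
    fix \<phi> \<psi> :: "'a \<Rightarrow> complex" assume "\<phi> \<in> schwartz_space" "\<psi> \<in> schwartz_space"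
    then show "T (\<lambda>x. \<phi> x + \<psi> x) = T \<phi> + T \<psi>"
      using Bochner_Integration.integral_add[OF iu iu, of \<phi> \<psi>] by (simp add: T_def schwartz_add distrib_left)
  next
    fix \<phi> :: "'a \<Rightarrow> complex" and d assume "\<phi> \<in> schwartz_space"
    then show "T (\<lambda>x. d * \<phi> x) = d * T \<phi>"
      by (simp add: T_def schwartz_cmult mult.left_commute)
  next
    fix \<phi> :: "'a \<Rightarrow> complex" assume \<phi>: "\<phi> \<in> schwartz_space"
    have "norm (LINT x|lborel. u x * \<phi> x) \<le> (LINT x|lborel. M * norm (\<phi> x))"
      using uM by (intro Bochner_Integration.integral_norm_bound_integral iu \<phi> integrable_mult_right integrable_norm schwartz_integrable)
        (auto simp: norm_mult intro!: mult_right_mono)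
    also have "\<dots> \<le> M * (A * schwartz_seminorm (DIM('a) + 2) \<phi>)"
      using schwartz_integral_bound[OF \<phi>] M0 by (auto simp: A_def intro!: mult_left_mono)
    finally show "norm (T \<phi>) \<le> norm (inverse c) * (M * A) * schwartz_seminorm (DIM('a) + 2) \<phi>"
      using \<phi> by (simp add: T_def norm_mult mult.assoc mult_left_mono)
  qed (simp add: T_def)
  moreover have T: "has_fourier_fun T F"
    unfolding has_fourier_fun_iff
  proof (intro conjI ballI locF)
    fix \<phi> :: "'a \<Rightarrow> complex" assume \<phi>: "\<phi> \<in> test_functions"
    let ?k = "\<lambda>\<omega> x. F \<omega> * fourier_integral \<phi> x * exp (\<i> * of_real (\<omega> \<bullet> x))"
    have i: "integrable (lborel \<Otimes>\<^sub>M lborel) (\<lambda>(\<omega>, x). ?k \<omega> x)"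
      by (rule integrable_pair_bounded_kernel) (use iF \<phi> in \<open>auto simp: fourier_integral_integrable\<close>)
    have "(LINT x|lborel. u x * fourier_integral \<phi> x) = (LINT x|lborel. LINT \<omega>|lborel. ?k \<omega> x)"
      unfolding u_def by (subst integral_mult_left_zero[symmetric]) (simp add: mult_ac)
    also have "\<dots> = (LINT \<omega>|lborel. LINT x|lborel. ?k \<omega> x)"
      using lborel_pair.Fubini_integral[OF i] by simp
    also have "\<dots> = (LINT \<omega>|lborel. F \<omega> * (c * \<phi> \<omega>))"
      unfolding mult.assoc by (simp add: inv[OF \<phi>])
    also have "\<dots> = c * (LINT \<omega>|lborel. F \<omega> * \<phi> \<omega>)"
      by (subst integral_mult_right_zero[symmetric]) (simp add: mult_ac)
    finally show "T (fourier_integral \<phi>) = (LINT x|lborel. F x * \<phi> x)"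
      using c fourier_integral_schwartz[OF \<phi>] by (simp add: T_def)
  qed
  moreover have "integrable lborel (\<lambda>\<omega>. (1 + norm \<omega>) powr (2 * k) * (norm (F \<omega>))\<^sup>2)" for k
  proof (rule bounded_integrable[of _ "(1 + R) powr \<bar>2 * k\<bar> * B\<^sup>2"])
    fix \<omega> :: 'a assume "norm \<omega> \<le> R"
    then have "(1 + norm \<omega>) powr (2 * k) * (norm (F \<omega>))\<^sup>2 \<le> (1 + R) powr \<bar>2 * k\<bar> * B\<^sup>2"
      by (intro mult_mono weight_upper_bound power_mono B) auto
    then show "norm ((1 + norm \<omega>) powr (2 * k) * (norm (F \<omega>))\<^sup>2) \<le> (1 + R) powr \<bar>2 * k\<bar> * B\<^sup>2" by simp
  qed (use R in \<open>auto\<close>)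
  ultimately show thesis using that sobolev_spaceI by blast
qed

section \<open>Fibers over the frequency lattice\<close>

definition frequency_lattice :: "(real ^ 'd) set"
  where "frequency_lattice = (\<lambda>j. (2 * pi) *\<^sub>R j) ` integer_lattice"

lemma countable_frequency_lattice: "countable (frequency_lattice :: (real ^ 'd) set)"
proof -
  have "j \<in> range (\<lambda>f :: 'd \<Rightarrow> int. \<chi> i. real_of_int (f i))" if "j \<in> integer_lattice" for j :: "real ^ 'd"
  proof
    show "j = (\<chi> i. real_of_int \<lfloor>j $ i\<rfloor>)"
      using that by (auto simp: integer_lattice_def vec_eq_iff)
  qed simp
  then have "(integer_lattice :: (real ^ 'd) set) \<subseteq> range (\<lambda>f :: 'd \<Rightarrow> int. \<chi> i. real_of_int (f i))"
    by blast
  then show ?thesis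
    unfolding frequency_lattice_def by (meson countable_image countable_subset countableI_type)
qed

lemma zero_frequency: "0 \<in> frequency_lattice"
  by (auto simp: frequency_lattice_def integer_lattice_def intro!: image_eqI[of _ _ 0])

lemma frequency_lattice_diff:
  "\<alpha> \<in> frequency_lattice \<Longrightarrow> \<beta> \<in> frequency_lattice \<Longrightarrow> \<alpha> - \<beta> \<in> frequency_lattice"
  by (auto simp: frequency_lattice_def integer_lattice_def scaleR_diff_right[symmetric])

lemma norm_frequency_ge:
  assumes "\<alpha> \<in> frequency_lattice" "\<alpha> \<noteq> 0"
  shows "norm \<alpha> \<ge> 6"
proof -
  obtain j where j: "j \<in> integer_lattice" "\<alpha> = (2 * pi) *\<^sub>R j"
    using assms by (auto simp: frequency_lattice_def)
  then obtain i where i: "j $ i \<noteq> 0" using assms(2) by (auto simp: vec_eq_iff)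
  obtain n where n: "j $ i = of_int n" using j(1) by (auto simp: integer_lattice_def elim: Ints_cases)
  have "1 \<le> \<bar>j $ i\<bar>" using i n by simp
  also have "\<dots> \<le> norm j" by (rule component_le_norm_cart)
  finally have "norm j \<ge> 1" .
  moreover have "6 \<le> 2 * pi" using pi_gt3 by simp
  ultimately have "6 * 1 \<le> 2 * pi * norm j" by (intro mult_mono) auto
  then show ?thesis by (simp add: j(2))
qed

lemma character_periodic:
  assumes "j \<in> integer_lattice" "\<alpha> \<in> frequency_lattice"
  shows "character j (\<omega> + \<alpha>) = character j \<omega>"
proof -
  obtain i where i: "i \<in> integer_lattice" "\<alpha> = (2 * pi) *\<^sub>R i"
    using assms(2) by (auto simp: frequency_lattice_def)
  have "j \<bullet> i \<in> \<int>"
    using assms(1) i(1) by (auto simp: inner_vec_def integer_lattice_def intro!: Ints_sum Ints_mult)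
  then obtain n where "j \<bullet> i = of_int n" by (auto elim: Ints_cases)
  then have "character j \<alpha> = exp (2 * of_int (- n) * of_real pi * \<i>)"
    by (simp add: i(2) mult_ac)
  also have "\<dots> = 1" using exp_integer_2pi[of "of_int (- n)"] by simp
  finally show ?thesis by (simp add: inner_add_right distrib_left exp_add exp_diff exp_minus)
qed

lemma AE_lborel_translate:
  fixes a :: "'a::euclidean_space"
  assumes "AE x in lborel. P x"
  shows "AE x in lborel. P (x + a)"
proof -
  obtain N where N: "N \<in> null_sets lborel" "{x. \<not> P x} \<subseteq> N"
    using assms by (auto simp: eventually_ae_filter)
  have "AE x in distr lborel borel ((+) a). x \<notin> N"
    unfolding lborel_distr_plus using N(1) by (rule AE_not_in)
  then have "AE x in lborel. a + x \<notin> N"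
    using N(1) by (subst (asm) AE_distr_iff) (auto simp: null_sets_def)
  then show ?thesis
    by eventually_elim (use N(2) in \<open>auto simp: add.commute\<close>)
qed

lemma AE_frequency_shifts:
  assumes "AE \<omega> in lborel. P \<omega>"
  shows "AE \<omega> in lborel. \<forall>\<alpha>\<in>frequency_lattice. P (\<omega> + \<alpha>)"
  using assms by (simp add: AE_ball_countable countable_frequency_lattice AE_lborel_translate)

text \<open>
The coefficients \<open>c\<close> are chosen separately for every \<open>\<omega>\<close> but are common to the whole fiber; this is
what ties the values of the transform near the origin to those on the translates.
\<close>

definition fibers_in_span :: "('n::finite \<Rightarrow> (real ^ 'd) functional) \<Rightarrow> (real ^ 'd) functional \<Rightarrow> bool"
  where "fibers_in_span \<Phi> g \<longleftrightarrow> (AE \<omega> in lborel. \<exists>c. \<forall>\<alpha>\<in>frequency_lattice.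
    fourier_fun g (\<omega> + \<alpha>) = (\<Sum>i\<in>UNIV. c i * fourier_fun (\<Phi> i) (\<omega> + \<alpha>)))"

text \<open>
The closure, in \<open>W\<^sub>2\<^sup>s\<close>, of the functions with fibers in the span. All later estimates tolerate replacing
an element by a sufficiently close function of this kind.
\<close>

definition approximable_space ::
    "real \<Rightarrow> ('n::finite \<Rightarrow> (real ^ 'd) functional) \<Rightarrow> (real ^ 'd) functional set"
  where "approximable_space s \<Phi> = {f \<in> sobolev_space s.
    \<forall>e>0. \<exists>g\<in>sobolev_space s. fibers_in_span \<Phi> g \<and> sobolev_norm s (\<lambda>\<phi>. f \<phi> - g \<phi>) < e}"

lemma fibers_in_spanI:
  assumes "has_fourier_fun g G"
    and "AE \<omega> in lborel. \<exists>c. \<forall>\<alpha>\<in>frequency_lattice. G (\<omega> + \<alpha>) = (\<Sum>i\<in>UNIV. c i * fourier_fun (\<Phi> i) (\<omega> + \<alpha>))"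
  shows "fibers_in_span \<Phi> g"
  unfolding fibers_in_span_def
  using assms(2) AE_frequency_shifts[OF fourier_fun_AE_eq[OF assms(1)]]
  by eventually_elim auto

lemma fibers_in_span_zero: "fibers_in_span \<Phi> (\<lambda>\<phi>. 0)"
  by (rule fibers_in_spanI[OF has_fourier_fun_zero]) (auto intro!: AE_I2 exI[of _ "\<lambda>_. 0"])

lemma fibers_in_span_add:
  assumes "f \<in> sobolev_space s" "g \<in> sobolev_space s" "fibers_in_span \<Phi> f" "fibers_in_span \<Phi> g"
  shows "fibers_in_span \<Phi> (\<lambda>\<phi>. f \<phi> + g \<phi>)"
proof (rule fibers_in_spanI)
  show "has_fourier_fun (\<lambda>\<phi>. f \<phi> + g \<phi>) (\<lambda>\<omega>. fourier_fun f \<omega> + fourier_fun g \<omega>)"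
    using assms by (intro has_fourier_fun_add sobolev_space_fourier_fun)
  show "AE \<omega> in lborel. \<exists>c. \<forall>\<alpha>\<in>frequency_lattice. fourier_fun f (\<omega> + \<alpha>) + fourier_fun g (\<omega> + \<alpha>) =
      (\<Sum>i\<in>UNIV. c i * fourier_fun (\<Phi> i) (\<omega> + \<alpha>))"
    using assms(3,4) unfolding fibers_in_span_def
  proof eventually_elim
    case (elim \<omega>)
    then obtain b c where "\<forall>\<alpha>\<in>frequency_lattice. fourier_fun f (\<omega> + \<alpha>) = (\<Sum>i\<in>UNIV. b i * fourier_fun (\<Phi> i) (\<omega> + \<alpha>))"
      "\<forall>\<alpha>\<in>frequency_lattice. fourier_fun g (\<omega> + \<alpha>) = (\<Sum>i\<in>UNIV. c i * fourier_fun (\<Phi> i) (\<omega> + \<alpha>))" by blast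
    then show ?case
      by (intro exI[of _ "\<lambda>i. b i + c i"]) (simp add: distrib_right sum.distrib)
  qed
qed

lemma fibers_in_span_cmult:
  assumes "f \<in> sobolev_space s" "fibers_in_span \<Phi> f"
  shows "fibers_in_span \<Phi> (\<lambda>\<phi>. a * f \<phi>)"
proof (rule fibers_in_spanI)
  show "has_fourier_fun (\<lambda>\<phi>. a * f \<phi>) (\<lambda>\<omega>. a * fourier_fun f \<omega>)"
    using assms by (intro has_fourier_fun_cmult sobolev_space_fourier_fun)
  show "AE \<omega> in lborel. \<exists>c. \<forall>\<alpha>\<in>frequency_lattice. a * fourier_fun f (\<omega> + \<alpha>) =
      (\<Sum>i\<in>UNIV. c i * fourier_fun (\<Phi> i) (\<omega> + \<alpha>))"
    using assms(2) unfolding fibers_in_span_def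
  proof eventually_elim
    case (elim \<omega>)
    then obtain b where "\<forall>\<alpha>\<in>frequency_lattice. fourier_fun f (\<omega> + \<alpha>) = (\<Sum>i\<in>UNIV. b i * fourier_fun (\<Phi> i) (\<omega> + \<alpha>))"
      by blast
    then show ?case
      by (intro exI[of _ "\<lambda>i. a * b i"]) (simp add: sum_distrib_left mult.assoc)
  qed
qed

text \<open>
The shift by \<open>j\<close> multiplies the Fourier transform by a character that is constant on every fiber.
\<close>

lemma fibers_in_span_translate:
  assumes "f \<in> sobolev_space s" "fibers_in_span \<Phi> f" "j \<in> integer_lattice"
  shows "fibers_in_span \<Phi> (translate j f)"
proof (rule fibers_in_spanI)
  show "has_fourier_fun (translate j f) (\<lambda>\<omega>. character j \<omega> * fourier_fun f \<omega>)"
    using assms by (intro has_fourier_fun_translate sobolev_space_fourier_fun)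
  show "AE \<omega> in lborel. \<exists>c. \<forall>\<alpha>\<in>frequency_lattice. character j (\<omega> + \<alpha>) * fourier_fun f (\<omega> + \<alpha>) =
      (\<Sum>i\<in>UNIV. c i * fourier_fun (\<Phi> i) (\<omega> + \<alpha>))"
    using assms(2) unfolding fibers_in_span_def
  proof eventually_elim
    case (elim \<omega>)
    then obtain b where "\<forall>\<alpha>\<in>frequency_lattice. fourier_fun f (\<omega> + \<alpha>) = (\<Sum>i\<in>UNIV. b i * fourier_fun (\<Phi> i) (\<omega> + \<alpha>))"
      by blast
    then show ?case
      using character_periodic[OF assms(3)]
      by (intro exI[of _ "\<lambda>i. character j \<omega> * b i"]) (auto simp: sum_distrib_left mult.assoc)
  qed
qed

lemma fibers_in_span_generator: "fibers_in_span \<Phi> (\<Phi> i)"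
  unfolding fibers_in_span_def
  by (intro AE_I2 exI[of _ "\<lambda>j. if j = i then 1 else 0"]) (simp add: if_distrib[of "\<lambda>x. x * _"] cong: if_cong)

lemma sobolev_norm_zero: "sobolev_norm s (\<lambda>\<phi>. 0) = 0"
  by (simp add: sobolev_norm_eq[OF has_fourier_fun_zero])

lemma closed_subspace_approximable_space: "closed_subspace s (approximable_space s \<Phi>)"
  unfolding closed_subspace_def
proof (intro conjI ballI allI impI)
  show "approximable_space s \<Phi> \<subseteq> sobolev_space s" by (auto simp: approximable_space_def)
  show "(\<lambda>\<phi>. 0) \<in> approximable_space s \<Phi>"
    unfolding approximable_space_def
    by (auto intro!: sobolev_zero bexI[of _ "\<lambda>\<phi>. 0"] simp: fibers_in_span_zero sobolev_norm_zero)
next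
  fix f g assume "f \<in> approximable_space s \<Phi>" "g \<in> approximable_space s \<Phi>"
  then have f: "f \<in> sobolev_space s" "\<And>e. e > 0 \<Longrightarrow> \<exists>k\<in>sobolev_space s. fibers_in_span \<Phi> k \<and> sobolev_norm s (\<lambda>\<phi>. f \<phi> - k \<phi>) < e"
    and g: "g \<in> sobolev_space s" "\<And>e. e > 0 \<Longrightarrow> \<exists>k\<in>sobolev_space s. fibers_in_span \<Phi> k \<and> sobolev_norm s (\<lambda>\<phi>. g \<phi> - k \<phi>) < e"
    by (auto simp: approximable_space_def)
  show "(\<lambda>\<phi>. f \<phi> + g \<phi>) \<in> approximable_space s \<Phi>"
    unfolding approximable_space_def
  proof (intro CollectI conjI allI impI sobolev_add f g)
    fix e :: real assume "e > 0"
    then have e4: "e / 4 > 0" by simp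
    obtain u where u: "u \<in> sobolev_space s" "fibers_in_span \<Phi> u" "sobolev_norm s (\<lambda>\<phi>. f \<phi> - u \<phi>) < e / 4"
      using f(2)[OF e4] by blast
    obtain v where v: "v \<in> sobolev_space s" "fibers_in_span \<Phi> v" "sobolev_norm s (\<lambda>\<phi>. g \<phi> - v \<phi>) < e / 4"
      using g(2)[OF e4] by blast
    have "2 * (sobolev_norm s (\<lambda>\<phi>. f \<phi> - u \<phi>) + sobolev_norm s (\<lambda>\<phi>. g \<phi> - v \<phi>)) < 2 * (e / 4 + e / 4)"
      using u(3) v(3) by (intro mult_strict_left_mono add_strict_mono) auto
    then have "sobolev_norm s (\<lambda>\<phi>. (f \<phi> - u \<phi>) + (g \<phi> - v \<phi>)) < e"
      using sobolev_norm_add_le[OF sobolev_diff[OF f(1) u(1)] sobolev_diff[OF g(1) v(1)]] by (simp add: le_less_trans)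
    then show "\<exists>k\<in>sobolev_space s. fibers_in_span \<Phi> k \<and> sobolev_norm s (\<lambda>\<phi>. f \<phi> + g \<phi> - k \<phi>) < e"
      using fibers_in_span_add[OF u(1) v(1) u(2) v(2)] sobolev_add[OF u(1) v(1)]
      by (intro bexI[of _ "\<lambda>\<phi>. u \<phi> + v \<phi>"]) (auto simp: algebra_simps)
  qed
next
  fix f c assume "f \<in> approximable_space s \<Phi>"
  then have f: "f \<in> sobolev_space s" "\<And>e. e > 0 \<Longrightarrow> \<exists>k\<in>sobolev_space s. fibers_in_span \<Phi> k \<and> sobolev_norm s (\<lambda>\<phi>. f \<phi> - k \<phi>) < e"
    by (auto simp: approximable_space_def)
  show "(\<lambda>\<phi>. c * f \<phi>) \<in> approximable_space s \<Phi>"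
    unfolding approximable_space_def
  proof (intro CollectI conjI allI impI sobolev_cmult f)
    fix e :: real assume e: "e > 0"
    have n: "norm c + 1 > 0" by (simp add: add_nonneg_pos)
    then have ec: "e / (norm c + 1) > 0" using e by simp
    then obtain u where u: "u \<in> sobolev_space s" "fibers_in_span \<Phi> u" "sobolev_norm s (\<lambda>\<phi>. f \<phi> - u \<phi>) < e / (norm c + 1)"
      using f(2) by blast
    have eq: "(\<lambda>\<phi>. c * f \<phi> - c * u \<phi>) = (\<lambda>\<phi>. c * (f \<phi> - u \<phi>))" by (simp add: right_diff_distrib)
    have "norm c * sobolev_norm s (\<lambda>\<phi>. f \<phi> - u \<phi>) \<le> norm c * (e / (norm c + 1))"
      by (intro mult_left_mono) (use u(3) in auto)
    also have "\<dots> < (norm c + 1) * (e / (norm c + 1))"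
      using ec by (intro mult_strict_right_mono) auto
    also have "\<dots> = e" using n by simp
    finally show "\<exists>k\<in>sobolev_space s. fibers_in_span \<Phi> k \<and> sobolev_norm s (\<lambda>\<phi>. c * f \<phi> - k \<phi>) < e"
      using fibers_in_span_cmult[OF u(1,2)] sobolev_cmult[OF u(1)] sobolev_norm_cmult[OF sobolev_diff[OF f(1) u(1)], of c]
      by (intro bexI[of _ "\<lambda>\<phi>. c * u \<phi>"]) (auto simp: eq)
  qed
next
  fix f assume f: "f \<in> sobolev_space s"
    and lim: "\<forall>e>0. \<exists>g\<in>approximable_space s \<Phi>. sobolev_norm s (\<lambda>\<phi>. f \<phi> - g \<phi>) < e"
  show "f \<in> approximable_space s \<Phi>"
    unfolding approximable_space_def
  proof (intro CollectI conjI allI impI f)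
    fix e :: real assume "e > 0"
    then have e4: "e / 4 > 0" by simp
    obtain g where g: "g \<in> approximable_space s \<Phi>" "sobolev_norm s (\<lambda>\<phi>. f \<phi> - g \<phi>) < e / 4"
      using lim e4 by blast
    then have gs: "g \<in> sobolev_space s" by (simp add: approximable_space_def)
    obtain k where k: "k \<in> sobolev_space s" "fibers_in_span \<Phi> k" "sobolev_norm s (\<lambda>\<phi>. g \<phi> - k \<phi>) < e / 4"
      using g(1) e4 unfolding approximable_space_def by blast
    have "2 * (sobolev_norm s (\<lambda>\<phi>. f \<phi> - g \<phi>) + sobolev_norm s (\<lambda>\<phi>. g \<phi> - k \<phi>)) < 2 * (e / 4 + e / 4)"
      using g(2) k(3) by (intro mult_strict_left_mono add_strict_mono) auto
    then have "sobolev_norm s (\<lambda>\<phi>. f \<phi> - k \<phi>) < e"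
      using sobolev_norm_diff_triangle[OF f gs k(1)] by (simp add: le_less_trans)
    then show "\<exists>k\<in>sobolev_space s. fibers_in_span \<Phi> k \<and> sobolev_norm s (\<lambda>\<phi>. f \<phi> - k \<phi>) < e"
      using k by blast
  qed
qed

lemma shift_invariant_approximable_space:
  fixes \<Phi> :: "'n::finite \<Rightarrow> (real ^ 'b) functional"
  shows "shift_invariant (approximable_space s \<Phi>)"
  unfolding shift_invariant_def
proof (intro ballI)
  fix j :: "real ^ 'b" and f assume j: "j \<in> integer_lattice" and "f \<in> approximable_space s \<Phi>"
  then have f: "f \<in> sobolev_space s" "\<And>e. e > 0 \<Longrightarrow> \<exists>k\<in>sobolev_space s. fibers_in_span \<Phi> k \<and> sobolev_norm s (\<lambda>\<phi>. f \<phi> - k \<phi>) < e"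
    by (auto simp: approximable_space_def)
  show "translate j f \<in> approximable_space s \<Phi>"
    unfolding approximable_space_def
  proof (intro CollectI conjI allI impI sobolev_translate f)
    fix e :: real assume "e > 0"
    then obtain u where u: "u \<in> sobolev_space s" "fibers_in_span \<Phi> u" "sobolev_norm s (\<lambda>\<phi>. f \<phi> - u \<phi>) < e"
      using f(2) by blast
    have "sobolev_norm s (\<lambda>\<phi>. translate j f \<phi> - translate j u \<phi>) < e"
      using sobolev_norm_translate[OF sobolev_diff[OF f(1) u(1)], of j] u(3) by (simp add: translate_def)
    then show "\<exists>k\<in>sobolev_space s. fibers_in_span \<Phi> k \<and> sobolev_norm s (\<lambda>\<phi>. translate j f \<phi> - k \<phi>) < e"
      using fibers_in_span_translate[OF u(1,2) j] sobolev_translate[OF u(1)] by blast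
  qed
qed

lemma si_space_approximable:
  assumes "range \<Phi> \<subseteq> sobolev_space s"
  shows "si_space s (range \<Phi>) \<subseteq> approximable_space s \<Phi>"
proof -
  have "\<Phi> i \<in> approximable_space s \<Phi>" for i
    unfolding approximable_space_def
    using assms fibers_in_span_generator[of \<Phi> i] by (auto intro!: bexI[of _ "\<Phi> i"] simp: sobolev_norm_zero)
  then show ?thesis
    unfolding si_space_def
    using closed_subspace_approximable_space shift_invariant_approximable_space by blast
qed

lemma zero_in_si_space: "(\<lambda>\<phi>. 0) \<in> si_space s G"
  by (auto simp: si_space_def closed_subspace_def)

section \<open>Weighted energies\<close>

text \<open>
The squared norm as an extended nonnegative number. It is attached to functions rather than
distributions, since dilation is easiest to follow on the representing functions.
\<close>

definition energy :: "real \<Rightarrow> ('a::euclidean_space \<Rightarrow> complex) \<Rightarrow> ennreal"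
  where "energy s F = (\<integral>\<^sup>+\<omega>. ennreal ((1 + norm \<omega>) powr (2 * s) * (norm (F \<omega>))\<^sup>2) \<partial>lborel)"

lemma energy_eq_sobolev_norm:
  assumes T: "has_fourier_fun T F" and fin: "energy s F < \<infinity>"
  shows "energy s F = ennreal ((sobolev_norm s T)\<^sup>2)"
proof -
  have [measurable]: "F \<in> borel_measurable borel"
    using T by (auto simp: has_fourier_fun_def locally_L2_borel)
  have i: "integrable lborel (\<lambda>\<omega>. (1 + norm \<omega>) powr (2 * s) * (norm (F \<omega>))\<^sup>2)"
    by (rule integrableI_bounded) (use fin in \<open>auto simp: energy_def\<close>)
  have "(sobolev_norm s T)\<^sup>2 = (LINT \<omega>|lborel. (1 + norm \<omega>) powr (2 * s) * (norm (F \<omega>))\<^sup>2)"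
    unfolding sobolev_norm_eq[OF T] by (intro real_sqrt_pow2 Bochner_Integration.integral_nonneg) simp
  then show ?thesis
    unfolding energy_def by (subst nn_integral_eq_integral[OF i]) auto
qed

lemma energy_cong_AE:
  assumes "AE \<omega> in lborel. F \<omega> = G \<omega>"
  shows "energy s F = energy s G"
  unfolding energy_def by (rule nn_integral_cong_AE) (use assms in \<open>auto elim: eventually_mono\<close>)

lemma sobolev_energy_finite:
  assumes "T \<in> sobolev_space s" "has_fourier_fun T F"
  shows "energy s F < \<infinity>"
proof -
  have "energy s (fourier_fun T) < \<infinity>"
    using sobolev_space_integrable[OF assms(1)] unfolding energy_def by (simp add: integrable_iff_bounded)
  then show ?thesis using energy_cong_AE[OF fourier_fun_AE_eq[OF assms(2)]] by simp
qed

lemma energy_triangle: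
  assumes [measurable]: "F \<in> borel_measurable borel" "G \<in> borel_measurable borel"
  shows "energy s (\<lambda>\<omega>. F \<omega> + G \<omega>) \<le> 2 * energy s F + 2 * energy s G"
proof -
  have "energy s (\<lambda>\<omega>. F \<omega> + G \<omega>) \<le> (\<integral>\<^sup>+\<omega>. 2 * ennreal ((1 + norm \<omega>) powr (2 * s) * (norm (F \<omega>))\<^sup>2)
      + 2 * ennreal ((1 + norm \<omega>) powr (2 * s) * (norm (G \<omega>))\<^sup>2) \<partial>lborel)"
    unfolding energy_def
  proof (rule nn_integral_mono)
    fix \<omega> :: 'a
    have "(1 + norm \<omega>) powr (2 * s) * (norm (F \<omega> + G \<omega>))\<^sup>2 \<le>
        2 * ((1 + norm \<omega>) powr (2 * s) * (norm (F \<omega>))\<^sup>2) + 2 * ((1 + norm \<omega>) powr (2 * s) * (norm (G \<omega>))\<^sup>2)"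
      using mult_left_mono[OF norm_add_square_le[of "F \<omega>" "G \<omega>"], of "(1 + norm \<omega>) powr (2 * s)"] by (simp add: algebra_simps)
    then have "ennreal ((1 + norm \<omega>) powr (2 * s) * (norm (F \<omega> + G \<omega>))\<^sup>2) \<le>
        ennreal (2 * ((1 + norm \<omega>) powr (2 * s) * (norm (F \<omega>))\<^sup>2) + 2 * ((1 + norm \<omega>) powr (2 * s) * (norm (G \<omega>))\<^sup>2))"
      by (rule ennreal_leI)
    then show "ennreal ((1 + norm \<omega>) powr (2 * s) * (norm (F \<omega> + G \<omega>))\<^sup>2) \<le>
        2 * ennreal ((1 + norm \<omega>) powr (2 * s) * (norm (F \<omega>))\<^sup>2) + 2 * ennreal ((1 + norm \<omega>) powr (2 * s) * (norm (G \<omega>))\<^sup>2)"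
      by (subst (asm) ennreal_plus) (auto simp: ennreal_mult simp del: ennreal_plus)
  qed
  also have "\<dots> = 2 * energy s F + 2 * energy s G"
    unfolding energy_def by (simp add: nn_integral_add nn_integral_cmult)
  finally show ?thesis .
qed

lemma dilated_weight_le:
  fixes h x s :: real
  assumes "0 < h" "h \<le> 1" "0 \<le> x"
  shows "(1 + x / h) powr (2 * s) \<le> h powr (- 2 * \<bar>s\<bar>) * (1 + x) powr (2 * s)"
proof (cases "s \<ge> 0")
  case True
  have "1 + x / h \<le> (1 + x) / h" using assms by (simp add: field_simps)
  then have "(1 + x / h) powr (2 * s) \<le> ((1 + x) / h) powr (2 * s)"
    using assms True by (intro powr_mono2) auto
  also have "\<dots> = h powr (- 2 * \<bar>s\<bar>) * (1 + x) powr (2 * s)"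
    using assms True by (subst powr_divide) (auto simp: powr_minus divide_inverse mult.commute)
  finally show ?thesis .
next
  case False
  have "x * h \<le> x" using assms by (simp add: mult_left_le)
  then have "1 + x \<le> 1 + x / h" using assms by (simp add: field_simps)
  then have "(1 + x / h) powr (2 * s) \<le> (1 + x) powr (2 * s)"
    using assms False by (intro powr_mono2') auto
  also have "\<dots> \<le> h powr (- 2 * \<bar>s\<bar>) * (1 + x) powr (2 * s)"
  proof -
    have "h powr 0 \<le> h powr (- 2 * \<bar>s\<bar>)" using assms by (intro powr_mono') auto
    then have "1 \<le> h powr (- 2 * \<bar>s\<bar>)" using assms by simp
    then show ?thesis by (simp add: mult_le_cancel_right1)
  qed
  finally show ?thesis .
qed

lemma energy_change_of_scale:
  fixes G :: "'a::euclidean_space \<Rightarrow> complex"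
  assumes [measurable]: "G \<in> borel_measurable borel" and h: "0 < h"
  shows "(\<integral>\<^sup>+\<eta>. ennreal ((1 + norm \<eta> / h) powr (2 * s) * (norm (G \<eta>))\<^sup>2) \<partial>lborel) =
    ennreal (h ^ DIM('a)) * energy s (\<lambda>\<omega>. G (h *\<^sub>R \<omega>))"
proof -
  let ?u = "\<lambda>\<eta>. ennreal ((1 + norm \<eta> / h) powr (2 * s) * (norm (G \<eta>))\<^sup>2)"
  have "(\<integral>\<^sup>+\<eta>. ?u \<eta> \<partial>lborel) = ennreal (\<bar>h\<bar> ^ DIM('a)) * (\<integral>\<^sup>+\<omega>. ?u (h *\<^sub>R \<omega> + 0) \<partial>lborel)"
    by (rule lborel_nn_integral_affine) (use h in auto)
  then show ?thesis using h by (simp add: energy_def)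
qed

lemma energy_dilate:
  fixes G :: "'a::euclidean_space \<Rightarrow> complex"
  assumes [measurable]: "G \<in> borel_measurable borel" and h: "0 < h" "h \<le> 1"
  shows "energy s (\<lambda>\<omega>. of_real (h ^ DIM('a)) * G (h *\<^sub>R \<omega>)) \<le> ennreal (h ^ DIM('a) * h powr (- 2 * \<bar>s\<bar>)) * energy s G"
proof -
  define d where "d = h ^ DIM('a)"
  have d: "d > 0" using h by (simp add: d_def)
  have "ennreal d * energy s (\<lambda>\<omega>. of_real d * G (h *\<^sub>R \<omega>)) =
      (\<integral>\<^sup>+\<eta>. ennreal ((1 + norm \<eta> / h) powr (2 * s) * (norm (of_real d * G \<eta>))\<^sup>2) \<partial>lborel)"
    unfolding d_def by (subst energy_change_of_scale) (use h in auto)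
  also have "\<dots> \<le> (\<integral>\<^sup>+\<eta>. ennreal (d * (d * h powr (- 2 * \<bar>s\<bar>))) * ennreal ((1 + norm \<eta>) powr (2 * s) * (norm (G \<eta>))\<^sup>2) \<partial>lborel)"
  proof (rule nn_integral_mono)
    fix \<eta> :: 'a
    have "(1 + norm \<eta> / h) powr (2 * s) * (norm (of_real d * G \<eta>))\<^sup>2 \<le>
        (h powr (- 2 * \<bar>s\<bar>) * (1 + norm \<eta>) powr (2 * s)) * (norm (of_real d * G \<eta>))\<^sup>2"
      by (intro mult_right_mono dilated_weight_le h) auto
    also have "\<dots> = (d * (d * h powr (- 2 * \<bar>s\<bar>))) * ((1 + norm \<eta>) powr (2 * s) * (norm (G \<eta>))\<^sup>2)"
      by (simp add: norm_mult power_mult_distrib power2_eq_square)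
    finally show "ennreal ((1 + norm \<eta> / h) powr (2 * s) * (norm (of_real d * G \<eta>))\<^sup>2) \<le>
        ennreal (d * (d * h powr (- 2 * \<bar>s\<bar>))) * ennreal ((1 + norm \<eta>) powr (2 * s) * (norm (G \<eta>))\<^sup>2)"
      using d by (subst ennreal_mult[symmetric]) (auto intro!: ennreal_leI)
  qed
  also have "\<dots> = ennreal d * (ennreal (d * h powr (- 2 * \<bar>s\<bar>)) * energy s G)"
    using d by (simp add: nn_integral_cmult energy_def ennreal_mult mult.assoc)
  finally show ?thesis
    unfolding d_def[symmetric] using d ennreal_mult_le_mult_iff[of "ennreal d"] by simp
qed

section \<open>Smallest eigenvalues and quadratic forms\<close>

lemma quadratic_nonneg_linear_coefficient:
  fixes b c :: real
  assumes "\<And>t. 0 \<le> 2 * t * b + t\<^sup>2 * c"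
  shows "b = 0"
proof (rule ccontr)
  assume b: "b \<noteq> 0"
  define m where "m = \<bar>c\<bar> + 1"
  have m: "m > 0" "c \<le> m" by (auto simp: m_def)
  define t where "t = - b / m"
  have "2 * t * b + t\<^sup>2 * c \<le> 2 * t * b + t\<^sup>2 * m"
    using m by (intro add_left_mono mult_left_mono) auto
  also have "\<dots> = - (b\<^sup>2 / m)"
    using m(1) by (simp add: t_def power2_eq_square field_simps)
  also have "\<dots> < 0"
    using b m by simp
  finally show False using assms[of t] by linarith
qed

text \<open>
Minimize the quadratic form over the unit sphere at \<open>u\<close>, with value \<open>r\<close>, and put \<open>v = L u - r u\<close>. The
nonnegative form \<open>x \<bullet> L x - r |x|\<^sup>2\<close> vanishes at \<open>u\<close>, and along \<open>u + t v\<close> its linear term is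
\<open>2 t |v|\<^sup>2\<close>, so \<open>v = 0\<close>.
\<close>

lemma self_adjoint_minimal_eigenvalue:
  fixes L :: "'a::euclidean_space \<Rightarrow> 'a"
  assumes L: "linear L" and sa: "\<And>x y. x \<bullet> L y = L x \<bullet> y"
  obtains u r where "u \<noteq> 0" "L u = r *\<^sub>R u" "\<And>x. r * (norm x)\<^sup>2 \<le> x \<bullet> L x"
proof -
  have "continuous_on (sphere 0 1) (\<lambda>x. x \<bullet> L x)"
    by (intro continuous_intros linear_continuous_on linear_conv_bounded_linear[THEN iffD1] L)
  moreover have "sphere (0::'a) 1 \<noteq> {}" using vector_choose_size[of 1] by (force simp: dist_norm)
  ultimately obtain u where u: "norm u = 1" and min: "\<And>x. norm x = 1 \<Longrightarrow> u \<bullet> L u \<le> x \<bullet> L x"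
    using continuous_attains_inf[OF compact_sphere, of 0 1 "\<lambda>x. x \<bullet> L x"] by auto
  define r where "r = u \<bullet> L u"
  have low: "r * (norm x)\<^sup>2 \<le> x \<bullet> L x" for x
  proof (cases "x = 0")
    case False
    have "r \<le> (inverse (norm x) *\<^sub>R x) \<bullet> L (inverse (norm x) *\<^sub>R x)"
      unfolding r_def using False by (intro min) simp
    also have "\<dots> = (x \<bullet> L x) / (norm x)\<^sup>2"
      by (simp add: linear_scale[OF L] power2_eq_square divide_inverse)
    finally show ?thesis using False by (simp add: pos_le_divide_eq)
  qed simp
  define v where "v = L u - r *\<^sub>R u"
  have "v \<bullet> v = 0"
  proof (rule quadratic_nonneg_linear_coefficient)
    fix t
    have "0 \<le> (u + t *\<^sub>R v) \<bullet> L (u + t *\<^sub>R v) - r * (norm (u + t *\<^sub>R v))\<^sup>2"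
      using low[of "u + t *\<^sub>R v"] by simp
    also have "\<dots> = 2 * t * (v \<bullet> v) + t\<^sup>2 * (v \<bullet> L v - r * (norm v)\<^sup>2)"
    proof -
      have "L (u + t *\<^sub>R v) = L u + t *\<^sub>R L v" by (simp add: linear_add[OF L] linear_scale[OF L])
      moreover have "u \<bullet> L v = v \<bullet> L u" using sa[of u v] by (simp add: inner_commute)
      moreover have "u \<bullet> u = 1" using u by (simp add: power2_norm_eq_inner[symmetric])
      moreover have "v \<bullet> L u = v \<bullet> v + r * (v \<bullet> u)" by (simp add: v_def inner_diff_right)
      ultimately show ?thesis
        unfolding power2_norm_eq_inner inner_add_left inner_add_right inner_scaleR_left inner_scaleR_right
        by (simp add: r_def[symmetric] inner_commute[of u v] power2_eq_square algebra_simps)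
    qed
    finally show "0 \<le> 2 * t * (v \<bullet> v) + t\<^sup>2 * (v \<bullet> L v - r * (norm v)\<^sup>2)" .
  qed
  then have "L u = r *\<^sub>R u" by (simp add: v_def)
  moreover have "u \<noteq> 0" using u by auto
  ultimately show thesis using that low by blast
qed

lemma matrix_vector_scaleR: "A *v (c *\<^sub>R x) = c *\<^sub>R (A *v x)" for A :: "complex ^ 'n ^ 'm"
  by (simp add: matrix_vector_mult_def vec_eq_iff scaleR_sum_right)

lemma of_real_vector_scale: "complex_of_real r *s x = r *\<^sub>R x"
  by (simp add: vec_eq_iff scaleR_conv_of_real[of r "x $ i" for i])

text \<open>
The inner product of the real Euclidean space underlying \<open>C^n\<close> is the real part of the Hermitian one, so
a Hermitian matrix is self-adjoint in the real sense and the variational description of the smallest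
eigenvalue applies.
\<close>

lemma
  fixes A :: "complex ^ 'n ^ 'n"
  assumes sa: "\<And>x y. x \<bullet> (A *v y) = (A *v x) \<bullet> y"
  shows rho_min_le: "rho_min A * (norm x)\<^sup>2 \<le> x \<bullet> (A *v x)"
    and rho_min_nonneg: "(\<And>x. 0 \<le> x \<bullet> (A *v x)) \<Longrightarrow> 0 \<le> rho_min A"
proof -
  have "linear ((*v) A)"
    by (rule linearI) (simp_all add: matrix_vector_right_distrib matrix_vector_scaleR)
  then obtain u r where u: "u \<noteq> 0" "A *v u = r *\<^sub>R u" "\<And>x. r * (norm x)\<^sup>2 \<le> x \<bullet> (A *v x)"
    by (rule self_adjoint_minimal_eigenvalue[OF _ sa]) blast
  have "rho_min A = r"
    unfolding rho_min_def
  proof (rule Least_equality)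
    show "eigenvalue A (complex_of_real r)"
      unfolding eigenvalue_def using u(1,2) by (auto simp: of_real_vector_scale)
    fix t assume "eigenvalue A (complex_of_real t)"
    then obtain x where x: "x \<noteq> 0" "A *v x = t *\<^sub>R x"
      unfolding eigenvalue_def by (auto simp: of_real_vector_scale)
    then show "r \<le> t"
      using u(3)[of x] by (simp add: power2_norm_eq_inner)
  qed
  then show "rho_min A * (norm x)\<^sup>2 \<le> x \<bullet> (A *v x)" using u(3) by simp
  show "0 \<le> rho_min A" if "\<And>x. 0 \<le> x \<bullet> (A *v x)"
  proof -
    have "0 \<le> r * (norm u)\<^sup>2" using that[of u] u(2) by (simp add: power2_norm_eq_inner)
    then show ?thesis using u(1) \<open>rho_min A = r\<close> by (simp add: zero_le_mult_iff)
  qed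
qed

lemma inner_complex_vec: "x \<bullet> y = Re (\<Sum>i\<in>UNIV. cnj (x $ i) * y $ i)" for x y :: "complex ^ 'n"
  by (simp add: inner_vec_def inner_complex_def)

lemma inner_rank_one:
  "x \<bullet> (rank_one v *v y) = Re (cnj (\<Sum>j\<in>UNIV. cnj (v $ j) * x $ j) * (\<Sum>j\<in>UNIV. cnj (v $ j) * y $ j))"
proof -
  have "rank_one v *v y = (\<chi> i. v $ i * (\<Sum>j\<in>UNIV. cnj (v $ j) * y $ j))"
    by (simp add: rank_one_def matrix_vector_mult_def sum_distrib_left mult.assoc)
  then show ?thesis
    unfolding inner_complex_vec by (simp add: sum_distrib_right mult_ac)
qed

lemma inner_rank_one_self: "x \<bullet> (rank_one v *v x) = (norm (\<Sum>j\<in>UNIV. cnj (v $ j) * x $ j))\<^sup>2"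
  unfolding inner_rank_one by (subst mult.commute) (simp only: complex_norm_square[symmetric] Re_complex_of_real)

lemma inner_rank_one_commute: "x \<bullet> (rank_one v *v y) = (rank_one v *v x) \<bullet> y"
proof -
  have "Re (cnj a * b) = Re (cnj b * a)" for a b :: complex by simp
  then show ?thesis unfolding inner_commute[of "rank_one v *v x" y] inner_rank_one .
qed

lemma linear_inner_matrix: "linear (\<lambda>A :: complex ^ 'n ^ 'n. x \<bullet> (A *v y))"
proof (rule linearI)
  fix A B :: "complex ^ 'n ^ 'n" and c :: real
  show "x \<bullet> ((A + B) *v y) = x \<bullet> (A *v y) + x \<bullet> (B *v y)"
    by (simp add: matrix_vector_mult_add_rdistrib inner_add_right)
  have "(c *\<^sub>R A) *v y = c *\<^sub>R (A *v y)"
    by (simp add: matrix_vector_mult_def vec_eq_iff scaleR_sum_right)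
  then show "x \<bullet> ((c *\<^sub>R A) *v y) = c *\<^sub>R (x \<bullet> (A *v y))" by simp
qed

lemma bounded_linear_inner_matrix: "bounded_linear (\<lambda>A :: complex ^ 'n ^ 'n. x \<bullet> (A *v y))"
  using linear_inner_matrix by (simp add: linear_conv_bounded_linear)

lemma summable_on_iff_nn_integral_count_space:
  fixes g :: "'i \<Rightarrow> real"
  assumes "\<And>i. i \<in> I \<Longrightarrow> 0 \<le> g i"
  shows "g summable_on I \<longleftrightarrow> (\<integral>\<^sup>+i. ennreal (g i) \<partial>count_space I) < \<infinity>"
proof -
  have "g summable_on I \<longleftrightarrow> (\<lambda>i. norm (g i)) summable_on I"
    using assms by (intro summable_on_cong) simp
  also have "\<dots> \<longleftrightarrow> integrable (count_space I) g"
    using abs_summable_equivalent[of g I] by (simp add: abs_summable_on_def)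
  also have "\<dots> \<longleftrightarrow> (\<integral>\<^sup>+i. ennreal (norm (g i)) \<partial>count_space I) < \<infinity>"
    by (simp add: integrable_iff_bounded)
  also have "(\<integral>\<^sup>+i. ennreal (norm (g i)) \<partial>count_space I) = (\<integral>\<^sup>+i. ennreal (g i) \<partial>count_space I)"
    using assms by (intro nn_integral_cong) simp
  finally show ?thesis .
qed

lemma nn_integral_count_space_eq_infsum:
  fixes g :: "'i \<Rightarrow> real"
  assumes "\<And>i. i \<in> I \<Longrightarrow> 0 \<le> g i" "g summable_on I"
  shows "(\<integral>\<^sup>+i. ennreal (g i) \<partial>count_space I) = ennreal (infsum g I)"
proof -
  have "(\<lambda>i. norm (g i)) summable_on I"
    using assms summable_on_cong[of I "\<lambda>i. norm (g i)" g] by simp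
  then have "Infinite_Set_Sum.abs_summable_on g I" using abs_summable_equivalent by blast
  then show ?thesis
    using nn_integral_conv_infsetsum[of g I] assms(1) infsetsum_infsum[of g I] by simp
qed

text \<open>
The quadratic form of a sum of rank one matrices is kept as an extended nonnegative number, because the
series of matrices may diverge. The sum of the matrices is then \<open>0\<close> by convention, and so is its
smallest eigenvalue; every upper bound by a positive constant holds trivially at such points.
\<close>

context
  fixes I :: "'i set" and w :: "'i \<Rightarrow> real" and v :: "'i \<Rightarrow> complex ^ 'n"
  assumes w: "\<And>i. 0 \<le> w i"
begin

definition "form_sum x = (\<integral>\<^sup>+i. ennreal (w i * (norm (\<Sum>j\<in>UNIV. cnj (v i $ j) * x $ j))\<^sup>2) \<partial>count_space I)"

definition "rank_one_sum = infsum (\<lambda>i. w i *\<^sub>R rank_one (v i)) I"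

lemma inner_rank_one_sum_commute: "x \<bullet> (rank_one_sum *v y) = (rank_one_sum *v x) \<bullet> y"
proof (cases "(\<lambda>i. w i *\<^sub>R rank_one (v i)) summable_on I")
  case True
  then have s: "((\<lambda>i. w i *\<^sub>R rank_one (v i)) has_sum rank_one_sum) I"
    unfolding rank_one_sum_def by (rule has_sum_infsum)
  have "((\<lambda>i. x \<bullet> ((w i *\<^sub>R rank_one (v i)) *v y)) has_sum (x \<bullet> (rank_one_sum *v y))) I"
    using has_sum_bounded_linear[OF bounded_linear_inner_matrix[of x y] s] by (simp add: o_def)
  moreover have "((\<lambda>i. y \<bullet> ((w i *\<^sub>R rank_one (v i)) *v x)) has_sum (y \<bullet> (rank_one_sum *v x))) I"
    using has_sum_bounded_linear[OF bounded_linear_inner_matrix[of y x] s] by (simp add: o_def)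
  moreover have "x \<bullet> ((w i *\<^sub>R rank_one (v i)) *v y) = y \<bullet> ((w i *\<^sub>R rank_one (v i)) *v x)" for i
    using inner_rank_one_commute[of x "v i" y] linear_scale[OF linear_inner_matrix[of x y]]
      linear_scale[OF linear_inner_matrix[of y x]] by (simp add: inner_commute)
  ultimately show ?thesis
    using has_sum_unique by (metis (no_types, lifting) has_sum_cong inner_commute)
qed (simp add: rank_one_sum_def infsum_not_exists)

lemma inner_weighted_rank_one:
  "x \<bullet> ((w i *\<^sub>R rank_one (v i)) *v x) = w i * (norm (\<Sum>j\<in>UNIV. cnj (v i $ j) * x $ j))\<^sup>2"
  using linear_scale[OF linear_inner_matrix[of x x], of "w i" "rank_one (v i)"] by (simp add: inner_rank_one_self)

lemma
  assumes "(\<lambda>i. w i *\<^sub>R rank_one (v i)) summable_on I"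
  shows form_sum_finite: "form_sum x < \<infinity>"
    and form_sum_eq: "form_sum x = ennreal (x \<bullet> (rank_one_sum *v x))"
    and inner_rank_one_sum_nonneg: "0 \<le> x \<bullet> (rank_one_sum *v x)"
proof -
  have s: "((\<lambda>i. w i *\<^sub>R rank_one (v i)) has_sum rank_one_sum) I"
    unfolding rank_one_sum_def using assms by (rule has_sum_infsum)
  have h: "((\<lambda>i. w i * (norm (\<Sum>j\<in>UNIV. cnj (v i $ j) * x $ j))\<^sup>2) has_sum (x \<bullet> (rank_one_sum *v x))) I"
    using has_sum_bounded_linear[OF bounded_linear_inner_matrix[of x x] s]
    by (simp add: o_def inner_weighted_rank_one)
  then have sm: "(\<lambda>i. w i * (norm (\<Sum>j\<in>UNIV. cnj (v i $ j) * x $ j))\<^sup>2) summable_on I"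
    and eq: "infsum (\<lambda>i. w i * (norm (\<Sum>j\<in>UNIV. cnj (v i $ j) * x $ j))\<^sup>2) I = x \<bullet> (rank_one_sum *v x)"
    by (auto simp: summable_on_def infsumI)
  show "form_sum x = ennreal (x \<bullet> (rank_one_sum *v x))"
    unfolding form_sum_def using nn_integral_count_space_eq_infsum[OF _ sm] w eq by simp
  then show "form_sum x < \<infinity>" by simp
  show "0 \<le> x \<bullet> (rank_one_sum *v x)"
    unfolding eq[symmetric] by (intro infsum_nonneg) (simp add: w)
qed

lemma norm_rank_one_le: "norm (rank_one (v i)) \<le> real (2 * CARD('n)) * (\<Sum>j\<in>UNIV. (norm (v i $ j))\<^sup>2)"
proof -
  have norm_le_sum: "norm x \<le> (\<Sum>k\<in>UNIV. norm (x $ k))" for x :: "'b::real_normed_vector ^ 'n"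
    unfolding norm_vec_def by (rule L2_set_le_sum) simp
  have "norm (rank_one (v i)) \<le> (\<Sum>k\<in>UNIV. norm (rank_one (v i) $ k))"
    by (rule norm_le_sum)
  also have "\<dots> \<le> (\<Sum>k\<in>UNIV. \<Sum>j\<in>UNIV. norm (rank_one (v i) $ k $ j))"
    by (intro sum_mono norm_le_sum)
  also have "\<dots> \<le> (\<Sum>k\<in>(UNIV::'n set). \<Sum>j\<in>(UNIV::'n set). (norm (v i $ k))\<^sup>2 + (norm (v i $ j))\<^sup>2)"
  proof (intro sum_mono)
    fix k j
    have "0 \<le> (norm (v i $ k) - norm (v i $ j))\<^sup>2 + (norm (v i $ k))\<^sup>2 + (norm (v i $ j))\<^sup>2" by simp
    then show "norm (rank_one (v i) $ k $ j) \<le> (norm (v i $ k))\<^sup>2 + (norm (v i $ j))\<^sup>2"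
      by (simp add: rank_one_def norm_mult power2_eq_square algebra_simps)
  qed
  also have "\<dots> = real (2 * CARD('n)) * (\<Sum>j\<in>UNIV. (norm (v i $ j))\<^sup>2)"
    by (simp add: sum.distrib sum_distrib_left[symmetric] algebra_simps)
  finally show ?thesis .
qed

text \<open>
The entries off the diagonal are dominated by the diagonal ones, \<open>2 |a b| \<le> |a|\<^sup>2 + |b|\<^sup>2\<close>, so convergence
of the form on the standard basis suffices.
\<close>

lemma rank_one_summable:
  assumes "\<And>j. form_sum (axis j 1) < \<infinity>"
  shows "(\<lambda>i. w i *\<^sub>R rank_one (v i)) summable_on I"
proof -
  have f: "form_sum (axis j 1) = (\<integral>\<^sup>+i. ennreal (w i * (norm (v i $ j))\<^sup>2) \<partial>count_space I)" for j
    unfolding form_sum_def by (simp add: axis_def if_distrib[of "\<lambda>x. _ * x"] cong: if_cong)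
  have s: "(\<lambda>i. w i * (norm (v i $ j))\<^sup>2) summable_on I" for j
    using assms[of j] w unfolding f by (subst summable_on_iff_nn_integral_count_space) auto
  have "(\<lambda>i. \<Sum>j\<in>J. w i * (norm (v i $ j))\<^sup>2) summable_on I" if "finite J" for J
    using that by (induction J rule: finite_induct) (auto intro: summable_on_add s)
  from this[OF finite_class.finite_UNIV] have "(\<lambda>i. real (2 * CARD('n)) * (\<Sum>j\<in>UNIV. w i * (norm (v i $ j))\<^sup>2)) summable_on I"
    by (rule summable_on_cmult_right)
  then have "(\<lambda>i. norm (w i *\<^sub>R rank_one (v i))) summable_on I"
  proof (rule summable_on_comparison_test)
    fix i
    show "norm (w i *\<^sub>R rank_one (v i)) \<le> real (2 * CARD('n)) * (\<Sum>j\<in>UNIV. w i * (norm (v i $ j))\<^sup>2)"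
      using mult_left_mono[OF norm_rank_one_le w] w[of i]
      by (simp add: sum_distrib_left[symmetric] mult_ac)
  qed auto
  then show ?thesis by (rule abs_summable_summable)
qed

lemma rho_min_rank_one_sum_nonneg: "0 \<le> rho_min rank_one_sum"
proof (rule rho_min_nonneg[OF inner_rank_one_sum_commute])
  show "0 \<le> x \<bullet> (rank_one_sum *v x)" for x
    using inner_rank_one_sum_nonneg[of x]
    by (cases "(\<lambda>i. w i *\<^sub>R rank_one (v i)) summable_on I") (auto simp: rank_one_sum_def infsum_not_exists)
qed

lemma rho_min_rank_one_sum_less:
  assumes "c > 0" and "(\<exists>j. form_sum (axis j 1) = \<infinity>) \<or> (\<exists>x. form_sum x < ennreal (c * (norm x)\<^sup>2))"
  shows "rho_min rank_one_sum < c"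
proof (cases "(\<lambda>i. w i *\<^sub>R rank_one (v i)) summable_on I")
  case True
  then obtain x where "ennreal (x \<bullet> (rank_one_sum *v x)) < ennreal (c * (norm x)\<^sup>2)"
    using assms(2) form_sum_finite[OF True] form_sum_eq[OF True] by (metis less_irrefl)
  then have "x \<bullet> (rank_one_sum *v x) < c * (norm x)\<^sup>2"
    using inner_rank_one_sum_nonneg[OF True] by (simp add: ennreal_less_iff)
  then have "rho_min rank_one_sum * (norm x)\<^sup>2 < c * (norm x)\<^sup>2"
    using rho_min_le[OF inner_rank_one_sum_commute, of x] by linarith
  then show ?thesis by (simp add: mult_less_cancel_right)
next
  case False
  then have "rank_one_sum = 0" by (simp add: rank_one_sum_def infsum_not_exists)
  define x :: "complex ^ 'n" where "x = axis undefined 1"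
  have "rho_min rank_one_sum * (norm x)\<^sup>2 \<le> 0"
    using rho_min_le[OF inner_rank_one_sum_commute, of x] \<open>rank_one_sum = 0\<close> by simp
  moreover have "norm x > 0" by (simp add: x_def axis_eq_0_iff)
  ultimately show ?thesis using assms(1) by (simp add: mult_le_0_iff)
qed

text \<open>
A finite form is continuous. This allows a countable dense set of vectors in the definition of the set
of frequencies below, which keeps that set Borel.
\<close>

lemma form_sum_lower_bound:
  assumes fin: "\<And>j. form_sum (axis j 1) < \<infinity>" and D: "closure D = UNIV"
    and low: "\<And>x. x \<in> D \<Longrightarrow> ennreal (c * (norm x)\<^sup>2) \<le> form_sum x"
  shows "ennreal (c * (norm x)\<^sup>2) \<le> form_sum x"
proof -
  note S = rank_one_summable[OF fin]
  let ?K = "{x. c * (norm x)\<^sup>2 \<le> x \<bullet> (rank_one_sum *v x)}"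
  have "linear ((*v) rank_one_sum)"
    by (rule linearI) (simp_all add: matrix_vector_right_distrib matrix_vector_scaleR)
  then have "continuous_on UNIV ((*v) rank_one_sum)"
    by (intro linear_continuous_on) (simp add: linear_conv_bounded_linear)
  then have "closed ?K"
    by (intro closed_Collect_le continuous_intros)
  moreover have "D \<subseteq> ?K"
    using low inner_rank_one_sum_nonneg[OF S] by (auto simp: form_sum_eq[OF S] ennreal_le_iff)
  ultimately have "x \<in> ?K" using D closure_minimal[of D ?K] by auto
  then show ?thesis by (simp add: form_sum_eq[OF S] ennreal_leI)
qed

end

section \<open>Folding integrals over the frequency lattice\<close>

lemma nn_integral_count_space_insert:
  assumes "a \<notin> I"
  shows "(\<integral>\<^sup>+i. f i \<partial>count_space (insert a I)) = f a + (\<integral>\<^sup>+i. f i \<partial>count_space I)"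
proof -
  have *: "(\<integral>\<^sup>+i. f i \<partial>count_space J) = (\<integral>\<^sup>+i\<in>J. f i \<partial>count_space UNIV)" for J
    by (simp add: nn_integral_restrict_space[symmetric] restrict_count_space)
  have "(\<integral>\<^sup>+i. f i \<partial>count_space {a}) = f a"
    by (simp add: nn_integral_count_space_finite)
  then show ?thesis
    using nn_integral_disjoint_pair_countspace[of "{a}" I f] assms unfolding * by simp
qed

text \<open>
Distinct points of the lattice are at distance at least \<open>2\<pi>\<close>, so the translates of a subset of the unit
ball are disjoint and the left-hand side is the integral over their union.
\<close>

lemma nn_integral_lattice_translates_le:
  fixes U :: "real ^ 'd \<Rightarrow> ennreal"
  assumes U[measurable]: "U \<in> borel_measurable borel" and E[measurable]: "E \<in> sets borel"
    and ball: "E \<subseteq> cball 0 1" and J: "J \<subseteq> frequency_lattice"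
  shows "(\<integral>\<^sup>+\<eta>\<in>E. (\<integral>\<^sup>+\<alpha>. U (\<eta> + \<alpha>) \<partial>count_space J) \<partial>lborel) \<le> (\<integral>\<^sup>+\<zeta>. U \<zeta> \<partial>lborel)"
proof -
  have cJ: "countable J" using J countable_frequency_lattice countable_subset by blast
  have "(\<integral>\<^sup>+\<eta>\<in>E. (\<integral>\<^sup>+\<alpha>. U (\<eta> + \<alpha>) \<partial>count_space J) \<partial>lborel) =
      (\<integral>\<^sup>+\<eta>. (\<integral>\<^sup>+\<alpha>. U (\<eta> + \<alpha>) * indicator E \<eta> \<partial>count_space J) \<partial>lborel)"
    by (simp add: nn_integral_multc)
  also have "\<dots> = (\<integral>\<^sup>+\<alpha>. (\<integral>\<^sup>+\<eta>. U (\<eta> + \<alpha>) * indicator E \<eta> \<partial>lborel) \<partial>count_space J)"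
    by (rule nn_integral_count_space_nn_integral[OF cJ]) measurable
  also have "\<dots> = (\<integral>\<^sup>+\<alpha>. (\<integral>\<^sup>+\<zeta>. U \<zeta> * indicator E (\<zeta> - \<alpha>) \<partial>lborel) \<partial>count_space J)"
  proof (rule nn_integral_cong)
    fix \<alpha>
    show "(\<integral>\<^sup>+\<eta>. U (\<eta> + \<alpha>) * indicator E \<eta> \<partial>lborel) = (\<integral>\<^sup>+\<zeta>. U \<zeta> * indicator E (\<zeta> - \<alpha>) \<partial>lborel)"
      using lborel_nn_integral_affine[of 1 "\<lambda>\<zeta>. U \<zeta> * indicator E (\<zeta> - \<alpha>)" \<alpha>] by simp
  qed
  also have "\<dots> = (\<integral>\<^sup>+\<zeta>. (\<integral>\<^sup>+\<alpha>. U \<zeta> * indicator E (\<zeta> - \<alpha>) \<partial>count_space J) \<partial>lborel)"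
    by (rule nn_integral_count_space_nn_integral[OF cJ, symmetric]) measurable
  also have "\<dots> \<le> (\<integral>\<^sup>+\<zeta>. U \<zeta> \<partial>lborel)"
  proof (rule nn_integral_mono)
    fix \<zeta> :: "real ^ 'd"
    have one: "(\<integral>\<^sup>+\<alpha>. indicator E (\<zeta> - \<alpha>) \<partial>count_space J) \<le> (1 :: ennreal)"
    proof (cases "\<exists>\<beta>\<in>J. \<zeta> - \<beta> \<in> E")
      case True
      then obtain \<beta> where \<beta>: "\<beta> \<in> J" "\<zeta> - \<beta> \<in> E" by blast
      have "\<alpha> = \<beta>" if "\<alpha> \<in> J" "\<zeta> - \<alpha> \<in> E" for \<alpha>
      proof (rule ccontr)
        assume "\<alpha> \<noteq> \<beta>"
        then have "6 \<le> norm (\<alpha> - \<beta>)"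
          using that(1) \<beta>(1) J by (intro norm_frequency_ge frequency_lattice_diff) auto
        moreover have "norm (\<zeta> - \<beta>) \<le> 1" "norm (\<zeta> - \<alpha>) \<le> 1" using that(2) \<beta>(2) ball by auto
        moreover have "norm (\<alpha> - \<beta>) \<le> norm (\<zeta> - \<beta>) + norm (\<zeta> - \<alpha>)"
          using norm_triangle_ineq4[of "\<zeta> - \<beta>" "\<zeta> - \<alpha>"] by simp
        ultimately show False by linarith
      qed
      then have "(\<integral>\<^sup>+\<alpha>. indicator E (\<zeta> - \<alpha>) \<partial>count_space J) \<le> (\<integral>\<^sup>+\<alpha>. indicator {\<beta>} \<alpha> \<partial>count_space J :: ennreal)"
        by (intro nn_integral_mono) (auto simp: indicator_def)
      also have "\<dots> = 1" using \<beta>(1) by (simp add: nn_integral_indicator)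
      finally show ?thesis .
    next
      case False
      then have "(\<integral>\<^sup>+\<alpha>. indicator E (\<zeta> - \<alpha>) \<partial>count_space J) = (\<integral>\<^sup>+\<alpha>. 0 \<partial>count_space J :: ennreal)"
        by (intro nn_integral_cong) (auto simp: indicator_def)
      then show ?thesis by simp
    qed
    have "(\<integral>\<^sup>+\<alpha>. U \<zeta> * indicator E (\<zeta> - \<alpha>) \<partial>count_space J) = U \<zeta> * (\<integral>\<^sup>+\<alpha>. indicator E (\<zeta> - \<alpha>) \<partial>count_space J)"
      by (rule nn_integral_cmult) simp
    also have "\<dots> \<le> U \<zeta> * 1" by (intro mult_left_mono one) simp
    finally show "(\<integral>\<^sup>+\<alpha>. U \<zeta> * indicator E (\<zeta> - \<alpha>) \<partial>count_space J) \<le> U \<zeta>" by simp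
  qed
  finally show ?thesis .
qed

abbreviation fiber_form ::
    "('n::finite \<Rightarrow> (real ^ 'd) functional) \<Rightarrow> (real ^ 'd) set \<Rightarrow> real \<Rightarrow> real ^ 'd \<Rightarrow> complex ^ 'n \<Rightarrow> ennreal"
  where "fiber_form \<Phi> I s \<eta> \<equiv> form_sum I (\<lambda>\<alpha>. norm (\<eta> + \<alpha>) powr (2 * s)) (\<lambda>\<alpha>. fourier_vec \<Phi> (\<eta> + \<alpha>))"

lemma A_matrix_eq_rank_one_sum:
  "A_matrix \<Phi> I s \<eta> = rank_one_sum I (\<lambda>\<alpha>. norm (\<eta> + \<alpha>) powr (2 * s)) (\<lambda>\<alpha>. fourier_vec \<Phi> (\<eta> + \<alpha>))"
  by (simp add: A_matrix_def rank_one_sum_def)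

lemma fiber_form_measurable:
  fixes \<Phi> :: "'n::finite \<Rightarrow> (real ^ 'd) functional"
  assumes \<Phi>: "\<And>i. fourier_fun (\<Phi> i) \<in> borel_measurable borel" and I: "countable I"
  shows "(\<lambda>\<eta>. fiber_form \<Phi> I s \<eta> x) \<in> borel_measurable borel"
proof -
  have [measurable]: "fourier_fun (\<Phi> i) \<in> borel_measurable borel" for i by (rule \<Phi>)
  define H where "H \<xi> = ennreal (norm \<xi> powr (2 * s) * (norm (\<Sum>j\<in>UNIV. cnj (fourier_vec \<Phi> \<xi> $ j) * x $ j))\<^sup>2)" for \<xi>
  have "(\<lambda>\<xi>. cnj (fourier_fun (\<Phi> j) \<xi>)) \<in> borel_measurable borel" for j
    by (rule borel_measurable_continuous_on[OF _ \<Phi>]) (intro continuous_intros)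
  then have [measurable]: "H \<in> borel_measurable borel"
    unfolding H_def fourier_vec_def by simp
  have "(\<lambda>z. H (fst z + snd z)) \<in> borel_measurable (borel \<Otimes>\<^sub>M count_space I)"
    by (rule measurable_compose_countable'[where f = "\<lambda>\<alpha> z. H (fst z + \<alpha>)" and g = snd, OF _ _ I]) measurable
  then have "(\<lambda>\<eta>. \<integral>\<^sup>+\<alpha>. H (\<eta> + \<alpha>) \<partial>count_space I) \<in> borel_measurable borel"
    by (intro sigma_finite_measure.borel_measurable_nn_integral[OF sigma_finite_measure_count_space_countable[OF I]])
       (simp add: case_prod_beta)
  then show ?thesis by (simp add: form_sum_def H_def)
qed

section \<open>The error allowed by the approximation order\<close>

lemma emeasure_eq_measure_cball:
  fixes E :: "'a::euclidean_space set"
  assumes "E \<subseteq> cball 0 r"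
  shows "emeasure lborel E = ennreal (measure lborel E)"
proof -
  have "emeasure lborel E \<le> emeasure lborel (cball (0 :: 'a) r)"
    by (rule emeasure_mono[OF assms]) simp
  also have "\<dots> < \<infinity>" using emeasure_compact_finite[OF compact_cball] by (simp add: less_top)
  finally show ?thesis by (simp add: emeasure_eq_ennreal_measure)
qed

lemma energy_uminus: "energy s (\<lambda>\<omega>. - F \<omega>) = energy s F"
  by (simp add: energy_def)

text \<open>
The function \<open>f\<close> with Fourier transform \<open>1\<^sub>E (h \<omega>)\<close> has \<open>W\<^sub>2\<^sup>k\<close>-norm comparable to the square root of
\<open>|E| / h^d\<close>, because \<open>E / h\<close> lies in the unit ball. The approximation order supplies a good \<open>g\<close>, which
is replaced by some \<open>u\<close> whose fibers are in the span; \<open>G\<close> represents the Fourier transform of \<open>u\<close>.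
\<close>

lemma error_energy_bound:
  fixes \<Phi> :: "'n::finite \<Rightarrow> (real ^ 'd) functional"
  assumes \<Phi>: "range \<Phi> \<subseteq> sobolev_space s" and h: "0 < h" "h \<le> 1" and C: "0 \<le> C"
    and E[measurable]: "E \<in> sets borel" and ball: "E \<subseteq> cball 0 h" and \<mu>: "measure lborel E > 0"
    and appr: "\<And>f. f \<in> sobolev_space k \<Longrightarrow>
      (INF g\<in>dilate h ` si_space s (range \<Phi>). sobolev_norm s (\<lambda>\<phi>. f \<phi> - g \<phi>)) \<le> C * h powr (k - s) * sobolev_norm k f"
  obtains G where "G \<in> borel_measurable borel"
    "AE \<omega> in lborel. \<exists>c. \<forall>\<alpha>\<in>frequency_lattice. G (\<omega> + \<alpha>) = (\<Sum>i\<in>UNIV. c i * fourier_fun (\<Phi> i) (\<omega> + \<alpha>))"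
    "energy s (\<lambda>\<omega>. indicator E (h *\<^sub>R \<omega>) - of_real (h ^ CARD('d)) * G (h *\<^sub>R \<omega>)) \<le>
      ennreal (4 * ((C + 1)\<^sup>2 * h powr (2 * k - 2 * s) * (2 powr \<bar>2 * k\<bar> * measure lborel E / h ^ CARD('d))))"
proof -
  define d where "d = h ^ CARD('d)"
  have d: "d > 0" "d = h ^ DIM(real ^ 'd)" using h by (simp_all add: d_def)
  define F :: "real ^ 'd \<Rightarrow> complex" where "F \<omega> = indicator E (h *\<^sub>R \<omega>)" for \<omega>
  have F[measurable]: "F \<in> borel_measurable borel" unfolding F_def by measurable
  have supp: "norm \<omega> \<le> 1" if "h *\<^sub>R \<omega> \<in> E" for \<omega>
  proof -
    have "h * norm \<omega> \<le> h * 1" using that ball h by (auto simp: subset_iff)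
    then show ?thesis using h by simp
  qed
  obtain f where f: "\<And>k. f \<in> sobolev_space k" "has_fourier_fun f F"
  proof (rule sobolev_space_with_fourier_fun[OF F, of 1 1])
    show "norm (F \<omega>) \<le> 1" for \<omega> by (auto simp: F_def indicator_def)
    show "F \<omega> = 0" if "norm \<omega> > 1" for \<omega> using supp[of \<omega>] that by (auto simp: F_def indicator_def)
  qed blast
  have emE: "emeasure lborel E = ennreal (measure lborel E)"
    by (rule emeasure_eq_measure_cball[OF ball])
  define N where "N = 2 powr \<bar>2 * k\<bar> * measure lborel E / d"
  have N: "N > 0" using \<mu> d by (simp add: N_def)
  have "(sobolev_norm k f)\<^sup>2 \<le> N"
  proof -
    have "ennreal d * energy k F = (\<integral>\<^sup>+\<eta>. ennreal ((1 + norm \<eta> / h) powr (2 * k) * (norm (indicator E \<eta> :: complex))\<^sup>2) \<partial>lborel)"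
      unfolding F_def d(2) by (rule energy_change_of_scale[symmetric]) (use h in auto)
    also have "\<dots> \<le> (\<integral>\<^sup>+\<eta>. ennreal (2 powr \<bar>2 * k\<bar>) * indicator E \<eta> \<partial>lborel)"
    proof (rule nn_integral_mono)
      fix \<eta> :: "real ^ 'd"
      show "ennreal ((1 + norm \<eta> / h) powr (2 * k) * (norm (indicator E \<eta> :: complex))\<^sup>2) \<le> ennreal (2 powr \<bar>2 * k\<bar>) * indicator E \<eta>"
      proof (cases "\<eta> \<in> E")
        case True
        then have "0 \<le> norm \<eta> / h" "norm \<eta> / h \<le> 1" using ball h by (auto simp: subset_iff)
        from weight_upper_bound[OF this, of "2 * k"] show ?thesis using True by (simp add: ennreal_leI)
      qed simp
    qed
    also have "\<dots> = ennreal (2 powr \<bar>2 * k\<bar> * measure lborel E)"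
      by (simp add: nn_integral_cmult_indicator emE ennreal_mult)
    finally have le: "ennreal d * energy k F \<le> ennreal (2 powr \<bar>2 * k\<bar> * measure lborel E)" .
    have "ennreal d * energy k F = ennreal (d * (sobolev_norm k f)\<^sup>2)"
      using energy_eq_sobolev_norm[OF f(2) sobolev_energy_finite[OF f]] d(1) by (simp add: ennreal_mult)
    with le have "d * (sobolev_norm k f)\<^sup>2 \<le> 2 powr \<bar>2 * k\<bar> * measure lborel E"
      by (simp add: ennreal_le_iff)
    then show ?thesis using d(1) by (simp add: N_def pos_le_divide_eq mult.commute)
  qed
  then have fN: "sobolev_norm k f \<le> sqrt N" by (rule real_le_rsqrt)
  \<comment> \<open>The increment of \<open>C\<close> makes the bound for the infimum strict, so that it is undercut by some \<open>g\<close>.\<close>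
  define b where "b = (C + 1) * h powr (k - s) * sqrt N"
  have b: "b > 0" using C h N by (simp add: b_def)
  have b2: "b\<^sup>2 = (C + 1)\<^sup>2 * h powr (2 * k - 2 * s) * N"
  proof -
    have "(h powr (k - s))\<^sup>2 = h powr (2 * k - 2 * s)"
      by (simp add: power2_eq_square powr_add[symmetric])
    then show ?thesis using N by (simp add: b_def power_mult_distrib)
  qed
  have "(INF g\<in>dilate h ` si_space s (range \<Phi>). sobolev_norm s (\<lambda>\<phi>. f \<phi> - g \<phi>)) \<le> C * h powr (k - s) * sqrt N"
    using order_trans[OF appr[OF f(1)] mult_left_mono[OF fN]] C by simp
  also have "\<dots> < b"
    unfolding b_def using h N by (intro mult_strict_right_mono) auto
  finally obtain g where g: "g \<in> si_space s (range \<Phi>)" "sobolev_norm s (\<lambda>\<phi>. f \<phi> - dilate h g \<phi>) < b"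
    using cInf_lessD[of "(\<lambda>g. sobolev_norm s (\<lambda>\<phi>. f \<phi> - g \<phi>)) ` dilate h ` si_space s (range \<Phi>)" b] zero_in_si_space
    by blast
  have "g \<in> approximable_space s \<Phi>" using g(1) si_space_approximable[OF \<Phi>] by blast
  then have gs: "g \<in> sobolev_space s"
    and "\<And>e. e > 0 \<Longrightarrow> \<exists>u\<in>sobolev_space s. fibers_in_span \<Phi> u \<and> sobolev_norm s (\<lambda>\<phi>. g \<phi> - u \<phi>) < e"
    by (auto simp: approximable_space_def)
  \<comment> \<open>The factor by which dilation can increase the energy; it decides how close \<open>u\<close> must be to \<open>g\<close>.\<close>
  define \<kappa> where "\<kappa> = d * h powr (- 2 * \<bar>s\<bar>)"
  have \<kappa>: "\<kappa> > 0" using d(1) h by (simp add: \<kappa>_def)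
  have "b / sqrt \<kappa> > 0" using b \<kappa> by simp
  then obtain u where u: "u \<in> sobolev_space s" "fibers_in_span \<Phi> u" "sobolev_norm s (\<lambda>\<phi>. g \<phi> - u \<phi>) < b / sqrt \<kappa>"
    using \<open>\<And>e. e > 0 \<Longrightarrow> _\<close> by blast
  let ?dil = "\<lambda>G \<omega>. complex_of_real d * G (h *\<^sub>R \<omega>)"
  let ?g = "fourier_fun g" and ?u = "fourier_fun u"
  have [measurable]: "?g \<in> borel_measurable borel" "?u \<in> borel_measurable borel"
    using gs u(1) by (auto simp: fourier_fun_borel)
  have dil: "energy s (?dil G) \<le> ennreal \<kappa> * energy s G" if "G \<in> borel_measurable borel" for G :: "real ^ 'd \<Rightarrow> complex"
    unfolding \<kappa>_def d(2) by (rule energy_dilate[OF that h])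
  have e1: "energy s (\<lambda>\<omega>. F \<omega> + - ?dil ?g \<omega>) \<le> ennreal (b\<^sup>2)"
  proof -
    have hf: "has_fourier_fun (\<lambda>\<phi>. f \<phi> - dilate h g \<phi>) (\<lambda>\<omega>. F \<omega> + - ?dil ?g \<omega>)"
      using has_fourier_fun_diff[OF f(2) has_fourier_fun_dilate[OF sobolev_space_fourier_fun[OF gs] h(1)]] by (simp add: d(2))
    have "energy s (?dil ?g) < \<infinity>"
      using dil[of ?g] sobolev_energy_finite[OF gs sobolev_space_fourier_fun[OF gs]]
      by (auto simp: ennreal_mult_less_top intro: le_less_trans)
    then have "2 * energy s F + 2 * energy s (\<lambda>\<omega>. - ?dil ?g \<omega>) < \<infinity>"
      using sobolev_energy_finite[OF f] by (simp only: energy_uminus) (simp add: ennreal_mult_less_top ennreal_add_less_top)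
    then have fin: "energy s (\<lambda>\<omega>. F \<omega> + - ?dil ?g \<omega>) < \<infinity>"
      by (rule le_less_trans[rotated]) (rule energy_triangle; measurable)
    have "(sobolev_norm s (\<lambda>\<phi>. f \<phi> - dilate h g \<phi>))\<^sup>2 \<le> b\<^sup>2"
      using g(2) by (intro power_mono) (auto simp: sobolev_norm_def)
    then show ?thesis unfolding energy_eq_sobolev_norm[OF hf fin] by (rule ennreal_leI)
  qed
  have e2: "energy s (?dil (\<lambda>\<omega>. ?g \<omega> - ?u \<omega>)) \<le> ennreal (b\<^sup>2)"
  proof -
    have gu: "(\<lambda>\<phi>. g \<phi> - u \<phi>) \<in> sobolev_space s" by (rule sobolev_diff[OF gs u(1)])
    have hf: "has_fourier_fun (\<lambda>\<phi>. g \<phi> - u \<phi>) (\<lambda>\<omega>. ?g \<omega> - ?u \<omega>)"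
      by (intro has_fourier_fun_diff sobolev_space_fourier_fun[OF gs] sobolev_space_fourier_fun[OF u(1)])
    have "(sobolev_norm s (\<lambda>\<phi>. g \<phi> - u \<phi>))\<^sup>2 \<le> (b / sqrt \<kappa>)\<^sup>2"
      using u(3) by (intro power_mono) (auto simp: sobolev_norm_def)
    also have "\<dots> = b\<^sup>2 / \<kappa>" using \<kappa> by (simp add: power_divide)
    finally have "\<kappa> * (sobolev_norm s (\<lambda>\<phi>. g \<phi> - u \<phi>))\<^sup>2 \<le> b\<^sup>2"
      using \<kappa> by (simp add: field_simps)
    then have "ennreal \<kappa> * energy s (\<lambda>\<omega>. ?g \<omega> - ?u \<omega>) \<le> ennreal (b\<^sup>2)"
      unfolding energy_eq_sobolev_norm[OF hf sobolev_energy_finite[OF gu hf]]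
      using \<kappa> by (simp add: ennreal_mult[symmetric] ennreal_leI)
    then show ?thesis using dil[of "\<lambda>\<omega>. ?g \<omega> - ?u \<omega>"] by (auto intro: order_trans)
  qed
  show thesis
  proof (rule that)
    show "?u \<in> borel_measurable borel" by measurable
    show "AE \<omega> in lborel. \<exists>c. \<forall>\<alpha>\<in>frequency_lattice. ?u (\<omega> + \<alpha>) = (\<Sum>i\<in>UNIV. c i * fourier_fun (\<Phi> i) (\<omega> + \<alpha>))"
      using u(2) by (simp add: fibers_in_span_def)
    have "(\<lambda>\<omega>. indicator E (h *\<^sub>R \<omega>) - of_real d * ?u (h *\<^sub>R \<omega>)) =
        (\<lambda>\<omega>. (F \<omega> + - ?dil ?g \<omega>) + ?dil (\<lambda>\<omega>. ?g \<omega> - ?u \<omega>) \<omega>)"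
      by (simp add: F_def fun_eq_iff right_diff_distrib)
    then have "energy s (\<lambda>\<omega>. indicator E (h *\<^sub>R \<omega>) - of_real d * ?u (h *\<^sub>R \<omega>)) \<le>
        2 * energy s (\<lambda>\<omega>. F \<omega> + - ?dil ?g \<omega>) + 2 * energy s (?dil (\<lambda>\<omega>. ?g \<omega> - ?u \<omega>))"
      by (simp only:) (rule energy_triangle; measurable)
    also have "\<dots> \<le> 2 * ennreal (b\<^sup>2) + 2 * ennreal (b\<^sup>2)"
      by (intro add_mono mult_left_mono e1 e2) auto
    also have "\<dots> = ennreal (4 * b\<^sup>2)"
    proof -
      have "2 * ennreal (b\<^sup>2) = ennreal (2 * b\<^sup>2)" by (simp add: ennreal_mult)
      then show ?thesis by (simp add: ennreal_plus[symmetric] del: ennreal_plus)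
    qed
    finally show "energy s (\<lambda>\<omega>. indicator E (h *\<^sub>R \<omega>) - of_real (h ^ CARD('d)) * ?u (h *\<^sub>R \<omega>)) \<le>
      ennreal (4 * ((C + 1)\<^sup>2 * h powr (2 * k - 2 * s) * (2 powr \<bar>2 * k\<bar> * measure lborel E / h ^ CARD('d))))"
      unfolding b2 N_def d_def .
  qed
qed

section \<open>The error forced by aliasing\<close>

lemma weight_lower_bound:
  fixes x t :: real
  assumes "0 < x" "x \<le> y" "y \<le> 2 * x"
  shows "2 powr (- \<bar>t\<bar>) * x powr t \<le> y powr t"
proof (cases "t \<ge> 0")
  case True
  have "2 powr (- \<bar>t\<bar>) * x powr t \<le> 1 * x powr t"
    using True by (intro mult_right_mono) (simp_all add: powr_minus inverse_le_1_iff ge_one_powr_ge_zero)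
  also have "\<dots> \<le> y powr t" using assms True by (simp add: powr_mono2)
  finally show ?thesis .
next
  case False
  have "2 powr (- \<bar>t\<bar>) * x powr t = (2 * x) powr t"
    using assms False by (simp add: powr_mult)
  also have "\<dots> \<le> y powr t" using assms False by (intro powr_mono2') auto
  finally show ?thesis .
qed

text \<open>
Either \<open>y\<close> misses \<open>1\<close>, or it is large enough for the penalty \<open>t |y|\<^sup>2\<close> to count.
\<close>

lemma squared_distance_trade_off:
  fixes y :: complex
  assumes "0 \<le> t" "t \<le> 1"
  shows "t / 2 \<le> (norm (1 - y))\<^sup>2 + t * (norm y)\<^sup>2"
proof -
  have "1 \<le> 2 * ((norm (1 - y))\<^sup>2 + (norm y)\<^sup>2)"
    using norm_add_square_le[of "1 - y" y] by simp
  from mult_left_mono[OF this assms(1)]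
  have "t / 2 \<le> t * (norm (1 - y))\<^sup>2 + t * (norm y)\<^sup>2" by (simp add: algebra_simps)
  also have "t * (norm (1 - y))\<^sup>2 \<le> 1 * (norm (1 - y))\<^sup>2"
    using assms by (intro mult_right_mono) auto
  finally show ?thesis by simp
qed

lemma norm_sum_mult_le:
  fixes x v :: "complex ^ 'n"
  shows "norm (\<Sum>j\<in>UNIV. x $ j * v $ j) \<le> norm x * norm v"
proof -
  have "norm (\<Sum>j\<in>UNIV. x $ j * v $ j) \<le> (\<Sum>j\<in>UNIV. \<bar>norm (x $ j)\<bar> * \<bar>norm (v $ j)\<bar>)"
    by (rule order_trans[OF norm_sum]) (simp add: norm_mult)
  also have "\<dots> \<le> norm x * norm v"
    unfolding norm_vec_def by (rule L2_set_mult_ineq)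
  finally show ?thesis .
qed

text \<open>
In the variable \<open>\<eta> = h\<omega>\<close>, fold the energy over the origin and the translates in \<open>I\<close>. At \<open>\<eta>\<close> in \<open>E\<close>
the origin contributes \<open>|1 - y|\<^sup>2\<close> with \<open>y = h^d G \<eta>\<close>. On the translates the target vanishes, and what
remains is the form at the coefficient vector \<open>x\<close> of the fiber of \<open>G\<close>, at least \<open>c |x|\<^sup>2\<close>. As
\<open>|y| \<le> h^d M |x|\<close>, both terms compete as in the trade-off above, with \<open>t = c h^(-2s) / M\<^sup>2\<close>.
\<close>

lemma error_energy_lower_bound:
  fixes \<Phi> :: "'n::finite \<Rightarrow> (real ^ 'd) functional"
  assumes I: "I \<subseteq> frequency_lattice - {0}" and h: "0 < h" "h \<le> 1"
    and G[measurable]: "G \<in> borel_measurable borel"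
    and span: "AE \<omega> in lborel. \<exists>b. \<forall>\<alpha>\<in>frequency_lattice. G (\<omega> + \<alpha>) = (\<Sum>i\<in>UNIV. b i * fourier_fun (\<Phi> i) (\<omega> + \<alpha>))"
    and E[measurable]: "E \<in> sets borel" and ball: "E \<subseteq> cball 0 h"
    and M: "M > 0" "AE \<omega> in lborel. norm \<omega> \<le> h \<longrightarrow> norm (fourier_vec \<Phi> \<omega>) \<le> M"
    and c: "c \<ge> 0" and low: "\<And>\<eta> x. \<eta> \<in> E \<Longrightarrow> ennreal (c * (norm x)\<^sup>2) \<le> fiber_form \<Phi> I s \<eta> x"
    and small: "c * h powr (- 2 * s) / M\<^sup>2 \<le> 1"
  shows "ennreal (2 powr (- \<bar>2 * s\<bar>) * (c * h powr (- 2 * s) / M\<^sup>2 / 2)) * emeasure lborel E \<le>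
    ennreal (h ^ CARD('d)) * energy s (\<lambda>\<omega>. indicator E (h *\<^sub>R \<omega>) - of_real (h ^ CARD('d)) * G (h *\<^sub>R \<omega>))"
proof -
  define d where "d = h ^ CARD('d)"
  have d: "d > 0" "d = h ^ DIM(real ^ 'd)" using h by (simp_all add: d_def)
  define \<kappa> where "\<kappa> = 2 powr (- \<bar>2 * s\<bar>)"
  have \<kappa>: "\<kappa> > 0" by (simp add: \<kappa>_def)
  define \<theta> where "\<theta> = c * h powr (- 2 * s) / M\<^sup>2"
  have \<theta>: "0 \<le> \<theta>" "\<theta> \<le> 1" using c small by (auto simp: \<theta>_def)
  define D :: "real ^ 'd \<Rightarrow> complex" where "D \<eta> = indicator E \<eta> - of_real d * G \<eta>" for \<eta>
  have [measurable]: "D \<in> borel_measurable borel" unfolding D_def by measurable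
  define U where "U \<eta> = ennreal ((1 + norm \<eta> / h) powr (2 * s) * (norm (D \<eta>))\<^sup>2)" for \<eta>
  have [measurable]: "U \<in> borel_measurable borel" unfolding U_def by measurable
  have zI: "0 \<notin> I" using I by auto
  have ball1: "E \<subseteq> cball 0 1" using ball h by (auto simp: subset_iff)
  have point: "ennreal (\<kappa> * (\<theta> / 2)) \<le> (\<integral>\<^sup>+\<alpha>. U (\<eta> + \<alpha>) \<partial>count_space (insert 0 I))"
    if \<eta>: "\<eta> \<in> E" and vM: "norm (fourier_vec \<Phi> \<eta>) \<le> M"
      and b: "\<And>\<alpha>. \<alpha> \<in> frequency_lattice \<Longrightarrow> G (\<eta> + \<alpha>) = (\<Sum>i\<in>UNIV. b i * fourier_fun (\<Phi> i) (\<eta> + \<alpha>))" for \<eta> b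
  proof -
    have n\<eta>: "norm \<eta> \<le> h" using \<eta> ball by auto
    define x :: "complex ^ 'n" where "x = (\<chi> i. cnj (b i))"
    define S where "S \<alpha> = (\<Sum>j\<in>UNIV. cnj (fourier_vec \<Phi> (\<eta> + \<alpha>) $ j) * x $ j)" for \<alpha>
    have S: "norm (S \<alpha>) = norm (G (\<eta> + \<alpha>))" if "\<alpha> \<in> frequency_lattice" for \<alpha>
    proof -
      have "S \<alpha> = cnj (G (\<eta> + \<alpha>))"
        by (simp add: S_def b[OF that] x_def fourier_vec_def mult.commute)
      then show ?thesis by simp
    qed
    define y where "y = of_real d * G \<eta>"
    have y: "(norm y)\<^sup>2 \<le> d\<^sup>2 * (norm x)\<^sup>2 * M\<^sup>2"
    proof -
      have "G \<eta> = (\<Sum>j\<in>UNIV. (\<chi> i. b i) $ j * fourier_vec \<Phi> \<eta> $ j)"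
        using b[OF zero_frequency] by (simp add: fourier_vec_def)
      then have "norm (G \<eta>) \<le> norm (\<chi> i. b i) * norm (fourier_vec \<Phi> \<eta>)"
        using norm_sum_mult_le by metis
      also have "norm (\<chi> i. b i) = norm x" by (simp add: norm_vec_def x_def)
      also have "norm x * norm (fourier_vec \<Phi> \<eta>) \<le> norm x * M" by (intro mult_left_mono vM) simp
      finally have "norm y \<le> d * (norm x * M)" using d(1) by (simp add: y_def norm_mult)
      from power_mono[OF this, of 2] show ?thesis by (simp add: power_mult_distrib mult_ac)
    qed
    \<comment> \<open>The dilated weight \<open>1 + |\<eta>| / h\<close> lies between \<open>1\<close> and \<open>2\<close>.\<close>
    have U0: "ennreal (\<kappa> * (norm (1 - y))\<^sup>2) \<le> U \<eta>"
    proof -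
      have "\<kappa> * 1 powr (2 * s) \<le> (1 + norm \<eta> / h) powr (2 * s)"
        unfolding \<kappa>_def using n\<eta> h by (intro weight_lower_bound) auto
      then have "\<kappa> * (norm (1 - y))\<^sup>2 \<le> (1 + norm \<eta> / h) powr (2 * s) * (norm (1 - y))\<^sup>2"
        by (intro mult_right_mono) auto
      then show ?thesis using \<eta> by (simp add: U_def D_def y_def ennreal_leI)
    qed
    \<comment> \<open>Here \<open>|\<eta> + \<alpha>| > 1 \<ge> h\<close>, so the dilated weight is comparable to \<open>|\<eta> + \<alpha>| / h\<close>.\<close>
    have UI: "ennreal (\<kappa> * h powr (- 2 * s) * d\<^sup>2) * ennreal (norm (\<eta> + \<alpha>) powr (2 * s) * (norm (S \<alpha>))\<^sup>2) \<le> U (\<eta> + \<alpha>)"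
      if "\<alpha> \<in> I" for \<alpha>
    proof -
      have \<alpha>: "\<alpha> \<in> frequency_lattice" "\<alpha> \<noteq> 0" using that I by auto
      have far: "norm (\<eta> + \<alpha>) > 1"
        using norm_frequency_ge[OF \<alpha>] norm_diff_ineq[of \<alpha> \<eta>] n\<eta> h by (simp add: add.commute)
      then have "\<eta> + \<alpha> \<notin> E" using ball1 by auto
      then have D: "(norm (D (\<eta> + \<alpha>)))\<^sup>2 = d\<^sup>2 * (norm (S \<alpha>))\<^sup>2"
        using d(1) by (simp add: D_def S[OF \<alpha>(1)] norm_mult power_mult_distrib)
      have "\<kappa> * (norm (\<eta> + \<alpha>) / h) powr (2 * s) \<le> (1 + norm (\<eta> + \<alpha>) / h) powr (2 * s)"
        unfolding \<kappa>_def using far h by (intro weight_lower_bound) (auto simp: field_simps)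
      moreover have "(norm (\<eta> + \<alpha>) / h) powr (2 * s) = norm (\<eta> + \<alpha>) powr (2 * s) * h powr (- 2 * s)"
        using h by (subst powr_divide) (auto simp: powr_minus divide_inverse)
      ultimately have "\<kappa> * (norm (\<eta> + \<alpha>) powr (2 * s) * h powr (- 2 * s)) * (d\<^sup>2 * (norm (S \<alpha>))\<^sup>2) \<le>
          (1 + norm (\<eta> + \<alpha>) / h) powr (2 * s) * (d\<^sup>2 * (norm (S \<alpha>))\<^sup>2)"
        by (intro mult_right_mono) auto
      then have "(\<kappa> * h powr (- 2 * s) * d\<^sup>2) * (norm (\<eta> + \<alpha>) powr (2 * s) * (norm (S \<alpha>))\<^sup>2) \<le>
          (1 + norm (\<eta> + \<alpha>) / h) powr (2 * s) * (norm (D (\<eta> + \<alpha>)))\<^sup>2"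
        unfolding D by (simp add: mult_ac)
      then show ?thesis
        unfolding U_def using \<kappa> by (subst ennreal_mult[symmetric]) (auto intro!: ennreal_leI)
    qed
    have "\<kappa> * (\<theta> / 2) \<le> \<kappa> * ((norm (1 - y))\<^sup>2 + \<theta> * (norm y)\<^sup>2)"
      using \<kappa> squared_distance_trade_off[OF \<theta>] by (intro mult_left_mono) auto
    also have "\<dots> \<le> \<kappa> * (norm (1 - y))\<^sup>2 + (\<kappa> * h powr (- 2 * s) * d\<^sup>2) * (c * (norm x)\<^sup>2)"
    proof -
      have "\<theta> * (norm y)\<^sup>2 \<le> \<theta> * (d\<^sup>2 * (norm x)\<^sup>2 * M\<^sup>2)" by (intro mult_left_mono y \<theta>)
      also have "\<dots> = h powr (- 2 * s) * d\<^sup>2 * (c * (norm x)\<^sup>2)" using M(1) by (simp add: \<theta>_def)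
      finally have "\<kappa> * (\<theta> * (norm y)\<^sup>2) \<le> \<kappa> * (h powr (- 2 * s) * d\<^sup>2 * (c * (norm x)\<^sup>2))"
        using \<kappa> by (intro mult_left_mono) auto
      then show ?thesis by (simp add: distrib_left mult.assoc)
    qed
    finally have "ennreal (\<kappa> * (\<theta> / 2)) \<le> ennreal (\<kappa> * (norm (1 - y))\<^sup>2) +
        ennreal (\<kappa> * h powr (- 2 * s) * d\<^sup>2) * ennreal (c * (norm x)\<^sup>2)"
      using \<kappa> c by (subst ennreal_mult[symmetric] ennreal_plus[symmetric]; auto intro!: ennreal_leI simp: ennreal_mult[symmetric] ennreal_plus[symmetric] simp del: ennreal_plus)
    also have "\<dots> \<le> U \<eta> + ennreal (\<kappa> * h powr (- 2 * s) * d\<^sup>2) * fiber_form \<Phi> I s \<eta> x"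
      by (intro add_mono mult_left_mono U0 low \<eta>) auto
    also have "ennreal (\<kappa> * h powr (- 2 * s) * d\<^sup>2) * fiber_form \<Phi> I s \<eta> x =
        (\<integral>\<^sup>+\<alpha>. ennreal (\<kappa> * h powr (- 2 * s) * d\<^sup>2) * ennreal (norm (\<eta> + \<alpha>) powr (2 * s) * (norm (S \<alpha>))\<^sup>2) \<partial>count_space I)"
      by (subst nn_integral_cmult) (auto simp: form_sum_def S_def)
    also have "U \<eta> + \<dots> \<le> U \<eta> + (\<integral>\<^sup>+\<alpha>. U (\<eta> + \<alpha>) \<partial>count_space I)"
      by (intro add_left_mono nn_integral_mono) (use UI in auto)
    also have "\<dots> = (\<integral>\<^sup>+\<alpha>. U (\<eta> + \<alpha>) \<partial>count_space (insert 0 I))"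
      using nn_integral_count_space_insert[OF zI, of "\<lambda>\<alpha>. U (\<eta> + \<alpha>)"] by simp
    finally show ?thesis .
  qed
  have "ennreal (\<kappa> * (\<theta> / 2)) * emeasure lborel E = (\<integral>\<^sup>+\<eta>\<in>E. ennreal (\<kappa> * (\<theta> / 2)) \<partial>lborel)"
    by (subst nn_integral_cmult_indicator) auto
  also have "\<dots> \<le> (\<integral>\<^sup>+\<eta>\<in>E. (\<integral>\<^sup>+\<alpha>. U (\<eta> + \<alpha>) \<partial>count_space (insert 0 I)) \<partial>lborel)"
  proof (rule nn_integral_mono_AE)
    show "AE \<eta> in lborel. ennreal (\<kappa> * (\<theta> / 2)) * indicator E \<eta> \<le>
        (\<integral>\<^sup>+\<alpha>. U (\<eta> + \<alpha>) \<partial>count_space (insert 0 I)) * indicator E \<eta>"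
      using M(2) span
    proof eventually_elim
      case (elim \<eta>)
      then obtain b where b: "\<And>\<alpha>. \<alpha> \<in> frequency_lattice \<Longrightarrow> G (\<eta> + \<alpha>) = (\<Sum>i\<in>UNIV. b i * fourier_fun (\<Phi> i) (\<eta> + \<alpha>))"
        by blast
      show ?case
      proof (cases "\<eta> \<in> E")
        case True
        then have "norm \<eta> \<le> h" using ball by auto
        then show ?thesis using point[OF True _ b] elim(1) True by simp
      qed simp
    qed
  qed
  also have "\<dots> \<le> (\<integral>\<^sup>+\<zeta>. U \<zeta> \<partial>lborel)"
    by (rule nn_integral_lattice_translates_le[OF _ E ball1]) (use I zero_frequency in auto)
  also have "\<dots> = ennreal d * energy s (\<lambda>\<omega>. D (h *\<^sub>R \<omega>))"
    unfolding U_def d(2) by (rule energy_change_of_scale) (use h in auto)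
  finally show ?thesis
    unfolding \<kappa>_def \<theta>_def D_def d_def .
qed

section \<open>The order of the zero\<close>

lemma countable_dense_set:
  obtains D :: "'a::second_countable_topology set" where "countable D" "closure D = UNIV"
proof -
  obtain D :: "'a set" where D: "countable D" "\<And>X. open X \<Longrightarrow> X \<noteq> {} \<Longrightarrow> \<exists>d\<in>D. d \<in> X"
    using countable_dense_exists by metis
  have "closure D = UNIV"
  proof (rule ccontr)
    assume "closure D \<noteq> UNIV"
    then obtain x where "x \<in> D" "x \<in> - closure D" using D(2)[of "- closure D"] by auto
    then show False using closure_subset by auto
  qed
  with D(1) show thesis using that by blast
qed

text \<open>
On the set \<open>E\<close> where the form dominates \<open>c |x|\<^sup>2\<close> the forced error exceeds the allowed one
by a factor \<open>2\<close>, both being proportional to the measure of \<open>E\<close>; so \<open>E\<close> is a null set. The constant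
\<open>K\<close> is chosen to produce this factor, and its smallness condition puts the trade-off in the range where
the penalty is at most \<open>1\<close>.
\<close>

lemma rho_min_bound_at_scale:
  fixes \<Phi> :: "'n::finite \<Rightarrow> (real ^ 'd) functional"
  assumes \<Phi>: "range \<Phi> \<subseteq> sobolev_space s" and I: "I \<subseteq> frequency_lattice - {0}"
    and h: "0 < h" "h \<le> 1" and C: "0 \<le> C"
    and M: "M > 0" "AE \<omega> in lborel. norm \<omega> \<le> h \<longrightarrow> norm (fourier_vec \<Phi> \<omega>) \<le> M"
    and appr: "\<And>f. f \<in> sobolev_space k \<Longrightarrow>
      (INF g\<in>dilate h ` si_space s (range \<Phi>). sobolev_norm s (\<lambda>\<phi>. f \<phi> - g \<phi>)) \<le> C * h powr (k - s) * sobolev_norm k f"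
    and K: "K = 16 * (C + 1)\<^sup>2 * 2 powr \<bar>2 * k\<bar> * 2 powr \<bar>2 * s\<bar>"
    and small: "K * h powr (2 * k - 2 * s) \<le> 1"
  shows "AE \<eta> in lborel. norm \<eta> \<le> h \<longrightarrow> rho_min (A_matrix \<Phi> I s \<eta>) < K * M\<^sup>2 * h powr (2 * k)"
proof -
  define c where "c = K * M\<^sup>2 * h powr (2 * k)"
  have K0: "K > 0" unfolding K using C by simp
  have c: "c > 0" using K0 M(1) h by (simp add: c_def)
  have \<theta>: "c * h powr (- 2 * s) / M\<^sup>2 = K * h powr (2 * k - 2 * s)"
    using M(1) by (simp add: c_def powr_add[symmetric] mult.assoc)
  obtain D :: "(complex ^ 'n) set" where D: "countable D" "closure D = UNIV"
    by (rule countable_dense_set)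
  have cI: "countable I" using I countable_frequency_lattice countable_subset by blast
  have [measurable]: "(\<lambda>\<eta>. fiber_form \<Phi> I s \<eta> x) \<in> borel_measurable borel" for x
    using \<Phi> by (intro fiber_form_measurable cI) (auto intro: fourier_fun_borel)
  define E where "E = {\<eta> \<in> space borel. norm \<eta> \<le> h \<and> (\<forall>j\<in>(UNIV::'n set). fiber_form \<Phi> I s \<eta> (axis j 1) < \<infinity>) \<and>
    (\<forall>x\<in>D. ennreal (c * (norm x)\<^sup>2) \<le> fiber_form \<Phi> I s \<eta> x)}"
  have E: "E \<in> sets borel"
  proof -
    have 1: "{\<eta> \<in> space borel. norm \<eta> \<le> h} \<in> sets (borel :: (real ^ 'd) measure)" by measurable
    have 2: "{\<eta> \<in> space borel. fiber_form \<Phi> I s \<eta> (axis j 1) < \<infinity>} \<in> sets borel" for j by measurable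
    have 3: "{\<eta> \<in> space borel. ennreal (c * (norm x)\<^sup>2) \<le> fiber_form \<Phi> I s \<eta> x} \<in> sets borel" for x by measurable
    show ?thesis
      unfolding E_def
      by (intro sets.sets_Collect_conj sets.sets_Collect_finite_All sets.sets_Collect_countable_All'
          1 2 3 D(1)) simp
  qed
  have ball: "E \<subseteq> cball 0 h" by (auto simp: E_def)
  have low: "ennreal (c * (norm x)\<^sup>2) \<le> fiber_form \<Phi> I s \<eta> x" if "\<eta> \<in> E" for \<eta> x
    by (rule form_sum_lower_bound[OF _ _ D(2)]) (use that in \<open>auto simp: E_def\<close>)
  have emE: "emeasure lborel E = ennreal (measure lborel E)"
    by (rule emeasure_eq_measure_cball[OF ball])
  have "measure lborel E = 0"
  proof (rule ccontr)
    assume "measure lborel E \<noteq> 0"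
    then have \<mu>: "measure lborel E > 0" using measure_nonneg[of lborel E] by linarith
    obtain G where G: "G \<in> borel_measurable borel"
      "AE \<omega> in lborel. \<exists>c. \<forall>\<alpha>\<in>frequency_lattice. G (\<omega> + \<alpha>) = (\<Sum>i\<in>UNIV. c i * fourier_fun (\<Phi> i) (\<omega> + \<alpha>))"
      and upper: "energy s (\<lambda>\<omega>. indicator E (h *\<^sub>R \<omega>) - of_real (h ^ CARD('d)) * G (h *\<^sub>R \<omega>)) \<le>
        ennreal (4 * ((C + 1)\<^sup>2 * h powr (2 * k - 2 * s) * (2 powr \<bar>2 * k\<bar> * measure lborel E / h ^ CARD('d))))"
      using error_energy_bound[OF \<Phi> h C E ball \<mu> appr] by blast
    define X where "X = (C + 1)\<^sup>2 * h powr (2 * k - 2 * s) * 2 powr \<bar>2 * k\<bar> * measure lborel E"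
    have X: "X > 0" using C h \<mu> by (simp add: X_def)
    have dh: "h ^ CARD('d) > 0" using h by simp
    have "ennreal (2 powr (- \<bar>2 * s\<bar>) * (K * h powr (2 * k - 2 * s) / 2)) * ennreal (measure lborel E) \<le>
        ennreal (h ^ CARD('d)) * energy s (\<lambda>\<omega>. indicator E (h *\<^sub>R \<omega>) - of_real (h ^ CARD('d)) * G (h *\<^sub>R \<omega>))"
      using error_energy_lower_bound[OF I h G E ball M _ low] c small unfolding emE \<theta> by simp
    also have "\<dots> \<le> ennreal (h ^ CARD('d)) *
        ennreal (4 * ((C + 1)\<^sup>2 * h powr (2 * k - 2 * s) * (2 powr \<bar>2 * k\<bar> * measure lborel E / h ^ CARD('d))))"
      by (intro mult_left_mono upper) simp
    also have "\<dots> = ennreal (4 * X)"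
      using dh by (subst ennreal_mult'[symmetric]) (auto simp: X_def field_simps)
    also have "ennreal (2 powr (- \<bar>2 * s\<bar>) * (K * h powr (2 * k - 2 * s) / 2)) * ennreal (measure lborel E) = ennreal (8 * X)"
    proof -
      have "2 powr (- \<bar>2 * s\<bar>) * 2 powr \<bar>2 * s\<bar> = (1::real)" by (simp add: powr_add[symmetric])
      then have "2 powr (- \<bar>2 * s\<bar>) * (K * h powr (2 * k - 2 * s) / 2) * measure lborel E = 8 * X"
        unfolding K X_def by algebra
      then show ?thesis by (simp add: ennreal_mult''[symmetric])
    qed
    finally show False using X by (simp add: ennreal_le_iff)
  qed
  then have "E \<in> null_sets lborel" using E emE by (auto simp: null_sets_def)
  then have "AE \<eta> in lborel. \<eta> \<notin> E" by (rule AE_not_in)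
  then show ?thesis
  proof eventually_elim
    case (elim \<eta>)
    show ?case
    proof
      assume "norm \<eta> \<le> h"
      with elim have "(\<exists>j. fiber_form \<Phi> I s \<eta> (axis j 1) = \<infinity>) \<or> (\<exists>x. fiber_form \<Phi> I s \<eta> x < ennreal (c * (norm x)\<^sup>2))"
        by (auto simp: E_def not_le not_less top_unique)
      then show "rho_min (A_matrix \<Phi> I s \<eta>) < K * M\<^sup>2 * h powr (2 * k)"
        unfolding A_matrix_eq_rank_one_sum c_def[symmetric]
        by (intro rho_min_rank_one_sum_less c) auto
    qed
  qed
qed

lemma norm_vec_le_sum: "norm x \<le> (\<Sum>k\<in>UNIV. norm (x $ k))" for x :: "'b::real_normed_vector ^ 'n"
  unfolding norm_vec_def by (rule L2_set_le_sum) simp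

lemma zero_order_geI:
  assumes "\<delta> > 0" "AE \<omega> in lborel. norm \<omega> < \<delta> \<longrightarrow> \<bar>F \<omega>\<bar> \<le> C * norm \<omega> powr m"
  shows "ereal m \<le> zero_order F"
  unfolding zero_order_def by (rule Sup_upper) (use assms in blast)

text \<open>
The bounds at the scales \<open>h0 / 2^n\<close> hold simultaneously outside a null set, and every nonzero
frequency \<open>\<eta>\<close> near the origin has norm within a factor \<open>2\<close> of one of these scales.
\<close>

lemma rho_min_zero_order:
  fixes \<Phi> :: "'n::finite \<Rightarrow> (real ^ 'd) functional"
  assumes \<Phi>: "range \<Phi> \<subseteq> sobolev_space s" and I: "I \<subseteq> frequency_lattice - {0}"
    and r: "r > 0" and M: "M > 0" "AE \<omega> in lborel. norm \<omega> < r \<longrightarrow> norm (fourier_vec \<Phi> \<omega>) \<le> M"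
    and prov: "provides_approximation_order s (si_space s (range \<Phi>)) k"
  shows "ereal (2 * k) \<le> zero_order (\<lambda>\<omega>. rho_min (A_matrix \<Phi> I s \<omega>))"
proof -
  have ks: "k > s" using prov by (simp add: provides_approximation_order_def)
  obtain C' where C': "\<And>f h. f \<in> sobolev_space k \<Longrightarrow> h > 0 \<Longrightarrow>
      (INF g\<in>dilate h ` si_space s (range \<Phi>). sobolev_norm s (\<lambda>\<phi>. f \<phi> - g \<phi>)) \<le> C' * h powr (k - s) * sobolev_norm k f"
    using prov unfolding provides_approximation_order_def by blast
  define C where "C = \<bar>C'\<bar>"
  have C0: "C \<ge> 0" by (simp add: C_def)
  have appr: "(INF g\<in>dilate h ` si_space s (range \<Phi>). sobolev_norm s (\<lambda>\<phi>. f \<phi> - g \<phi>)) \<le> C * h powr (k - s) * sobolev_norm k f"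
    if "f \<in> sobolev_space k" "h > 0" for f h
  proof -
    have "C' * h powr (k - s) * sobolev_norm k f \<le> C * h powr (k - s) * sobolev_norm k f"
      by (intro mult_right_mono) (auto simp: C_def sobolev_norm_def)
    then show ?thesis using C'[OF that] by linarith
  qed
  define K where "K = 16 * (C + 1)\<^sup>2 * 2 powr \<bar>2 * k\<bar> * 2 powr \<bar>2 * s\<bar>"
  have K0: "K > 0" unfolding K_def using C0 by simp
  \<comment> \<open>The last term gives \<open>K h^(2k - 2s) \<le> 1\<close> for all \<open>h \<le> h0\<close>, as the exponent is positive.\<close>
  define h0 where "h0 = min (min 1 (r / 2)) ((1 / K) powr (1 / (2 * k - 2 * s)))"
  have h0: "h0 > 0" "h0 \<le> 1" "h0 < r" using r K0 by (auto simp: h0_def)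
  have small: "K * h powr (2 * k - 2 * s) \<le> 1" if "0 < h" "h \<le> h0" for h
  proof -
    have "h powr (2 * k - 2 * s) \<le> ((1 / K) powr (1 / (2 * k - 2 * s))) powr (2 * k - 2 * s)"
      using that ks by (intro powr_mono2) (auto simp: h0_def)
    also have "\<dots> = 1 / K" using ks K0 by (simp add: powr_powr)
    finally show ?thesis using K0 by (simp add: field_simps)
  qed
  define hn where "hn n = h0 / 2 ^ n" for n :: nat
  have hn: "0 < hn n" "hn n \<le> h0" for n using h0(1) by (auto simp: hn_def divide_le_eq)
  have "AE \<eta> in lborel. \<forall>n. norm \<eta> \<le> hn n \<longrightarrow> rho_min (A_matrix \<Phi> I s \<eta>) < K * M\<^sup>2 * hn n powr (2 * k)"
    unfolding AE_all_countable
  proof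
    fix n
    have Mn: "AE \<omega> in lborel. norm \<omega> \<le> hn n \<longrightarrow> norm (fourier_vec \<Phi> \<omega>) \<le> M"
      using M(2) by eventually_elim (use hn(2)[of n] h0(3) in auto)
    show "AE \<eta> in lborel. norm \<eta> \<le> hn n \<longrightarrow> rho_min (A_matrix \<Phi> I s \<eta>) < K * M\<^sup>2 * hn n powr (2 * k)"
      by (rule rho_min_bound_at_scale[OF \<Phi> I hn(1) _ C0 M(1) Mn appr K_def small[OF hn]])
         (use hn[of n] h0(2) in auto)
  qed
  moreover have "AE \<eta> in lborel. \<eta> \<noteq> (0 :: real ^ 'd)" by (rule AE_lborel_singleton)
  ultimately have "AE \<eta> in lborel. norm \<eta> < h0 \<longrightarrow>
      \<bar>rho_min (A_matrix \<Phi> I s \<eta>)\<bar> \<le> K * M\<^sup>2 * 2 powr \<bar>2 * k\<bar> * norm \<eta> powr (2 * k)"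
  proof eventually_elim
    case (elim \<eta>)
    show ?case
    proof
      assume less: "norm \<eta> < h0"
      have pos: "norm \<eta> > 0" using elim(2) by simp
      define P where "P n \<longleftrightarrow> hn n < norm \<eta>" for n
      have "\<exists>n. P n"
      proof -
        obtain n where "(1 / 2) ^ n < norm \<eta> / h0"
          using real_arch_pow_inv[of "norm \<eta> / h0" "1 / 2"] pos h0(1) by auto
        then have "hn n < norm \<eta>" using h0(1) by (simp add: hn_def field_simps power_divide)
        then show ?thesis by (auto simp: P_def)
      qed
      moreover have "\<not> P 0" using less by (simp add: P_def hn_def)
      ultimately obtain n where n: "\<not> P n" "P (Suc n)"
        using exists_least_lemma[of P] by blast
      have "hn (Suc n) = hn n / 2" by (simp add: hn_def)
      then have near: "norm \<eta> \<le> hn n" "hn n \<le> 2 * norm \<eta>" using n by (auto simp: P_def)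
      have w: "hn n powr (2 * k) \<le> 2 powr \<bar>2 * k\<bar> * norm \<eta> powr (2 * k)"
      proof -
        have "2 powr (- \<bar>- (2 * k)\<bar>) * norm \<eta> powr (- (2 * k)) \<le> hn n powr (- (2 * k))"
          using pos near by (intro weight_lower_bound) auto
        then have "inverse (hn n powr (- (2 * k))) \<le> inverse (2 powr (- \<bar>- (2 * k)\<bar>) * norm \<eta> powr (- (2 * k)))"
          using pos by (intro le_imp_inverse_le) auto
        then show ?thesis by (simp add: powr_minus)
      qed
      have "0 \<le> rho_min (A_matrix \<Phi> I s \<eta>)"
        unfolding A_matrix_eq_rank_one_sum by (rule rho_min_rank_one_sum_nonneg) simp
      moreover have "rho_min (A_matrix \<Phi> I s \<eta>) \<le> K * M\<^sup>2 * hn n powr (2 * k)"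
        using elim(1) near(1) less_imp_le by blast
      moreover have "K * M\<^sup>2 * hn n powr (2 * k) \<le> K * M\<^sup>2 * (2 powr \<bar>2 * k\<bar> * norm \<eta> powr (2 * k))"
        using K0 by (intro mult_left_mono w) auto
      ultimately show "\<bar>rho_min (A_matrix \<Phi> I s \<eta>)\<bar> \<le> K * M\<^sup>2 * 2 powr \<bar>2 * k\<bar> * norm \<eta> powr (2 * k)"
        by (simp add: mult.assoc)
    qed
  qed
  then show ?thesis by (rule zero_order_geI[OF h0(1)])
qed

theorem theorem33:
  fixes s :: real
    and \<Phi> :: "'n::finite \<Rightarrow> (real ^ 'd) functional"
    and \<Omega> I :: "(real ^ 'd) set"
  assumes "range \<Phi> \<subseteq> sobolev_space s"
    and "open \<Omega>" and "0 \<in> \<Omega>"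
    and "\<And>i. \<exists>B. AE \<omega> in lborel. \<omega> \<in> \<Omega> \<longrightarrow> norm (fourier_fun (\<Phi> i) \<omega>) \<le> B"
    and "I \<subseteq> (\<lambda>j. (2 * pi) *\<^sub>R j) ` integer_lattice - {0}"
  shows "\<forall>k. provides_approximation_order s (si_space s (range \<Phi>)) k \<longrightarrow>
           ereal k \<le> zero_order (\<lambda>\<omega>. rho_min (A_matrix \<Phi> I s \<omega>)) / 2"
proof (intro allI impI)
  fix k assume k: "provides_approximation_order s (si_space s (range \<Phi>)) k"
  obtain r where r: "r > 0" "ball 0 r \<subseteq> \<Omega>" using assms(2,3) open_contains_ball by blast
  obtain B where B: "\<And>i. AE \<omega> in lborel. \<omega> \<in> \<Omega> \<longrightarrow> norm (fourier_fun (\<Phi> i) \<omega>) \<le> B i"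
    using choice[of "\<lambda>i B. AE \<omega> in lborel. \<omega> \<in> \<Omega> \<longrightarrow> norm (fourier_fun (\<Phi> i) \<omega>) \<le> B"] assms(4) by blast
  define M where "M = (\<Sum>i\<in>UNIV. \<bar>B i\<bar>) + 1"
  have M: "M > 0" by (simp add: M_def add_nonneg_pos sum_nonneg)
  have "AE \<omega> in lborel. \<forall>i\<in>UNIV. \<omega> \<in> \<Omega> \<longrightarrow> norm (fourier_fun (\<Phi> i) \<omega>) \<le> B i"
    by (intro AE_finite_allI B) simp
  then have "AE \<omega> in lborel. norm \<omega> < r \<longrightarrow> norm (fourier_vec \<Phi> \<omega>) \<le> M"
  proof eventually_elim
    case (elim \<omega>)
    show ?case
    proof
      assume "norm \<omega> < r"
      then have "\<omega> \<in> \<Omega>" using r(2) by auto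
      then have "norm (fourier_fun (\<Phi> i) \<omega>) \<le> \<bar>B i\<bar>" for i
        using elim order_trans[OF _ abs_ge_self] by blast
      then have "(\<Sum>i\<in>UNIV. norm (fourier_vec \<Phi> \<omega> $ i)) \<le> (\<Sum>i\<in>UNIV. \<bar>B i\<bar>)"
        by (intro sum_mono) (simp add: fourier_vec_def)
      then show "norm (fourier_vec \<Phi> \<omega>) \<le> M"
        using norm_vec_le_sum[of "fourier_vec \<Phi> \<omega>"] by (simp add: M_def)
    qed
  qed
  then have le: "ereal (2 * k) \<le> zero_order (\<lambda>\<omega>. rho_min (A_matrix \<Phi> I s \<omega>))"
    using assms(1,5) r(1) M k by (intro rho_min_zero_order) (auto simp: frequency_lattice_def)
  then show "ereal k \<le> zero_order (\<lambda>\<omega>. rho_min (A_matrix \<Phi> I s \<omega>)) / 2"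
    by (cases "zero_order (\<lambda>\<omega>. rho_min (A_matrix \<Phi> I s \<omega>))") auto
qed

end
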